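(* For every pair of equipped quantum spaces $\mathfrak{W},\mathfrak{V}\in\mathrm{EQA}$ there exists an arrow of $\mathrm{QA}$ which is an algebra epimorphism $$\underline{hom}_{\mathrm{QA}}[\mathsf{U}\mathfrak{W},\mathsf{U}\mathfrak{V}]\twoheadrightarrow\mathsf{U}\,\underline{hom}_{\mathrm{EQA}}[\mathfrak{W},\mathfrak{V}].$$ Equivalently, the quantum space $\underline{hom}_{\mathrm{QA}}[\mathsf{U}\mathfrak{W},\mathsf{U}\mathfrak{V}]^{op}$ in $\mathrm{QA}^{op}$ contains $\mathsf{U}\,\underline{hom}_{\mathrm{EQA}}[\mathfrak{W},\mathfrak{V}]^{op}$ as a subspace.
   Context: $\Bbbk$ is $\mathbb{R}$ or $\mathbb{C}$; algebras are unital associative $\Bbbk$-algebras. For a finite dimensional vector space $\mathbf{V}$, $\mathbf{V}^{\otimes}$ is its tensor algebra and $I[\mathbf{X}]$ the two-sided ideal generated by $\mathbf{X}\subset\mathbf{V}^{\otimes}$. The category $\mathrm{QA}$ of quadratic algebras: objects are pairs $\mathcal{A}=(\mathbf{A}_1,\mathbf{A})$ with $\mathbf{A}$ an algebra generated by a finite dimensional subspace $\mathbf{A}_1$, such that the kernel of $\mathbf{A}_1^{\otimes}\twoheadrightarrow\mathbf{A}$ is $I[\mathbf{R}]$ for some subspace $\mathbf{R}\subset\mathbf{A}_1^{\otimes 2}$. Arrows are algebra homomorphisms preserving the generating subspaces. The monoidal product is $(\mathbf{A}_1,\mathbf{A})\circ(\mathbf{B}_1,\mathbf{B})=(\mathbf{A}_1\otimes\mathbf{B}_1,\mathbf{A}\circ\mathbf{B})$,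 with $\mathbf{A}\circ\mathbf{B}$ the subalgebra of $\mathbf{A}\otimes\mathbf{B}$ generated by $\mathbf{A}_1\otimes\mathbf{B}_1$; on arrows $\alpha\circ\beta=(\alpha\otimes\beta)|_{\mathbf{A}\circ\mathbf{B}}$. The monoidal category $(\mathrm{QA},\circ)$ has (Manin) internal coHom objects: for $\mathcal{A},\mathcal{B}\in\mathrm{QA}$, $\underline{hom}_{\mathrm{QA}}[\mathcal{B},\mathcal{A}]$ is the quadratic algebra, with generating space $\mathbf{B}_1^{*}\otimes\mathbf{A}_1$, together with the arrow $\delta_{\mathcal{A},\mathcal{B}}:\mathcal{A}\to\underline{hom}_{\mathrm{QA}}[\mathcal{B},\mathcal{A}]\circ\mathcal{B}$ given on generators by $a_i\mapsto\sum_j(b^{j}\otimes a_i)\otimes b_j$ (for bases $\{a_i\}$ of $\mathbf{A}_1$, $\{b_j\}$ of $\mathbf{B}_1$, and dual basis $\{b^j\}$), characterized by the universal property: for every $\mathcal{H}\in\mathrm{QA}$ and arrow $\varphi:\mathcal{A}\to\mathcal{H}\circ\mathcal{B}$ there is a unique arrow $\alpha:\underline{hom}_{\mathrm{QA}}[\mathcal{B},\mathcal{A}]\to\mathcal{H}$ with $\varphi=(\alpha\circ\mathrm{id})\,\delta_{\mathcal{A},\mathcal{B}}$. The category $\mathrm{EQA}$ of equipped quantum spaces is described (up to equivalence) as follows: objects are pairs $\mathfrak{V}=(\mathbf{V},R)$ with $\mathbf{V}$ a finite dimensional $\Bbbk$-vector space and $R:\mathbf{V}^{\otimes 2}\to\mathbf{V}^{\otimes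 2}$ linear; arrows $(\mathbf{V},R)\to(\mathbf{W},S)$ are linear maps $l:\mathbf{V}\to\mathbf{W}$ with $l^{\otimes 2}R=S\,l^{\otimes 2}$. Its monoidal product is $(\mathbf{V},R)\boxtimes(\mathbf{W},S)=(\mathbf{V}\otimes\mathbf{W},R\boxtimes S)$, where $R\boxtimes S=\varphi_{\mathbf{V},\mathbf{W}}^{-1}(R\otimes\mathrm{id}+\mathrm{id}\otimes S)\varphi_{\mathbf{V},\mathbf{W}}$ and $\varphi_{\mathbf{V},\mathbf{W}}:(\mathbf{V}\otimes\mathbf{W})^{\otimes 2}\to\mathbf{V}^{\otimes 2}\otimes\mathbf{W}^{\otimes 2}$ is $v\otimes w\otimes v'\otimes w'\mapsto v\otimes v'\otimes w\otimes w'$; the dual of $\mathfrak{W}=(\mathbf{W},S)$ is $\mathfrak{W}^{\dagger}=(\mathbf{W}^{*},-S^{*})$, with $S^*$ the transpose of $S$ for the factor-by-factor pairing of $(\mathbf{W}^{*})^{\otimes 2}$ with $\mathbf{W}^{\otimes 2}$. The internal coHom objects of $\mathrm{EQA}$ are $\underline{hom}_{\mathrm{EQA}}[\mathfrak{W},\mathfrak{V}]=\mathfrak{W}^{\dagger}\boxtimes\mathfrak{V}$. The functor $\mathsf{U}:\mathrm{EQA}\to\mathrm{QA}$ sends $(\mathbf{V},R)$ to $(\mathbf{V},\mathbf{V}^{\otimes}/I[\operatorname{Im}R])$, and an arrow to its extension to an algebra homomorphism. Quantum spaces are objects $\mathcal{A}^{op}$ of the opposite category $\mathrm{QA}^{op}$;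 an epimorphism $\mathcal{A}\twoheadrightarrow\mathcal{B}$ in $\mathrm{QA}$ is regarded as an inclusion $\mathcal{B}^{op}\hookrightarrow\mathcal{A}^{op}$ of quantum spaces. *)

theory Defs
  imports Complex_Main "HOL-Algebra.Module" "HOL-Algebra.QuotRing" "HOL-Algebra.Subrings" "HOL-Library.Poly_Mapping"
begin

text \<open>
  Vector spaces and unital associative algebras are HOL-Algebra records of type
  \<open>('k, 'a) module\<close>, with an arbitrary carrier set.  For a mere vector space the fields
  \<open>mult\<close> and \<open>one\<close> of the record carry no meaning.  HOL-Algebra's locale \<open>algebra\<close> is not used,
  as it is restricted to commutative algebras.
  Maps are extensional on the carrier of their domain, so that equality of arrows is equality
  of functions.

  The definitions make sense over any field.  The ground field \<open>\<real>\<close> or \<open>\<complex>\<close> is rendered by the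
  class \<open>real_normed_field\<close>, whose instances are, by the Gelfand-Mazur theorem, exactly these
  two fields up to isomorphism.
\<close>

section \<open>Linear algebra over a type of scalars\<close>

definition base_field :: "('k::field, 'k) module" where
  "base_field = \<lparr>carrier = UNIV, monoid.mult = (*), one = 1, ring.zero = 0, add = (+), smult = (*)\<rparr>"

definition vec_space :: "('k::field, 'v, 'x) module_scheme \<Rightarrow> bool" where
  "vec_space V \<longleftrightarrow> Module.module base_field V"

definition lin_subspace :: "('k::field, 'v, 'x) module_scheme \<Rightarrow> 'v set \<Rightarrow> bool" where
  "lin_subspace V N \<longleftrightarrow> submodule N base_field V"

definition lin_span :: "('k::field, 'v, 'x) module_scheme \<Rightarrow> 'v set \<Rightarrow> 'v set" where
  "lin_span V S = \<Inter>{N. lin_subspace V N \<and> S \<subseteq> N}"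

definition fin_dim :: "('k::field, 'v, 'x) module_scheme \<Rightarrow> bool" where
  "fin_dim V \<longleftrightarrow> (\<exists>B. finite B \<and> B \<subseteq> carrier V \<and> lin_span V B = carrier V)"

definition lin_maps ::
  "('k::field, 'v, 'x) module_scheme \<Rightarrow> ('k, 'w, 'y) module_scheme \<Rightarrow> ('v \<Rightarrow> 'w) set" where
  "lin_maps V W = {f \<in> carrier V \<rightarrow>\<^sub>E carrier W.
     (\<forall>x\<in>carrier V. \<forall>y\<in>carrier V. f (x \<oplus>\<^bsub>V\<^esub> y) = f x \<oplus>\<^bsub>W\<^esub> f y) \<and>
     (\<forall>c. \<forall>x\<in>carrier V. f (c \<odot>\<^bsub>V\<^esub> x) = c \<odot>\<^bsub>W\<^esub> f x)}"

definition id_map :: "('k::field, 'v, 'x) module_scheme \<Rightarrow> 'v \<Rightarrow> 'v" where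
  "id_map V = (\<lambda>x\<in>carrier V. x)"

definition dual_space :: "('k::field, 'v, 'x) module_scheme \<Rightarrow> ('k, 'v \<Rightarrow> 'k) module" where
  "dual_space V = \<lparr>carrier = lin_maps V (base_field :: ('k, 'k) module),
     monoid.mult = undefined, one = undefined,
     ring.zero = (\<lambda>x\<in>carrier V. 0), add = (\<lambda>f g. \<lambda>x\<in>carrier V. f x + g x),
     smult = (\<lambda>c f. \<lambda>x\<in>carrier V. c * f x)\<rparr>"

definition dual_bases ::
  "('k::field, 'v, 'x) module_scheme \<Rightarrow> nat \<Rightarrow> (nat \<Rightarrow> 'v) \<Rightarrow> (nat \<Rightarrow> 'v \<Rightarrow> 'k) \<Rightarrow> bool" where
  "dual_bases V n b d \<longleftrightarrow>
     b ` {..<n} \<subseteq> carrier V \<and> lin_span V (b ` {..<n}) = carrier V \<and>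
     d ` {..<n} \<subseteq> carrier (dual_space V) \<and>
     (\<forall>i<n. \<forall>j<n. d i (b j) = (if i = j then 1 else 0))"

definition assoc_algebra :: "('k::field, 'a, 'x) module_scheme \<Rightarrow> bool" where
  "assoc_algebra A \<longleftrightarrow> vec_space A \<and> ring A \<and>
     (\<forall>c. \<forall>x\<in>carrier A. \<forall>y\<in>carrier A.
        (c \<odot>\<^bsub>A\<^esub> x) \<otimes>\<^bsub>A\<^esub> y = c \<odot>\<^bsub>A\<^esub> (x \<otimes>\<^bsub>A\<^esub> y) \<and>
        x \<otimes>\<^bsub>A\<^esub> (c \<odot>\<^bsub>A\<^esub> y) = c \<odot>\<^bsub>A\<^esub> (x \<otimes>\<^bsub>A\<^esub> y))"

definition subalgebra_gen :: "('k::field, 'a, 'x) module_scheme \<Rightarrow> 'a set \<Rightarrow> 'a set" where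
  "subalgebra_gen A S = \<Inter>{B. subring B A \<and> lin_subspace A B \<and> S \<subseteq> B}"

text \<open>
  \<open>A Quot I\<close> with the induced scalar multiplication.  For a vector space \<open>A\<close> and a subspace \<open>I\<close>
  this is the quotient vector space.
\<close>

definition quot_algebra ::
  "('k::field, 'a, 'x) module_scheme \<Rightarrow> 'a set \<Rightarrow> ('k, 'a set) module" where
  "quot_algebra A I = \<lparr>carrier = carrier (A Quot I), monoid.mult = monoid.mult (A Quot I),
     one = one (A Quot I), ring.zero = ring.zero (A Quot I), add = add (A Quot I),
     smult = (\<lambda>c X. \<Union>x\<in>X. I +>\<^bsub>A\<^esub> (c \<odot>\<^bsub>A\<^esub> x))\<rparr>"


section \<open>Tensor products and tensor algebras\<close>

text \<open>
  The vector space with basis \<open>carrier G\<close>, as finitely supported functions; if \<open>G\<close> is a monoid,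
  this is its monoid algebra.
\<close>

definition monoid_algebra :: "('m, 'x) monoid_scheme \<Rightarrow> ('k::field, 'm \<Rightarrow>\<^sub>0 'k) module" where
  "monoid_algebra G = \<lparr>carrier = {p. Poly_Mapping.keys p \<subseteq> carrier G},
     monoid.mult = (\<lambda>p q. \<Sum>x\<in>Poly_Mapping.keys p. \<Sum>y\<in>Poly_Mapping.keys q.
       Poly_Mapping.single (x \<otimes>\<^bsub>G\<^esub> y) (Poly_Mapping.lookup p x * Poly_Mapping.lookup q y)),
     one = Poly_Mapping.single \<one>\<^bsub>G\<^esub> 1, ring.zero = 0, add = (+),
     smult = (\<lambda>c. Poly_Mapping.map ((*) c))\<rparr>"

text \<open>
  \<open>V \<otimes> W\<close> is the free vector space on \<open>V \<times> W\<close> modulo the bilinearity relations.  If \<open>V\<close> and \<open>W\<close>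
  are algebras, the relations span an ideal and the inherited multiplication is
  \<open>(v \<otimes> w) (v' \<otimes> w') = v v' \<otimes> w w'\<close>.
\<close>

definition tensor_rels ::
  "('k::field, 'v, 'x) module_scheme \<Rightarrow> ('k, 'w, 'y) module_scheme \<Rightarrow> ('v \<times> 'w \<Rightarrow>\<^sub>0 'k) set" where
  "tensor_rels V W = lin_span (monoid_algebra (V \<times>\<times> W))
     ({Poly_Mapping.single (v \<oplus>\<^bsub>V\<^esub> v', w) 1 - Poly_Mapping.single (v, w) 1
         - Poly_Mapping.single (v', w) 1
         | v v' w. v \<in> carrier V \<and> v' \<in> carrier V \<and> w \<in> carrier W} \<union>
      {Poly_Mapping.single (v, w \<oplus>\<^bsub>W\<^esub> w') 1 - Poly_Mapping.single (v, w) 1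
         - Poly_Mapping.single (v, w') 1
         | v w w'. v \<in> carrier V \<and> w \<in> carrier W \<and> w' \<in> carrier W} \<union>
      {Poly_Mapping.single (c \<odot>\<^bsub>V\<^esub> v, w) 1 - Poly_Mapping.single (v, w) c
         | c v w. v \<in> carrier V \<and> w \<in> carrier W} \<union>
      {Poly_Mapping.single (v, c \<odot>\<^bsub>W\<^esub> w) 1 - Poly_Mapping.single (v, w) c
         | c v w. v \<in> carrier V \<and> w \<in> carrier W})"

definition tensor ::
  "('k::field, 'v, 'x) module_scheme \<Rightarrow> ('k, 'w, 'y) module_scheme
    \<Rightarrow> ('k, ('v \<times> 'w \<Rightarrow>\<^sub>0 'k) set) module" where
  "tensor V W = quot_algebra (monoid_algebra (V \<times>\<times> W)) (tensor_rels V W)"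

definition pure_tensor ::
  "('k::field, 'v, 'x) module_scheme \<Rightarrow> ('k, 'w, 'y) module_scheme
    \<Rightarrow> 'v \<Rightarrow> 'w \<Rightarrow> ('v \<times> 'w \<Rightarrow>\<^sub>0 'k) set" where
  "pure_tensor V W v w =
     tensor_rels V W +>\<^bsub>(monoid_algebra (V \<times>\<times> W) :: ('k, 'v \<times> 'w \<Rightarrow>\<^sub>0 'k) module)\<^esub>
       Poly_Mapping.single (v, w) 1"

definition tensor_map ::
  "('k::field, 'v, 'x) module_scheme \<Rightarrow> ('k, 'w, 'y) module_scheme
    \<Rightarrow> ('k, 'v', 'x') module_scheme \<Rightarrow> ('k, 'w', 'y') module_scheme
    \<Rightarrow> ('v \<Rightarrow> 'v') \<Rightarrow> ('w \<Rightarrow> 'w') \<Rightarrow> ('v \<times> 'w \<Rightarrow>\<^sub>0 'k) set \<Rightarrow> ('v' \<times> 'w' \<Rightarrow>\<^sub>0 'k) set" where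
  "tensor_map V W V' W' f g = (THE h. h \<in> lin_maps (tensor V W) (tensor V' W') \<and>
     (\<forall>v\<in>carrier V. \<forall>w\<in>carrier W.
        h (pure_tensor V W v w) = pure_tensor V' W' (f v) (g w)))"

text \<open>
  The tensor algebra of \<open>V\<close> is the free algebra on the set \<open>carrier V\<close> (the monoid algebra of
  the words in \<open>V\<close>) modulo the linearity relations.
\<close>

definition words :: "('k, 'v, 'x) module_scheme \<Rightarrow> 'v list monoid" where
  "words V = \<lparr>carrier = lists (carrier V), monoid.mult = (@), one = []\<rparr>"

definition tensor_algebra_rels :: "('k::field, 'v, 'x) module_scheme \<Rightarrow> ('v list \<Rightarrow>\<^sub>0 'k) set" where
  "tensor_algebra_rels V = Idl\<^bsub>(monoid_algebra (words V) :: ('k, 'v list \<Rightarrow>\<^sub>0 'k) module)\<^esub>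
     ({Poly_Mapping.single [v \<oplus>\<^bsub>V\<^esub> v'] 1 - Poly_Mapping.single [v] 1 - Poly_Mapping.single [v'] 1
         | v v'. v \<in> carrier V \<and> v' \<in> carrier V} \<union>
      {Poly_Mapping.single [c \<odot>\<^bsub>V\<^esub> v] 1 - Poly_Mapping.single [v] c
         | c v. v \<in> carrier V})"

definition tensor_algebra ::
  "('k::field, 'v, 'x) module_scheme \<Rightarrow> ('k, ('v list \<Rightarrow>\<^sub>0 'k) set) module" where
  "tensor_algebra V = quot_algebra (monoid_algebra (words V)) (tensor_algebra_rels V)"

definition tensor_incl ::
  "('k::field, 'v, 'x) module_scheme \<Rightarrow> 'v \<Rightarrow> ('v list \<Rightarrow>\<^sub>0 'k) set" where
  "tensor_incl V v =
     tensor_algebra_rels V +>\<^bsub>(monoid_algebra (words V) :: ('k, 'v list \<Rightarrow>\<^sub>0 'k) module)\<^esub>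
       Poly_Mapping.single [v] 1"

text \<open>\<open>v \<otimes> v'\<close> in the tensor square of \<open>V\<close>, which is the degree two component of its tensor algebra.\<close>

definition sq_tensor ::
  "('k::field, 'v, 'x) module_scheme \<Rightarrow> 'v \<Rightarrow> 'v \<Rightarrow> ('v list \<Rightarrow>\<^sub>0 'k) set" where
  "sq_tensor V v v' = tensor_incl V v \<otimes>\<^bsub>tensor_algebra V\<^esub> tensor_incl V v'"

definition tensor_square ::
  "('k::field, 'v, 'x) module_scheme \<Rightarrow> ('k, ('v list \<Rightarrow>\<^sub>0 'k) set) module" where
  "tensor_square V = (tensor_algebra V)\<lparr>carrier := lin_span (tensor_algebra V)
     {sq_tensor V v v' | v v'. v \<in> carrier V \<and> v' \<in> carrier V}\<rparr>"


section \<open>Quadratic algebras\<close>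

record ('k, 'a) qalg = "('k, 'a) module" +
  gens :: "'a set"

definition gen_space :: "('k, 'a) qalg \<Rightarrow> ('k, 'a) qalg" where
  "gen_space A = A\<lparr>carrier := gens A\<rparr>"

definition quadratic_algebra :: "('k::field, 'a) qalg \<Rightarrow> bool" where
  "quadratic_algebra A \<longleftrightarrow> assoc_algebra A \<and>
     lin_subspace A (gens A) \<and> fin_dim (gen_space A) \<and> subalgebra_gen A (gens A) = carrier A \<and>
     (\<exists>\<pi> \<in> ring_hom (tensor_algebra (gen_space A)) A \<inter> lin_maps (tensor_algebra (gen_space A)) A.
        (\<forall>a\<in>gens A. \<pi> (tensor_incl (gen_space A) a) = a) \<and>
        (\<exists>R. lin_subspace (tensor_square (gen_space A)) R \<and>
             a_kernel (tensor_algebra (gen_space A)) A \<pi> = Idl\<^bsub>tensor_algebra (gen_space A)\<^esub> R))"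

definition QA_hom :: "('k::field, 'a) qalg \<Rightarrow> ('k, 'b) qalg \<Rightarrow> ('a \<Rightarrow> 'b) set" where
  "QA_hom A B = {f \<in> ring_hom A B \<inter> lin_maps A B. f ` gens A \<subseteq> gens B}"

definition QA_prod ::
  "('k::field, 'a) qalg \<Rightarrow> ('k, 'b) qalg \<Rightarrow> ('k, ('a \<times> 'b \<Rightarrow>\<^sub>0 'k) set) qalg" where
  "QA_prod A B =
    (let P = tensor A B;
         G = lin_span P {pure_tensor A B a b | a b. a \<in> gens A \<and> b \<in> gens B}
     in \<lparr>carrier = subalgebra_gen P G, monoid.mult = monoid.mult P, one = one P,
         ring.zero = ring.zero P, add = add P, smult = smult P, gens = G\<rparr>)"

definition QA_prod_map ::
  "('k::field, 'a) qalg \<Rightarrow> ('k, 'b) qalg \<Rightarrow> ('k, 'a') qalg \<Rightarrow> ('k, 'b') qalg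
    \<Rightarrow> ('a \<Rightarrow> 'a') \<Rightarrow> ('b \<Rightarrow> 'b') \<Rightarrow> ('a \<times> 'b \<Rightarrow>\<^sub>0 'k) set \<Rightarrow> ('a' \<times> 'b' \<Rightarrow>\<^sub>0 'k) set" where
  "QA_prod_map A B A' B' \<alpha> \<beta> = restrict (tensor_map A B A' B' \<alpha> \<beta>) (carrier (QA_prod A B))"

text \<open>
  \<open>H\<close>, with generating space \<open>B\<^sub>1\<^sup>* \<otimes> A\<^sub>1\<close> via the linear isomorphism \<open>\<iota>\<close>, and \<open>\<delta> : A \<rightarrow> H \<circ> B\<close> are
  an internal coHom object of \<open>B\<close> and \<open>A\<close>.  Like every finitely generated algebra, a quadratic
  algebra has countable dimension, hence an isomorphic copy whose carrier is a subset of
  \<open>nat \<Rightarrow> 'k\<close>; so it is enough to let the test objects \<open>X\<close> range over that type.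
\<close>

definition QA_coHom ::
  "('k::field, 'b) qalg \<Rightarrow> ('k, 'a) qalg \<Rightarrow> ('k, 'h) qalg
    \<Rightarrow> ((('b \<Rightarrow> 'k) \<times> 'a \<Rightarrow>\<^sub>0 'k) set \<Rightarrow> 'h) \<Rightarrow> ('a \<Rightarrow> ('h \<times> 'b \<Rightarrow>\<^sub>0 'k) set) \<Rightarrow> bool" where
  "QA_coHom B A H \<iota> \<delta> \<longleftrightarrow> quadratic_algebra H \<and>
     (let B\<^sub>1' = dual_space (gen_space B); A\<^sub>1 = gen_space A in
        \<iota> \<in> lin_maps (tensor B\<^sub>1' A\<^sub>1) (gen_space H) \<and>
        bij_betw \<iota> (carrier (tensor B\<^sub>1' A\<^sub>1)) (gens H) \<and>
        \<delta> \<in> QA_hom A (QA_prod H B) \<and>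
        (\<forall>n b d. dual_bases (gen_space B) n b d \<longrightarrow>
           (\<forall>a\<in>gens A. \<delta> a =
             (\<Oplus>\<^bsub>QA_prod H B\<^esub>j\<in>{..<n}. pure_tensor H B (\<iota> (pure_tensor B\<^sub>1' A\<^sub>1 (d j) a)) (b j))))) \<and>
     (\<forall>(X :: ('k, nat \<Rightarrow> 'k) qalg) \<phi>.
        quadratic_algebra X \<and> \<phi> \<in> QA_hom A (QA_prod X B) \<longrightarrow>
        (\<exists>!\<alpha>. \<alpha> \<in> QA_hom H X \<and>
           \<phi> = compose (carrier A) (QA_prod_map H B X B \<alpha> (id_map B)) \<delta>))"

definition QA_epi :: "('k::field, 'a) qalg \<Rightarrow> ('k, 'b) qalg \<Rightarrow> ('a \<Rightarrow> 'b) \<Rightarrow> bool" where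
  "QA_epi A B f \<longleftrightarrow> quadratic_algebra A \<and> quadratic_algebra B \<and>
     f \<in> QA_hom A B \<and> f ` carrier A = carrier B"

text \<open>\<open>B\<^sup>o\<^sup>p\<close> is a subspace of the quantum space \<open>A\<^sup>o\<^sup>p\<close>.\<close>

definition quantum_subspace :: "('k::field, 'b) qalg \<Rightarrow> ('k, 'a) qalg \<Rightarrow> bool" where
  "quantum_subspace B A \<longleftrightarrow> (\<exists>f. QA_epi A B f)"


section \<open>Equipped quantum spaces\<close>

type_synonym ('k, 'v) equipped =
  "('k, 'v) module \<times> (('v list \<Rightarrow>\<^sub>0 'k) set \<Rightarrow> ('v list \<Rightarrow>\<^sub>0 'k) set)"

definition EQA_object :: "('k::field, 'v) equipped \<Rightarrow> bool" where
  "EQA_object = (\<lambda>(V, R). vec_space V \<and> fin_dim V \<and> R \<in> lin_maps (tensor_square V) (tensor_square V))"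

text \<open>The shuffle \<open>v \<otimes> w \<otimes> v' \<otimes> w' \<mapsto> v \<otimes> v' \<otimes> w \<otimes> w'\<close>.\<close>

definition shuffle_map ::
  "('k::field, 'v) module \<Rightarrow> ('k, 'w) module
    \<Rightarrow> (('v \<times> 'w \<Rightarrow>\<^sub>0 'k) set list \<Rightarrow>\<^sub>0 'k) set
    \<Rightarrow> (('v list \<Rightarrow>\<^sub>0 'k) set \<times> ('w list \<Rightarrow>\<^sub>0 'k) set \<Rightarrow>\<^sub>0 'k) set" where
  "shuffle_map V W = (THE h.
     h \<in> lin_maps (tensor_square (tensor V W)) (tensor (tensor_square V) (tensor_square W)) \<and>
     (\<forall>v\<in>carrier V. \<forall>w\<in>carrier W. \<forall>v'\<in>carrier V. \<forall>w'\<in>carrier W.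
        h (sq_tensor (tensor V W) (pure_tensor V W v w) (pure_tensor V W v' w')) =
        pure_tensor (tensor_square V) (tensor_square W) (sq_tensor V v v') (sq_tensor W w w')))"

definition EQA_prod ::
  "('k::field, 'v) equipped \<Rightarrow> ('k, 'w) equipped \<Rightarrow> ('k, ('v \<times> 'w \<Rightarrow>\<^sub>0 'k) set) equipped" where
  "EQA_prod = (\<lambda>(V, R) (W, S).
    (let V2 = tensor_square V; W2 = tensor_square W; P = tensor_square (tensor V W);
         \<phi> = shuffle_map V W
     in (tensor V W,
         \<lambda>x\<in>carrier P. the_inv_into (carrier P) \<phi>
           (tensor_map V2 W2 V2 W2 R (id_map W2) (\<phi> x) \<oplus>\<^bsub>tensor V2 W2\<^esub>
            tensor_map V2 W2 V2 W2 (id_map V2) S (\<phi> x)))))"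

text \<open>The factor-by-factor pairing, \<open>\<langle>f \<otimes> f', w \<otimes> w'\<rangle> = f(w) f'(w')\<close>.\<close>

definition sq_pairing ::
  "('k::field, 'w) module \<Rightarrow> (('w \<Rightarrow> 'k) list \<Rightarrow>\<^sub>0 'k) set \<Rightarrow> ('w list \<Rightarrow>\<^sub>0 'k) set \<Rightarrow> 'k" where
  "sq_pairing W = (THE \<beta>.
     \<beta> \<in> lin_maps (tensor_square (dual_space W)) (dual_space (tensor_square W)) \<and>
     (\<forall>f\<in>carrier (dual_space W). \<forall>f'\<in>carrier (dual_space W). \<forall>w\<in>carrier W. \<forall>w'\<in>carrier W.
        \<beta> (sq_tensor (dual_space W) f f') (sq_tensor W w w') = f w * f' w'))"

definition sq_transpose ::
  "('k::field, 'w) module \<Rightarrow> (('w list \<Rightarrow>\<^sub>0 'k) set \<Rightarrow> ('w list \<Rightarrow>\<^sub>0 'k) set)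
    \<Rightarrow> (('w \<Rightarrow> 'k) list \<Rightarrow>\<^sub>0 'k) set \<Rightarrow> (('w \<Rightarrow> 'k) list \<Rightarrow>\<^sub>0 'k) set" where
  "sq_transpose W S = (THE T.
     T \<in> lin_maps (tensor_square (dual_space W)) (tensor_square (dual_space W)) \<and>
     (\<forall>x\<in>carrier (tensor_square (dual_space W)). \<forall>y\<in>carrier (tensor_square W).
        sq_pairing W (T x) y = sq_pairing W x (S y)))"

definition EQA_dual :: "('k::field, 'w) equipped \<Rightarrow> ('k, 'w \<Rightarrow> 'k) equipped" where
  "EQA_dual = (\<lambda>(W, S). (dual_space W,
     \<lambda>x\<in>carrier (tensor_square (dual_space W)).
       \<ominus>\<^bsub>tensor_square (dual_space W)\<^esub> sq_transpose W S x))"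

definition EQA_coHom ::
  "('k::field, 'w) equipped \<Rightarrow> ('k, 'v) equipped
    \<Rightarrow> ('k, (('w \<Rightarrow> 'k) \<times> 'v \<Rightarrow>\<^sub>0 'k) set) equipped" where
  "EQA_coHom \<WW> \<VV> = EQA_prod (EQA_dual \<WW>) \<VV>"

text \<open>The functor \<open>U\<close> on objects.\<close>

definition U_obj :: "('k::field, 'v) equipped \<Rightarrow> ('k, ('v list \<Rightarrow>\<^sub>0 'k) set set) qalg" where
  "U_obj = (\<lambda>(V, R).
    (let T = tensor_algebra V; I = Idl\<^bsub>T\<^esub> (R ` carrier (tensor_square V)); Q = quot_algebra T I
     in \<lparr>carrier = carrier Q, monoid.mult = monoid.mult Q, one = one Q, ring.zero = ring.zero Q,
         add = add Q, smult = smult Q, gens = {I +>\<^bsub>T\<^esub> tensor_incl V v | v. v \<in> carrier V}\<rparr>))"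

end

theory Submission
  imports Defs "HOL-Library.Countable_Set"
begin

text \<open>
  Write \<open>A = U(V, R)\<close>, \<open>B = U(W, S)\<close> and let \<open>E = U(W\<^sup>* \<otimes> V, Q)\<close> be the image under \<open>U\<close> of the internal
  coHom object of equipped spaces.  The epimorphism onto \<open>E\<close> comes from the universal property of \<open>H\<close>,
  applied to a coaction of \<open>E\<close>.  With dual bases \<open>b\<^sub>j\<close>, \<open>d\<^sub>j\<close> of \<open>W\<close> and \<open>W\<^sup>*\<close>, the assignment
  \<open>v \<mapsto> \<Sum>\<^sub>j (d\<^sub>j \<otimes> v) \<otimes> b\<^sub>j\<close> extends to an algebra homomorphism from the tensor algebra of \<open>V\<close> to
  \<open>E \<otimes> B\<close>.  In degree two it is \<open>t \<mapsto> \<Sum>\<^sub>q \<mu>(D\<^sub>q, t) \<otimes> B\<^sub>q\<close>, where \<open>B\<^sub>q\<close> and \<open>D\<^sub>q\<close> are the induced dual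
  bases of the tensor squares and \<open>\<mu>(x, t)\<close> is the class in \<open>E\<close> of \<open>x \<otimes> t\<close> with its factors shuffled
  back.  The relations of \<open>E\<close> say \<open>\<mu>(x, R t) = \<mu>(S\<^sup>* x, t)\<close>, and expanding \<open>S\<^sup>* D\<^sub>q\<close> in the basis \<open>D\<close> moves
  the transpose to the other side: \<open>R t\<close> is sent to \<open>\<Sum>\<^sub>q \<mu>(D\<^sub>q, t) \<otimes> S B\<^sub>q\<close>, which vanishes because
  \<open>S B\<^sub>q = 0\<close> in \<open>B\<close>.  So there is an arrow \<open>\<phi> : A \<rightarrow> E \<circ> B\<close> (lemma \<open>coaction_exists\<close>).

  The universal property yields \<open>\<alpha> : H \<rightarrow> E\<close> with \<open>\<phi> = (\<alpha> \<circ> id) \<delta>\<close>.  Relations of degree two leave the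
  degree one part of \<open>B\<close> untouched, so each \<open>d\<^sub>j\<close> extends to a functional on \<open>B\<close>; applied to the second
  factor of \<open>\<phi>(v)\<close> it gives \<open>d\<^sub>j \<otimes> v\<close>, which is therefore in the image of \<open>\<alpha>\<close>.  These elements generate
  \<open>E\<close>, so \<open>\<alpha>\<close> is onto (lemma \<open>coHom_arrow_surjective\<close>).

  The universal property speaks of test objects with carrier in \<open>nat \<Rightarrow> 'k\<close>, so the argument is carried
  out for a copy of \<open>E\<close> there.  The copy exists because \<open>E\<close> has a countable spanning set
  (lemmas \<open>tensor_algebra_countable_span\<close>, \<open>countable_span_injection\<close>), and it is quadratic because
  being quadratic can be checked on a presentation by an abstract space of generators
  (lemma \<open>quadratic_algebra_presented\<close>).

  The remaining work makes the quotient constructions usable: universal properties of quotients, tensor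
  products and tensor algebras, and of the tensor square as a subspace of the tensor algebra
  (lemma \<open>tensor_square_lift\<close>).  From these follow existence and uniqueness of the shuffle, the pairing
  and the transpose, which are defined by descriptions.
\<close>

section \<open>Vector spaces\<close>

lemma base_field_simps [simp]:
  "carrier base_field = UNIV" "\<zero>\<^bsub>base_field\<^esub> = 0" "\<one>\<^bsub>base_field\<^esub> = 1"
  "a \<oplus>\<^bsub>base_field\<^esub> b = a + b" "a \<otimes>\<^bsub>base_field\<^esub> b = a * b" "a \<odot>\<^bsub>base_field\<^esub> b = a * b"
  by (simp_all add: base_field_def)

lemma cring_base_field: "cring (base_field :: ('k::field, 'k) module)"
proof (rule cringI)
  show "abelian_group (base_field :: ('k::field, 'k) module)"
  proof (rule abelian_groupI)
    fix x :: 'k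
    show "\<exists>y\<in>carrier base_field. y \<oplus>\<^bsub>base_field\<^esub> x = \<zero>\<^bsub>base_field\<^esub>"
      by (rule bexI[of _ "-x"]) auto
  qed (simp_all add: add.assoc add.commute)
  show "comm_monoid (base_field :: ('k::field, 'k) module)"
    by (rule comm_monoidI) (simp_all add: mult.assoc mult.commute)
qed (simp add: distrib_right)

lemma vec_spaceI:
  fixes V :: "('k::field, 'v, 'x) module_scheme"
  assumes "\<zero>\<^bsub>V\<^esub> \<in> carrier V"
    and "\<And>x y. x \<in> carrier V \<Longrightarrow> y \<in> carrier V \<Longrightarrow> x \<oplus>\<^bsub>V\<^esub> y \<in> carrier V"
    and "\<And>c x. x \<in> carrier V \<Longrightarrow> c \<odot>\<^bsub>V\<^esub> x \<in> carrier V"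
    and "\<And>x y z. x \<in> carrier V \<Longrightarrow> y \<in> carrier V \<Longrightarrow> z \<in> carrier V \<Longrightarrow>
           (x \<oplus>\<^bsub>V\<^esub> y) \<oplus>\<^bsub>V\<^esub> z = x \<oplus>\<^bsub>V\<^esub> (y \<oplus>\<^bsub>V\<^esub> z)"
    and "\<And>x y. x \<in> carrier V \<Longrightarrow> y \<in> carrier V \<Longrightarrow> x \<oplus>\<^bsub>V\<^esub> y = y \<oplus>\<^bsub>V\<^esub> x"
    and "\<And>x. x \<in> carrier V \<Longrightarrow> \<zero>\<^bsub>V\<^esub> \<oplus>\<^bsub>V\<^esub> x = x"
    and "\<And>x. x \<in> carrier V \<Longrightarrow> (- 1) \<odot>\<^bsub>V\<^esub> x \<oplus>\<^bsub>V\<^esub> x = \<zero>\<^bsub>V\<^esub>"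
    and "\<And>a b x. x \<in> carrier V \<Longrightarrow> (a + b) \<odot>\<^bsub>V\<^esub> x = a \<odot>\<^bsub>V\<^esub> x \<oplus>\<^bsub>V\<^esub> b \<odot>\<^bsub>V\<^esub> x"
    and "\<And>a x y. x \<in> carrier V \<Longrightarrow> y \<in> carrier V \<Longrightarrow>
           a \<odot>\<^bsub>V\<^esub> (x \<oplus>\<^bsub>V\<^esub> y) = a \<odot>\<^bsub>V\<^esub> x \<oplus>\<^bsub>V\<^esub> a \<odot>\<^bsub>V\<^esub> y"
    and "\<And>a b x. x \<in> carrier V \<Longrightarrow> (a * b) \<odot>\<^bsub>V\<^esub> x = a \<odot>\<^bsub>V\<^esub> (b \<odot>\<^bsub>V\<^esub> x)"
    and "\<And>x. x \<in> carrier V \<Longrightarrow> 1 \<odot>\<^bsub>V\<^esub> x = x"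
  shows "vec_space V"
  unfolding vec_space_def
proof (rule moduleI)
  show "abelian_group V"
  proof (rule abelian_groupI)
    show "\<exists>y\<in>carrier V. y \<oplus>\<^bsub>V\<^esub> x = \<zero>\<^bsub>V\<^esub>" if "x \<in> carrier V" for x
      using assms(3)[OF that, of "-1"] assms(7)[OF that] by (rule rev_bexI)
  qed (fact assms)+
  show "cring (base_field :: ('k, 'k) module)"
    by (rule cring_base_field)
qed (simp_all only: base_field_simps assms(3,8-11))

text \<open>The vector space axioms, and their first consequences, as conditional rewrite rules.\<close>

context
  fixes V :: "('k::field, 'v, 'x) module_scheme"
  assumes V: "vec_space V"
begin

lemma vs_module: "Module.module base_field V"
  using V by (simp add: vec_space_def)

lemma vs_abelian_group: "abelian_group V"
  using vs_module by (simp add: module_def)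

interpretation Module.module base_field V
  by (rule vs_module)

lemma vs_zero_closed [simp]: "\<zero>\<^bsub>V\<^esub> \<in> carrier V"
  by simp

lemma vs_add_closed [simp]: "x \<in> carrier V \<Longrightarrow> y \<in> carrier V \<Longrightarrow> x \<oplus>\<^bsub>V\<^esub> y \<in> carrier V"
  by simp

lemma vs_smult_closed [simp]: "x \<in> carrier V \<Longrightarrow> c \<odot>\<^bsub>V\<^esub> x \<in> carrier V"
  using smult_closed by simp

lemma vs_add_assoc:
  "x \<in> carrier V \<Longrightarrow> y \<in> carrier V \<Longrightarrow> z \<in> carrier V \<Longrightarrow>
   (x \<oplus>\<^bsub>V\<^esub> y) \<oplus>\<^bsub>V\<^esub> z = x \<oplus>\<^bsub>V\<^esub> (y \<oplus>\<^bsub>V\<^esub> z)"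
  by (rule a_assoc)

lemma vs_add_comm: "x \<in> carrier V \<Longrightarrow> y \<in> carrier V \<Longrightarrow> x \<oplus>\<^bsub>V\<^esub> y = y \<oplus>\<^bsub>V\<^esub> x"
  by (rule a_comm)

lemma vs_add_left_comm:
  "x \<in> carrier V \<Longrightarrow> y \<in> carrier V \<Longrightarrow> z \<in> carrier V \<Longrightarrow>
   x \<oplus>\<^bsub>V\<^esub> (y \<oplus>\<^bsub>V\<^esub> z) = y \<oplus>\<^bsub>V\<^esub> (x \<oplus>\<^bsub>V\<^esub> z)"
  by (rule a_lcomm)

lemma vs_zero_add [simp]: "x \<in> carrier V \<Longrightarrow> \<zero>\<^bsub>V\<^esub> \<oplus>\<^bsub>V\<^esub> x = x"
  by simp

lemma vs_add_zero [simp]: "x \<in> carrier V \<Longrightarrow> x \<oplus>\<^bsub>V\<^esub> \<zero>\<^bsub>V\<^esub> = x"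
  by simp

lemma vs_add_smult: "x \<in> carrier V \<Longrightarrow> (a + b) \<odot>\<^bsub>V\<^esub> x = a \<odot>\<^bsub>V\<^esub> x \<oplus>\<^bsub>V\<^esub> b \<odot>\<^bsub>V\<^esub> x"
  using smult_l_distr by simp

lemma vs_smult_add:
  "x \<in> carrier V \<Longrightarrow> y \<in> carrier V \<Longrightarrow>
   a \<odot>\<^bsub>V\<^esub> (x \<oplus>\<^bsub>V\<^esub> y) = a \<odot>\<^bsub>V\<^esub> x \<oplus>\<^bsub>V\<^esub> a \<odot>\<^bsub>V\<^esub> y"
  using smult_r_distr by simp

lemma vs_smult_smult [simp]: "x \<in> carrier V \<Longrightarrow> a \<odot>\<^bsub>V\<^esub> (b \<odot>\<^bsub>V\<^esub> x) = (a * b) \<odot>\<^bsub>V\<^esub> x"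
  using smult_assoc1[of a b x] by simp

lemma vs_one_smult [simp]: "x \<in> carrier V \<Longrightarrow> 1 \<odot>\<^bsub>V\<^esub> x = x"
  using smult_one by simp

lemma vs_zero_smult [simp]: "x \<in> carrier V \<Longrightarrow> 0 \<odot>\<^bsub>V\<^esub> x = \<zero>\<^bsub>V\<^esub>"
  using smult_l_null by simp

lemma vs_smult_zero [simp]: "a \<odot>\<^bsub>V\<^esub> \<zero>\<^bsub>V\<^esub> = \<zero>\<^bsub>V\<^esub>"
  using smult_r_null by simp

lemma vs_neg: "x \<in> carrier V \<Longrightarrow> \<ominus>\<^bsub>V\<^esub> x = (- 1) \<odot>\<^bsub>V\<^esub> x"
proof -
  assume x: "x \<in> carrier V"
  have "(- 1) \<odot>\<^bsub>V\<^esub> x \<oplus>\<^bsub>V\<^esub> x = (- 1 + 1) \<odot>\<^bsub>V\<^esub> x"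
    using x by (subst vs_add_smult) simp_all
  then show ?thesis
    using x minus_equality[of "(- 1) \<odot>\<^bsub>V\<^esub> x" x] by simp
qed

lemma vs_add_neg [simp]: "x \<in> carrier V \<Longrightarrow> x \<oplus>\<^bsub>V\<^esub> \<ominus>\<^bsub>V\<^esub> x = \<zero>\<^bsub>V\<^esub>"
  by (rule r_neg)

lemma vs_minus_eq_zero_iff:
  assumes x: "x \<in> carrier V" and y: "y \<in> carrier V"
  shows "x \<oplus>\<^bsub>V\<^esub> (- 1) \<odot>\<^bsub>V\<^esub> y = \<zero>\<^bsub>V\<^esub> \<longleftrightarrow> x = y"
proof
  have "(x \<oplus>\<^bsub>V\<^esub> (- 1) \<odot>\<^bsub>V\<^esub> y) \<oplus>\<^bsub>V\<^esub> y = x"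
    using x y by (simp add: vs_neg[symmetric] vs_add_assoc l_neg)
  then show "x = y" if "x \<oplus>\<^bsub>V\<^esub> (- 1) \<odot>\<^bsub>V\<^esub> y = \<zero>\<^bsub>V\<^esub>"
    using that y by simp
qed (use y in \<open>simp add: vs_neg[symmetric]\<close>)

lemma vs_neg_add: "x \<in> carrier V \<Longrightarrow> (- 1) \<odot>\<^bsub>V\<^esub> x \<oplus>\<^bsub>V\<^esub> x = \<zero>\<^bsub>V\<^esub>"
  by (simp add: vs_neg[symmetric] l_neg)

lemma vs_add_neg1: "x \<in> carrier V \<Longrightarrow> x \<oplus>\<^bsub>V\<^esub> (- 1) \<odot>\<^bsub>V\<^esub> x = \<zero>\<^bsub>V\<^esub>"
  by (simp add: vs_minus_eq_zero_iff)

lemma vs_finsum_closed [simp]: "(\<And>i. i \<in> I \<Longrightarrow> f i \<in> carrier V) \<Longrightarrow> finsum V f I \<in> carrier V"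
  by (rule finsum_closed) auto

lemma vs_finsum_cong:
  "I = J \<Longrightarrow> (\<And>i. i \<in> J \<Longrightarrow> f i = g i) \<Longrightarrow> (\<And>i. i \<in> J \<Longrightarrow> g i \<in> carrier V) \<Longrightarrow>
   finsum V f I = finsum V g J"
  by (rule finsum_cong') auto

lemma vs_finsum_insert:
  "finite I \<Longrightarrow> i \<notin> I \<Longrightarrow> f i \<in> carrier V \<Longrightarrow> (\<And>j. j \<in> I \<Longrightarrow> f j \<in> carrier V) \<Longrightarrow>
   finsum V f (insert i I) = f i \<oplus>\<^bsub>V\<^esub> finsum V f I"
  by (rule finsum_insert) auto

lemma vs_finsum_empty [simp]: "finsum V f {} = \<zero>\<^bsub>V\<^esub>"
  by simp

lemma vs_finsum_add:
  "(\<And>i. i \<in> I \<Longrightarrow> f i \<in> carrier V) \<Longrightarrow> (\<And>i. i \<in> I \<Longrightarrow> g i \<in> carrier V) \<Longrightarrow>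
   finsum V (\<lambda>i. f i \<oplus>\<^bsub>V\<^esub> g i) I = finsum V f I \<oplus>\<^bsub>V\<^esub> finsum V g I"
  by (rule finsum_addf) auto

lemma vs_finsum_zero: "(\<And>i. i \<in> I \<Longrightarrow> f i = \<zero>\<^bsub>V\<^esub>) \<Longrightarrow> finsum V f I = \<zero>\<^bsub>V\<^esub>"
  using add.finprod_one_eqI by blast

lemma vs_finsum_mono_neutral:
  "finite J \<Longrightarrow> I \<subseteq> J \<Longrightarrow> (\<And>i. i \<in> I \<Longrightarrow> f i \<in> carrier V) \<Longrightarrow>
   (\<And>i. i \<in> J - I \<Longrightarrow> f i = \<zero>\<^bsub>V\<^esub>) \<Longrightarrow> finsum V f J = finsum V f I"
  by (rule add.finprod_mono_neutral_cong_left[symmetric], simp_all)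
    (metis Diff_iff Pi_I vs_zero_closed)

lemma vs_finsum_single:
  assumes "finite I" "i \<in> I" "f i \<in> carrier V" "\<And>j. j \<in> I \<Longrightarrow> j \<noteq> i \<Longrightarrow> f j = \<zero>\<^bsub>V\<^esub>"
  shows "finsum V f I = f i"
proof -
  have "finsum V f I = finsum V f {i}"
    by (rule vs_finsum_mono_neutral) (use assms in auto)
  also have "\<dots> = f i"
    using vs_finsum_insert[of "{}" i f] assms by simp
  finally show ?thesis .
qed

end

lemma vs_finsum_swap:
  assumes V: "vec_space V" and "finite I" "finite J" and f: "\<And>i j. i \<in> I \<Longrightarrow> j \<in> J \<Longrightarrow> f i j \<in> carrier V"
  shows "finsum V (\<lambda>i. finsum V (f i) J) I = finsum V (\<lambda>j. finsum V (\<lambda>i. f i j) I) J"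
  using \<open>finite I\<close> f
proof (induction I)
  case empty
  show ?case
    using V by (simp add: vs_finsum_zero[OF V])
next
  case (insert i I)
  have "finsum V (\<lambda>j. finsum V (\<lambda>i. f i j) (insert i I)) J
    = finsum V (\<lambda>j. f i j \<oplus>\<^bsub>V\<^esub> finsum V (\<lambda>i. f i j) I) J"
    using insert V by (intro vs_finsum_cong) (auto simp: vs_finsum_insert)
  also have "\<dots> = finsum V (f i) J \<oplus>\<^bsub>V\<^esub> finsum V (\<lambda>j. finsum V (\<lambda>i. f i j) I) J"
    using insert V by (intro vs_finsum_add) auto
  also have "\<dots> = finsum V (f i) J \<oplus>\<^bsub>V\<^esub> finsum V (\<lambda>i. finsum V (f i) J) I"
    using insert by simp
  also have "\<dots> = finsum V (\<lambda>i. finsum V (f i) J) (insert i I)"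
    using insert V by (intro vs_finsum_insert[symmetric]) auto
  finally show ?case ..
qed

lemma vs_finsum_Times:
  assumes V: "vec_space V" and I: "finite I" and J: "finite J" and f: "\<And>i j. i \<in> I \<Longrightarrow> j \<in> J \<Longrightarrow> f i j \<in> carrier V"
  shows "finsum V (\<lambda>i. finsum V (f i) J) I = finsum V (\<lambda>(i, j). f i j) (I \<times> J)"
  using I f
proof (induction I)
  case empty
  then show ?case
    using V by simp
next
  case (insert i I)
  interpret abelian_group V
    by (rule vs_abelian_group[OF V])
  have "finsum V (\<lambda>(i, j). f i j) (Pair i ` J) = finsum V (f i) J"
    using insert by (subst finsum_reindex) (auto simp: inj_on_def)
  moreover have "finsum V (\<lambda>(i, j). f i j) (Pair i ` J \<union> I \<times> J)
    = finsum V (\<lambda>(i, j). f i j) (Pair i ` J) \<oplus>\<^bsub>V\<^esub> finsum V (\<lambda>(i, j). f i j) (I \<times> J)"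
    using insert J by (intro finsum_Un_disjoint) auto
  moreover have "insert i I \<times> J = Pair i ` J \<union> I \<times> J"
    by auto
  moreover have "finsum V (\<lambda>i. finsum V (f i) J) (insert i I) = finsum V (f i) J \<oplus>\<^bsub>V\<^esub> finsum V (\<lambda>i. finsum V (f i) J) I"
    using insert V by (intro vs_finsum_insert) auto
  ultimately show ?case
    using insert by simp
qed

subsection \<open>Subspaces and spans\<close>

lemma lin_subspaceI:
  assumes V: "vec_space V" and "N \<subseteq> carrier V" "\<zero>\<^bsub>V\<^esub> \<in> N"
    and "\<And>x y. x \<in> N \<Longrightarrow> y \<in> N \<Longrightarrow> x \<oplus>\<^bsub>V\<^esub> y \<in> N"
    and "\<And>c x. x \<in> N \<Longrightarrow> c \<odot>\<^bsub>V\<^esub> x \<in> N"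
  shows "lin_subspace V N"
  unfolding lin_subspace_def
proof (rule Module.module.submoduleI)
  show "Module.module base_field V"
    using V by (rule vs_module)
  show "\<ominus>\<^bsub>V\<^esub> x \<in> N" if "x \<in> N" for x
    using that assms vs_neg[OF V, of x] by auto
qed (use assms in auto)

lemma lin_subspaceD:
  assumes V: "vec_space V" and N: "lin_subspace V N"
  shows lin_subspace_subset: "N \<subseteq> carrier V"
    and lin_subspace_zero: "\<zero>\<^bsub>V\<^esub> \<in> N"
    and lin_subspace_add: "\<And>x y. x \<in> N \<Longrightarrow> y \<in> N \<Longrightarrow> x \<oplus>\<^bsub>V\<^esub> y \<in> N"
    and lin_subspace_smult: "\<And>c x. x \<in> N \<Longrightarrow> c \<odot>\<^bsub>V\<^esub> x \<in> N"
proof -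
  have *: "submodule N base_field V"
    using N by (simp add: lin_subspace_def)
  note E = Module.module.submoduleE[OF vs_module[OF V] *]
  show "N \<subseteq> carrier V"
    by (rule E)
  show "\<And>x y. x \<in> N \<Longrightarrow> y \<in> N \<Longrightarrow> x \<oplus>\<^bsub>V\<^esub> y \<in> N"
    by (rule E)
  show sm: "\<And>c x. x \<in> N \<Longrightarrow> c \<odot>\<^bsub>V\<^esub> x \<in> N"
    using E(4) by simp
  obtain x where "x \<in> N"
    using E(2) by auto
  then show "\<zero>\<^bsub>V\<^esub> \<in> N"
    using sm[of x 0] V E(1) by (auto simp: vs_zero_smult)
qed

lemma vec_space_subspace:
  assumes V: "vec_space V" and N: "lin_subspace V N"
  shows "vec_space (V\<lparr>carrier := N\<rparr>)"
  using N submodule.submodule_is_module[OF _ vs_module[OF V]]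
  by (simp add: vec_space_def lin_subspace_def)

lemma lin_subspace_carrier: "vec_space V \<Longrightarrow> lin_subspace V (carrier V)"
  by (rule lin_subspaceI) auto

lemma lin_span_least: "lin_subspace V N \<Longrightarrow> S \<subseteq> N \<Longrightarrow> lin_span V S \<subseteq> N"
  by (auto simp: lin_span_def)

lemma lin_span_superset: "S \<subseteq> lin_span V S"
  by (auto simp: lin_span_def)

lemma lin_span_subspace:
  assumes V: "vec_space V" and S: "S \<subseteq> carrier V"
  shows "lin_subspace V (lin_span V S)"
proof (rule lin_subspaceI[OF V])
  show "lin_span V S \<subseteq> carrier V"
    by (rule lin_span_least[OF lin_subspace_carrier[OF V] S])
qed (auto simp: lin_span_def lin_subspaceD[OF V])

lemma lin_span_induct [consumes 3, case_names base zero add smult]: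
  assumes V: "vec_space V" and S: "S \<subseteq> carrier V" and x: "x \<in> lin_span V S"
    and base: "\<And>x. x \<in> S \<Longrightarrow> P x" and zero: "P \<zero>\<^bsub>V\<^esub>"
    and add: "\<And>x y. x \<in> carrier V \<Longrightarrow> y \<in> carrier V \<Longrightarrow> P x \<Longrightarrow> P y \<Longrightarrow> P (x \<oplus>\<^bsub>V\<^esub> y)"
    and smult: "\<And>c x. x \<in> carrier V \<Longrightarrow> P x \<Longrightarrow> P (c \<odot>\<^bsub>V\<^esub> x)"
  shows "P x"
proof -
  have "lin_subspace V {x \<in> carrier V. P x}"
    by (rule lin_subspaceI[OF V]) (use V zero add smult in auto)
  then have "lin_span V S \<subseteq> {x \<in> carrier V. P x}"
    by (rule lin_span_least) (use S base in auto)
  then show ?thesis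
    using x by auto
qed

lemma lin_span_finsum:
  assumes V: "vec_space V" and N: "lin_subspace V N" and "finite I" and f: "\<And>i. i \<in> I \<Longrightarrow> f i \<in> N"
  shows "finsum V f I \<in> N"
  using \<open>finite I\<close> f
proof (induction I)
  case empty
  then show ?case using lin_subspaceD[OF V N] V by simp
next
  case (insert i I)
  then show ?case
    using lin_subspaceD[OF V N] by (subst vs_finsum_insert[OF V]) auto
qed

lemma lin_span_carrier: "vec_space V \<Longrightarrow> lin_span V (carrier V) = carrier V"
  using lin_span_least[OF lin_subspace_carrier order_refl] lin_span_superset[of "carrier V" V] by blast

lemma finsum_same:
  assumes V: "vec_space V" and W: "vec_space W"
    and eq: "\<zero>\<^bsub>W\<^esub> = \<zero>\<^bsub>V\<^esub>" "\<And>x y. x \<oplus>\<^bsub>W\<^esub> y = x \<oplus>\<^bsub>V\<^esub> y"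
    and "finite I" and f: "\<And>i. i \<in> I \<Longrightarrow> f i \<in> carrier V" "\<And>i. i \<in> I \<Longrightarrow> f i \<in> carrier W"
  shows "finsum W f I = finsum V f I"
  using \<open>finite I\<close> f
proof (induction I)
  case empty
  then show ?case by (simp add: V W eq)
next
  case (insert i I)
  then show ?case
    by (simp add: vs_finsum_insert[OF V] vs_finsum_insert[OF W] eq)
qed

subsection \<open>Linear and bilinear maps\<close>

text \<open>
  Linearity on the carrier, without the extensionality that the membership in \<open>lin_maps\<close> adds:
  it is preserved by plain composition.
\<close>

definition lin ::
  "('k::field, 'v, 'x) module_scheme \<Rightarrow> ('k, 'w, 'y) module_scheme \<Rightarrow> ('v \<Rightarrow> 'w) \<Rightarrow> bool" where
  "lin V W f \<longleftrightarrow> (\<forall>x\<in>carrier V. f x \<in> carrier W) \<and>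
     (\<forall>x\<in>carrier V. \<forall>y\<in>carrier V. f (x \<oplus>\<^bsub>V\<^esub> y) = f x \<oplus>\<^bsub>W\<^esub> f y) \<and>
     (\<forall>c. \<forall>x\<in>carrier V. f (c \<odot>\<^bsub>V\<^esub> x) = c \<odot>\<^bsub>W\<^esub> f x)"

definition bilin ::
  "('k::field, 'v, 'x) module_scheme \<Rightarrow> ('k, 'w, 'y) module_scheme \<Rightarrow> ('k, 'u, 'z) module_scheme
    \<Rightarrow> ('v \<Rightarrow> 'w \<Rightarrow> 'u) \<Rightarrow> bool" where
  "bilin V W U f \<longleftrightarrow> (\<forall>v\<in>carrier V. lin W U (f v)) \<and> (\<forall>w\<in>carrier W. lin V U (\<lambda>v. f v w))"

lemma linI:
  assumes "\<And>x. x \<in> carrier V \<Longrightarrow> f x \<in> carrier W"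
    and "\<And>x y. x \<in> carrier V \<Longrightarrow> y \<in> carrier V \<Longrightarrow> f (x \<oplus>\<^bsub>V\<^esub> y) = f x \<oplus>\<^bsub>W\<^esub> f y"
    and "\<And>c x. x \<in> carrier V \<Longrightarrow> f (c \<odot>\<^bsub>V\<^esub> x) = c \<odot>\<^bsub>W\<^esub> f x"
  shows "lin V W f"
  using assms by (simp add: lin_def)

lemma linD:
  assumes "lin V W f"
  shows lin_closed: "\<And>x. x \<in> carrier V \<Longrightarrow> f x \<in> carrier W"
    and lin_add: "\<And>x y. x \<in> carrier V \<Longrightarrow> y \<in> carrier V \<Longrightarrow> f (x \<oplus>\<^bsub>V\<^esub> y) = f x \<oplus>\<^bsub>W\<^esub> f y"
    and lin_smult: "\<And>c x. x \<in> carrier V \<Longrightarrow> f (c \<odot>\<^bsub>V\<^esub> x) = c \<odot>\<^bsub>W\<^esub> f x"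
  using assms by (simp_all add: lin_def)

lemma lin_maps_iff: "f \<in> lin_maps V W \<longleftrightarrow> lin V W f \<and> f \<in> extensional (carrier V)"
  by (auto simp: lin_maps_def lin_def PiE_def)

lemma lin_maps_lin: "f \<in> lin_maps V W \<Longrightarrow> lin V W f"
  by (simp add: lin_maps_iff)

lemma lin_cong:
  assumes "vec_space V" "\<And>x. x \<in> carrier V \<Longrightarrow> f x = g x"
  shows "lin V W f \<longleftrightarrow> lin V W g"
  using assms by (simp add: lin_def)

lemma lin_cong_imp:
  "lin V W g \<Longrightarrow> vec_space V \<Longrightarrow> (\<And>x. x \<in> carrier V \<Longrightarrow> f x = g x) \<Longrightarrow> lin V W f"
  using lin_cong by blast

lemma lin_restrict [simp]: "vec_space V \<Longrightarrow> lin V W (restrict f (carrier V)) \<longleftrightarrow> lin V W f"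
  by (rule lin_cong) auto

lemma restrict_lin_maps: "vec_space V \<Longrightarrow> lin V W f \<Longrightarrow> restrict f (carrier V) \<in> lin_maps V W"
  by (simp add: lin_maps_iff)

lemma lin_zero:
  assumes "vec_space V" "vec_space W" "lin V W f"
  shows "f \<zero>\<^bsub>V\<^esub> = \<zero>\<^bsub>W\<^esub>"
proof -
  have "f (0 \<odot>\<^bsub>V\<^esub> \<zero>\<^bsub>V\<^esub>) = 0 \<odot>\<^bsub>W\<^esub> f \<zero>\<^bsub>V\<^esub>"
    using assms lin_smult by (metis vs_zero_closed)
  then show ?thesis
    using assms by (simp add: lin_closed[OF assms(3)])
qed

lemma lin_finsum:
  assumes V: "vec_space V" and W: "vec_space W" and f: "lin V W f"
    and "finite I" and g: "\<And>i. i \<in> I \<Longrightarrow> g i \<in> carrier V"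
  shows "f (finsum V g I) = finsum W (\<lambda>i. f (g i)) I"
  using \<open>finite I\<close> g
proof (induction I)
  case empty
  then show ?case using assms by (simp add: lin_zero)
next
  case (insert i I)
  have "f (finsum V g (insert i I)) = f (g i \<oplus>\<^bsub>V\<^esub> finsum V g I)"
    using insert V by (subst vs_finsum_insert) auto
  also have "\<dots> = f (g i) \<oplus>\<^bsub>W\<^esub> finsum W (\<lambda>i. f (g i)) I"
    using insert V f by (simp add: linD)
  also have "\<dots> = finsum W (\<lambda>i. f (g i)) (insert i I)"
    using insert W f by (subst vs_finsum_insert) (auto simp: linD)
  finally show ?case .
qed

lemma lin_comp: "lin V W f \<Longrightarrow> lin W U g \<Longrightarrow> lin V U (\<lambda>x. g (f x))"
  by (simp add: lin_def)

lemma lin_ident: "lin V V (\<lambda>x. x)"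
  by (simp add: lin_def)

lemma id_map_lin_maps: "vec_space V \<Longrightarrow> id_map V \<in> lin_maps V V"
  by (simp add: id_map_def restrict_lin_maps lin_ident)

lemma lin_const_zero: "vec_space U \<Longrightarrow> lin V U (\<lambda>x. \<zero>\<^bsub>U\<^esub>)"
  by (simp add: lin_def)

lemma lin_sum:
  assumes "vec_space W" "lin V W f" "lin V W g"
  shows "lin V W (\<lambda>x. f x \<oplus>\<^bsub>W\<^esub> g x)"
  using assms by (intro linI) (simp_all add: linD vs_smult_add vs_add_assoc vs_add_left_comm)

lemma lin_scale:
  assumes "vec_space W" "lin V W f"
  shows "lin V W (\<lambda>x. c \<odot>\<^bsub>W\<^esub> f x)"
  using assms by (intro linI) (simp_all add: linD vs_smult_add mult.commute)

lemma lin_scale_fun: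
  assumes "vec_space W" "lin V base_field f" "w \<in> carrier W"
  shows "lin V W (\<lambda>x. f x \<odot>\<^bsub>W\<^esub> w)"
  using assms by (intro linI) (simp_all add: linD vs_add_smult)

lemma lin_finsum_fun:
  assumes "vec_space V" "vec_space W" "finite I" and f: "\<And>i. i \<in> I \<Longrightarrow> lin V W (f i)"
  shows "lin V W (\<lambda>x. finsum W (\<lambda>i. f i x) I)"
  using \<open>finite I\<close> f
proof (induction I)
  case empty
  then show ?case using assms by (simp add: lin_const_zero)
next
  case (insert i I)
  have "lin V W (\<lambda>x. f i x \<oplus>\<^bsub>W\<^esub> finsum W (\<lambda>i. f i x) I)"
    using insert assms by (intro lin_sum) auto
  then show ?case
  proof (rule lin_cong_imp[OF _ assms(1)])
    show "finsum W (\<lambda>i. f i x) (insert i I) = f i x \<oplus>\<^bsub>W\<^esub> finsum W (\<lambda>i. f i x) I"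
    if "x \<in> carrier V" for x
      using that insert(1,2) lin_closed[OF insert(4)] assms(2) by (simp add: vs_finsum_insert)
  qed
qed

lemma vs_smult_finsum:
  assumes "vec_space V" "finite I" "\<And>i. i \<in> I \<Longrightarrow> f i \<in> carrier V"
  shows "c \<odot>\<^bsub>V\<^esub> finsum V f I = finsum V (\<lambda>i. c \<odot>\<^bsub>V\<^esub> f i) I"
  using assms by (intro lin_finsum lin_scale lin_ident) auto

lemma lin_subspace_vimage:
  assumes "vec_space V" "vec_space W" "lin V W f" "lin_subspace W N"
  shows "lin_subspace V {x \<in> carrier V. f x \<in> N}"
  using assms by (intro lin_subspaceI) (auto simp: linD lin_zero lin_subspaceD[OF assms(2,4)])

lemma lin_subspace_image:
  assumes V: "vec_space V" and W: "vec_space W" and f: "lin V W f" and N: "lin_subspace V N"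
  shows "lin_subspace W (f ` N)"
proof (rule lin_subspaceI[OF W])
  note N' = lin_subspaceD[OF V N]
  show "f ` N \<subseteq> carrier W"
    using N' f by (auto simp: linD)
  show "\<zero>\<^bsub>W\<^esub> \<in> f ` N"
    using lin_zero[OF V W f] N' by (metis imageI)
  show "x \<oplus>\<^bsub>W\<^esub> y \<in> f ` N" if xy: "x \<in> f ` N" "y \<in> f ` N" for x y
  proof -
    obtain a b where "a \<in> N" "b \<in> N" "x = f a" "y = f b" using xy by (meson imageE)
    then show ?thesis using N'(1,3) lin_add[OF f, of a b] by (metis imageI subsetD)
  qed
  show "c \<odot>\<^bsub>W\<^esub> x \<in> f ` N" if x: "x \<in> f ` N" for c x
  proof -
    obtain a where "a \<in> N" "x = f a" using x by (meson imageE)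
    then show ?thesis using N'(1,4) lin_smult[OF f, of a c] by (metis imageI subsetD)
  qed
qed

lemma lin_eq_on_span:
  assumes V: "vec_space V" and W: "vec_space W" and f: "lin V W f" and g: "lin V W g"
    and S: "S \<subseteq> carrier V" and eq: "\<And>x. x \<in> S \<Longrightarrow> f x = g x" and x: "x \<in> lin_span V S"
  shows "f x = g x"
  using V S x by (induction rule: lin_span_induct) (use eq V W f g in \<open>auto simp: linD lin_zero\<close>)

lemma lin_the_inv_into:
  assumes V: "vec_space V" and W: "vec_space W" and f: "lin V W f"
    and bij: "bij_betw f (carrier V) (carrier W)"
  shows "lin W V (the_inv_into (carrier V) f)"
proof -
  let ?g = "the_inv_into (carrier V) f"
  have inj: "inj_on f (carrier V)" and im: "f ` carrier V = carrier W"
    using bij by (auto simp: bij_betw_def)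
  have gf: "?g (f x) = x" if "x \<in> carrier V" for x
    using that inj by (simp add: the_inv_into_f_f)
  have *: "\<exists>a\<in>carrier V. x = f a" if "x \<in> carrier W" for x
    using that im by auto
  show ?thesis
  proof (rule linI)
    show "?g x \<in> carrier V" if "x \<in> carrier W" for x
      using *[OF that] gf by auto
    show "?g (x \<oplus>\<^bsub>W\<^esub> y) = ?g x \<oplus>\<^bsub>V\<^esub> ?g y" if xy: "x \<in> carrier W" "y \<in> carrier W" for x y
    proof -
      obtain a b where "a \<in> carrier V" "b \<in> carrier V" "x = f a" "y = f b"
        using xy * by meson
      then show ?thesis
        using V gf lin_add[OF f, of a b, symmetric] by auto
    qed
    show "?g (c \<odot>\<^bsub>W\<^esub> x) = c \<odot>\<^bsub>V\<^esub> ?g x" if "x \<in> carrier W" for c x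
    proof -
      obtain a where "a \<in> carrier V" "x = f a"
        using * \<open>x \<in> carrier W\<close> by meson
      then show ?thesis
        using V gf lin_smult[OF f, of a c, symmetric] by auto
    qed
  qed
qed

lemma bilinI:
  assumes "\<And>v w. v \<in> carrier V \<Longrightarrow> w \<in> carrier W \<Longrightarrow> f v w \<in> carrier U"
    and "\<And>v v' w. v \<in> carrier V \<Longrightarrow> v' \<in> carrier V \<Longrightarrow> w \<in> carrier W \<Longrightarrow>
           f (v \<oplus>\<^bsub>V\<^esub> v') w = f v w \<oplus>\<^bsub>U\<^esub> f v' w"
    and "\<And>c v w. v \<in> carrier V \<Longrightarrow> w \<in> carrier W \<Longrightarrow> f (c \<odot>\<^bsub>V\<^esub> v) w = c \<odot>\<^bsub>U\<^esub> f v w"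
    and "\<And>v w w'. v \<in> carrier V \<Longrightarrow> w \<in> carrier W \<Longrightarrow> w' \<in> carrier W \<Longrightarrow>
           f v (w \<oplus>\<^bsub>W\<^esub> w') = f v w \<oplus>\<^bsub>U\<^esub> f v w'"
    and "\<And>c v w. v \<in> carrier V \<Longrightarrow> w \<in> carrier W \<Longrightarrow> f v (c \<odot>\<^bsub>W\<^esub> w) = c \<odot>\<^bsub>U\<^esub> f v w"
  shows "bilin V W U f"
  using assms by (simp add: bilin_def lin_def)

lemma bilinD:
  assumes "bilin V W U f"
  shows "\<And>v w. v \<in> carrier V \<Longrightarrow> w \<in> carrier W \<Longrightarrow> f v w \<in> carrier U"
    and "\<And>v v' w. v \<in> carrier V \<Longrightarrow> v' \<in> carrier V \<Longrightarrow> w \<in> carrier W \<Longrightarrow>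
           f (v \<oplus>\<^bsub>V\<^esub> v') w = f v w \<oplus>\<^bsub>U\<^esub> f v' w"
    and "\<And>c v w. v \<in> carrier V \<Longrightarrow> w \<in> carrier W \<Longrightarrow> f (c \<odot>\<^bsub>V\<^esub> v) w = c \<odot>\<^bsub>U\<^esub> f v w"
    and "\<And>v w w'. v \<in> carrier V \<Longrightarrow> w \<in> carrier W \<Longrightarrow> w' \<in> carrier W \<Longrightarrow>
           f v (w \<oplus>\<^bsub>W\<^esub> w') = f v w \<oplus>\<^bsub>U\<^esub> f v w'"
    and "\<And>c v w. v \<in> carrier V \<Longrightarrow> w \<in> carrier W \<Longrightarrow> f v (c \<odot>\<^bsub>W\<^esub> w) = c \<odot>\<^bsub>U\<^esub> f v w"
  using assms by (simp_all add: bilin_def lin_def)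

lemma bilin_lin:
  assumes "bilin V W U f"
  shows bilin_lin_right: "\<And>v. v \<in> carrier V \<Longrightarrow> lin W U (f v)"
    and bilin_lin_left: "\<And>w. w \<in> carrier W \<Longrightarrow> lin V U (\<lambda>v. f v w)"
  using assms by (simp_all add: bilin_def)

lemma bilin_comp:
  assumes "bilin V W U f" "lin V' V g" "lin W' W h" "lin U U' k"
  shows "bilin V' W' U' (\<lambda>v w. k (f (g v) (h w)))"
  using assms by (simp add: bilin_def lin_def)

lemma lin_span_image:
  assumes V: "vec_space V" and W: "vec_space W" and f: "lin V W f" and S: "S \<subseteq> carrier V"
  shows "f ` lin_span V S = lin_span W (f ` S)"
proof
  have fS: "f ` S \<subseteq> carrier W"
    using S f by (auto simp: linD)
  have "S \<subseteq> {x \<in> carrier V. f x \<in> lin_span W (f ` S)}"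
    using S lin_span_superset[of "f ` S" W] by auto
  then show "f ` lin_span V S \<subseteq> lin_span W (f ` S)"
    using lin_span_least[OF lin_subspace_vimage[OF V W f lin_span_subspace[OF W fS]], of S] by auto
  show "lin_span W (f ` S) \<subseteq> f ` lin_span V S"
    using lin_span_superset[of S V]
    by (intro lin_span_least lin_subspace_image[OF V W f] lin_span_subspace[OF V S]) auto
qed

lemma lin_ext:
  assumes "vec_space V" "vec_space W" "lin V W f" "lin V W g"
    and "S \<subseteq> carrier V" "lin_span V S = carrier V" "\<And>x. x \<in> S \<Longrightarrow> f x = g x" "x \<in> carrier V"
  shows "f x = g x"
  using lin_eq_on_span[OF assms(1-5,7)] assms(6,8) by simp

lemma bilin_ext:
  assumes V: "vec_space V" and W: "vec_space W" and U: "vec_space U" and f: "bilin V W U f" and g: "bilin V W U g"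
    and S: "S \<subseteq> carrier V" "lin_span V S = carrier V" and T: "T \<subseteq> carrier W" "lin_span W T = carrier W"
    and eq: "\<And>x y. x \<in> S \<Longrightarrow> y \<in> T \<Longrightarrow> f x y = g x y" and x: "x \<in> carrier V" and y: "y \<in> carrier W"
  shows "f x y = g x y"
proof (rule lin_ext[OF V U bilin_lin_left[OF f y] bilin_lin_left[OF g y] S _ x])
  fix x assume x: "x \<in> S"
  then have xV: "x \<in> carrier V"
    using S by auto
  show "f x y = g x y"
    by (rule lin_ext[OF W U bilin_lin_right[OF f xV] bilin_lin_right[OF g xV] T eq[OF x] y])
qed

lemma bilin_span:
  assumes V: "vec_space V" and W: "vec_space W" and U: "vec_space U" and f: "bilin V W U f"
    and S: "S \<subseteq> carrier V" "lin_span V S = carrier V" and T: "T \<subseteq> carrier W" "lin_span W T = carrier W"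
    and span: "lin_span U {f v w | v w. v \<in> carrier V \<and> w \<in> carrier W} = carrier U"
  shows "lin_span U {f v w | v w. v \<in> S \<and> w \<in> T} = carrier U" (is "?N = _")
proof -
  have sub: "{f v w | v w. v \<in> S \<and> w \<in> T} \<subseteq> carrier U"
    using S T bilinD(1)[OF f] by blast
  have N: "lin_subspace U ?N"
    by (rule lin_span_subspace[OF U sub])
  have 1: "f v w \<in> ?N" if v: "v \<in> S" and w: "w \<in> carrier W" for v w
  proof -
    have "v \<in> carrier V"
      using v S by auto
    then have "lin_subspace W {w \<in> carrier W. f v w \<in> ?N}"
      by (intro lin_subspace_vimage[OF W U bilin_lin_right[OF f] N])
    moreover have "T \<subseteq> {w \<in> carrier W. f v w \<in> ?N}"
      using T v lin_span_superset[of "{f v w | v w. v \<in> S \<and> w \<in> T}" U] by blast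
    ultimately have "lin_span W T \<subseteq> {w \<in> carrier W. f v w \<in> ?N}"
      by (rule lin_span_least)
    then show ?thesis
      using T w by auto
  qed
  have 2: "f v w \<in> ?N" if v: "v \<in> carrier V" and w: "w \<in> carrier W" for v w
  proof -
    have "lin_subspace V {v \<in> carrier V. f v w \<in> ?N}"
      by (intro lin_subspace_vimage[OF V U bilin_lin_left[OF f w] N])
    moreover have "S \<subseteq> {v \<in> carrier V. f v w \<in> ?N}"
      using S w 1 by auto
    ultimately have "lin_span V S \<subseteq> {v \<in> carrier V. f v w \<in> ?N}"
      by (rule lin_span_least)
    then show ?thesis
      using S v by auto
  qed
  have "lin_span U {f v w | v w. v \<in> carrier V \<and> w \<in> carrier W} \<subseteq> ?N"
    by (rule lin_span_least[OF N]) (use 2 in auto)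
  then show ?thesis
    using span lin_subspace_subset[OF U N] by auto
qed

text \<open>
  The axioms are equations, so they pass along surjections that preserve the operations.  This moves
  structure to isomorphic copies and to records with additional fields.
\<close>

lemma vec_space_image:
  assumes V: "vec_space V" and im: "f ` carrier V = carrier W"
    and add: "\<And>x y. x \<in> carrier V \<Longrightarrow> y \<in> carrier V \<Longrightarrow> f x \<oplus>\<^bsub>W\<^esub> f y = f (x \<oplus>\<^bsub>V\<^esub> y)"
    and smult: "\<And>c x. x \<in> carrier V \<Longrightarrow> c \<odot>\<^bsub>W\<^esub> f x = f (c \<odot>\<^bsub>V\<^esub> x)"
    and zero: "\<zero>\<^bsub>W\<^esub> = f \<zero>\<^bsub>V\<^esub>"
  shows "vec_space W"
  by (rule vec_spaceI; unfold im[symmetric])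
    (use V in \<open>auto simp: add smult zero vs_add_assoc vs_add_comm vs_add_left_comm
      vs_add_neg1 vs_add_smult vs_smult_add\<close>)

subsection \<open>Spaces of linear maps\<close>

text \<open>The fields \<open>mult\<close> and \<open>one\<close> are chosen such that the dual space is a special case.\<close>

definition hom_space ::
  "('k::field, 'v, 'x) module_scheme \<Rightarrow> ('k, 'w, 'y) module_scheme \<Rightarrow> ('k, 'v \<Rightarrow> 'w) module" where
  "hom_space V W = \<lparr>carrier = lin_maps V W, monoid.mult = undefined, one = undefined,
     ring.zero = (\<lambda>x\<in>carrier V. \<zero>\<^bsub>W\<^esub>), add = (\<lambda>f g. \<lambda>x\<in>carrier V. f x \<oplus>\<^bsub>W\<^esub> g x),
     smult = (\<lambda>c f. \<lambda>x\<in>carrier V. c \<odot>\<^bsub>W\<^esub> f x)\<rparr>"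

lemma hom_space_simps:
  "carrier (hom_space V W) = lin_maps V W"
  "\<zero>\<^bsub>hom_space V W\<^esub> = (\<lambda>x\<in>carrier V. \<zero>\<^bsub>W\<^esub>)"
  "f \<oplus>\<^bsub>hom_space V W\<^esub> g = (\<lambda>x\<in>carrier V. f x \<oplus>\<^bsub>W\<^esub> g x)"
  "c \<odot>\<^bsub>hom_space V W\<^esub> f = (\<lambda>x\<in>carrier V. c \<odot>\<^bsub>W\<^esub> f x)"
  by (simp_all add: hom_space_def)

lemma dual_space_eq_hom_space: "dual_space V = hom_space V base_field"
  by (simp add: dual_space_def hom_space_def base_field_def)

lemma lin_maps_eqI:
  "f \<in> lin_maps V W \<Longrightarrow> g \<in> lin_maps V W \<Longrightarrow> (\<And>x. x \<in> carrier V \<Longrightarrow> f x = g x) \<Longrightarrow> f = g"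
  by (auto simp: lin_maps_iff intro: extensionalityI)

lemma vec_space_base_field: "vec_space (base_field :: ('k::field, 'k) module)"
  by (rule vec_spaceI) (simp_all add: algebra_simps)

lemma vec_space_hom_space:
  assumes V: "vec_space V" and W: "vec_space W"
  shows "vec_space (hom_space V W)"
proof (rule vec_spaceI)
  show "\<zero>\<^bsub>hom_space V W\<^esub> \<in> carrier (hom_space V W)"
    using V W by (simp add: hom_space_simps restrict_lin_maps lin_const_zero)
  show "f \<oplus>\<^bsub>hom_space V W\<^esub> g \<in> carrier (hom_space V W)"
    if "f \<in> carrier (hom_space V W)" "g \<in> carrier (hom_space V W)" for f g
    using that V W by (simp add: hom_space_simps restrict_lin_maps lin_sum lin_maps_lin)
  show "c \<odot>\<^bsub>hom_space V W\<^esub> f \<in> carrier (hom_space V W)"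
    if "f \<in> carrier (hom_space V W)" for c f
    using that V W by (simp add: hom_space_simps restrict_lin_maps lin_scale lin_maps_lin)
qed (auto simp: hom_space_simps lin_maps_iff lin_def extensional_def fun_eq_iff restrict_def V W
    vs_add_assoc vs_add_comm vs_add_left_comm vs_smult_add vs_add_smult vs_neg_add vs_minus_eq_zero_iff)

lemma lin_eval:
  assumes "x \<in> carrier V"
  shows "lin (hom_space V W) W (\<lambda>f. f x)"
  using assms by (auto simp: lin_def hom_space_simps lin_maps_iff)

lemma vec_space_dual_space: "vec_space V \<Longrightarrow> vec_space (dual_space V)"
  by (simp add: dual_space_eq_hom_space vec_space_hom_space vec_space_base_field)

lemma carrier_dual_space: "carrier (dual_space V) = lin_maps V base_field"
  by (simp add: dual_space_def)

lemma dual_space_simps [simp]: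
  "x \<in> carrier V \<Longrightarrow> (f \<oplus>\<^bsub>dual_space V\<^esub> g) x = f x + g x"
  "x \<in> carrier V \<Longrightarrow> (c \<odot>\<^bsub>dual_space V\<^esub> f) x = c * f x"
  "x \<in> carrier V \<Longrightarrow> \<zero>\<^bsub>dual_space V\<^esub> x = 0"
  by (simp_all add: dual_space_def)

lemma dual_space_lin: "f \<in> carrier (dual_space V) \<Longrightarrow> lin V base_field f"
  by (simp add: carrier_dual_space lin_maps_lin)

lemma lin_eval_dual: "x \<in> carrier V \<Longrightarrow> lin (dual_space V) base_field (\<lambda>f. f x)"
  using lin_eval[of x V base_field] by (simp add: dual_space_eq_hom_space)

lemma bilin_hom_space:
  assumes V: "vec_space V" and W: "vec_space W" and f: "bilin V W U f"
  shows "(\<lambda>x\<in>carrier V. \<lambda>y\<in>carrier W. f x y) \<in> lin_maps V (hom_space W U)"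
proof (rule restrict_lin_maps[OF V], rule linI)
  note b = bilinD[OF f]
  show "restrict (f x) (carrier W) \<in> carrier (hom_space W U)" if "x \<in> carrier V" for x
    by (simp add: hom_space_simps restrict_lin_maps[OF W bilin_lin_right[OF f that]])
qed (auto simp: hom_space_simps bilinD[OF f] fun_eq_iff restrict_def)

lemma hom_space_bilin:
  assumes "lin V (hom_space W U) h"
  shows "bilin V W U h"
  unfolding bilin_def
proof (intro conjI ballI)
  show "lin W U (h v)" if "v \<in> carrier V" for v
    using lin_closed[OF assms that] by (simp add: hom_space_simps lin_maps_lin)
  show "lin V U (\<lambda>v. h v w)" if "w \<in> carrier W" for w
    by (rule lin_comp[OF assms lin_eval[OF that]])
qed

subsection \<open>Dual bases\<close>

text \<open>
  The coordinate along a complement line of \<open>N\<close>: it is the scalar \<open>t\<close> with \<open>x - t b \<in> N\<close>, which is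
  unique because \<open>b \<notin> N\<close>.
\<close>

lemma coordinate_functional:
  assumes V: "vec_space V" and N: "lin_subspace V N" and b: "b \<in> carrier V" "b \<notin> N"
    and split: "\<And>x. x \<in> carrier V \<Longrightarrow> \<exists>t. x \<oplus>\<^bsub>V\<^esub> (- t) \<odot>\<^bsub>V\<^esub> b \<in> N"
  shows "\<exists>d\<in>carrier (dual_space V). d b = 1 \<and> (\<forall>x\<in>N. d x = 0)"
proof -
  note N' = lin_subspaceD[OF V N]
  have uniq: "t = s"
    if x: "x \<in> carrier V" and t: "x \<oplus>\<^bsub>V\<^esub> (- t) \<odot>\<^bsub>V\<^esub> b \<in> N" and s: "x \<oplus>\<^bsub>V\<^esub> (- s) \<odot>\<^bsub>V\<^esub> b \<in> N" for x t s
  proof (rule ccontr)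
    assume ne: "t \<noteq> s"
    have "(x \<oplus>\<^bsub>V\<^esub> (- s) \<odot>\<^bsub>V\<^esub> b) \<oplus>\<^bsub>V\<^esub> (- 1) \<odot>\<^bsub>V\<^esub> (x \<oplus>\<^bsub>V\<^esub> (- t) \<odot>\<^bsub>V\<^esub> b) \<in> N"
      using N' t s by blast
    also have "(x \<oplus>\<^bsub>V\<^esub> (- s) \<odot>\<^bsub>V\<^esub> b) \<oplus>\<^bsub>V\<^esub> (- 1) \<odot>\<^bsub>V\<^esub> (x \<oplus>\<^bsub>V\<^esub> (- t) \<odot>\<^bsub>V\<^esub> b)
      = (x \<oplus>\<^bsub>V\<^esub> (- 1) \<odot>\<^bsub>V\<^esub> x) \<oplus>\<^bsub>V\<^esub> ((- s) \<odot>\<^bsub>V\<^esub> b \<oplus>\<^bsub>V\<^esub> t \<odot>\<^bsub>V\<^esub> b)"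
      using x b V by (simp add: vs_smult_add vs_add_assoc vs_add_left_comm)
    also have "\<dots> = (t - s) \<odot>\<^bsub>V\<^esub> b"
      using x b V vs_minus_eq_zero_iff[OF V, of x x] vs_add_smult[OF V, of b "- s" t] by simp
    finally have "inverse (t - s) \<odot>\<^bsub>V\<^esub> ((t - s) \<odot>\<^bsub>V\<^esub> b) \<in> N"
      using N' by blast
    then show False
      using ne b V by simp
  qed
  define d where "d = (\<lambda>x\<in>carrier V. SOME t. x \<oplus>\<^bsub>V\<^esub> (- t) \<odot>\<^bsub>V\<^esub> b \<in> N)"
  have d: "x \<oplus>\<^bsub>V\<^esub> (- d x) \<odot>\<^bsub>V\<^esub> b \<in> N" if "x \<in> carrier V" for x
    using someI_ex[OF split[OF that]] that by (simp add: d_def)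
  have d_eq: "d x = t" if "x \<in> carrier V" "x \<oplus>\<^bsub>V\<^esub> (- t) \<odot>\<^bsub>V\<^esub> b \<in> N" for x t
    using uniq[OF that(1)] d that by blast
  have "lin V base_field d"
  proof (rule linI)
    fix x y assume xy: "x \<in> carrier V" "y \<in> carrier V"
    have "(x \<oplus>\<^bsub>V\<^esub> (- d x) \<odot>\<^bsub>V\<^esub> b) \<oplus>\<^bsub>V\<^esub> (y \<oplus>\<^bsub>V\<^esub> (- d y) \<odot>\<^bsub>V\<^esub> b) \<in> N"
      using d xy N' by blast
    also have "(x \<oplus>\<^bsub>V\<^esub> (- d x) \<odot>\<^bsub>V\<^esub> b) \<oplus>\<^bsub>V\<^esub> (y \<oplus>\<^bsub>V\<^esub> (- d y) \<odot>\<^bsub>V\<^esub> b)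
      = (x \<oplus>\<^bsub>V\<^esub> y) \<oplus>\<^bsub>V\<^esub> (- (d x + d y)) \<odot>\<^bsub>V\<^esub> b"
      using xy b V vs_add_smult[OF V, of b "- d x" "- d y"]
      by (simp add: vs_add_assoc vs_add_left_comm)
    finally show "d (x \<oplus>\<^bsub>V\<^esub> y) = d x \<oplus>\<^bsub>base_field\<^esub> d y"
      using d_eq[of "x \<oplus>\<^bsub>V\<^esub> y" "d x + d y"] xy V by simp
  next
    fix c x assume x: "x \<in> carrier V"
    have "c \<odot>\<^bsub>V\<^esub> (x \<oplus>\<^bsub>V\<^esub> (- d x) \<odot>\<^bsub>V\<^esub> b) \<in> N"
      using d x N' by blast
    then have "c \<odot>\<^bsub>V\<^esub> x \<oplus>\<^bsub>V\<^esub> (- (c * d x)) \<odot>\<^bsub>V\<^esub> b \<in> N"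
      using x b V by (simp add: vs_smult_add)
    then show "d (c \<odot>\<^bsub>V\<^esub> x) = c \<odot>\<^bsub>base_field\<^esub> d x"
      using d_eq[of "c \<odot>\<^bsub>V\<^esub> x" "c * d x"] x V by simp
  qed simp
  moreover have "d \<in> extensional (carrier V)"
    by (simp add: d_def)
  moreover have "d b = 1"
    using b V N' vs_minus_eq_zero_iff[OF V, of b b] by (intro d_eq) simp_all
  moreover have "d x = 0" if "x \<in> N" for x
    using that b V N' by (intro d_eq) auto
  ultimately show ?thesis
    by (auto simp: carrier_dual_space lin_maps_iff)
qed

text \<open>
  In a spanning set of minimal cardinality no vector lies in the span of the others, so each vector
  has a coordinate functional that vanishes on the others.
\<close>

lemma dual_bases_exist:
  assumes V: "vec_space V" and fd: "fin_dim V"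
  shows "\<exists>n b d. dual_bases V n b d"
proof -
  define Q where "Q = (\<lambda>B. finite B \<and> B \<subseteq> carrier V \<and> lin_span V B = carrier V)"
  obtain B0 where "Q B0"
    using fd by (auto simp: fin_dim_def Q_def)
  then obtain B where QB: "Q B" and min: "\<And>B'. Q B' \<Longrightarrow> card B \<le> card B'"
    using ex_has_least_nat[of Q B0 card] by auto
  have B: "finite B" "B \<subseteq> carrier V" "lin_span V B = carrier V"
    using QB by (auto simp: Q_def)
  have "\<exists>d\<in>carrier (dual_space V). d b = 1 \<and> (\<forall>x\<in>B - {b}. d x = 0)" if b: "b \<in> B" for b
  proof -
    define N where "N = lin_span V (B - {b})"
    have N: "lin_subspace V N"
      using B V by (auto simp: N_def intro!: lin_span_subspace)
    note N' = lin_subspaceD[OF V N]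
    have sub: "B - {b} \<subseteq> N"
      unfolding N_def by (rule lin_span_superset)
    have bV: "b \<in> carrier V"
      using b B by auto
    have "b \<notin> N"
    proof
      assume "b \<in> N"
      then have "B \<subseteq> N"
        using sub by auto
      then have "lin_span V B \<subseteq> N"
        by (rule lin_span_least[OF N])
      then have "Q (B - {b})"
        using B N' by (auto simp: Q_def N_def)
      then have "card B \<le> card (B - {b})"
        by (rule min)
      then show False
        using b B by (metis card_Diff1_less leD)
    qed
    moreover have "\<exists>t. x \<oplus>\<^bsub>V\<^esub> (- t) \<odot>\<^bsub>V\<^esub> b \<in> N" if x: "x \<in> carrier V" for x
    proof -
      have "x \<in> lin_span V B"
        using x B by simp
      with V B(2) show ?thesis
      proof (induction rule: lin_span_induct)
        case (base x)
        show ?case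
        proof (cases "x = b")
          case True
          then show ?thesis
            using bV V N' vs_minus_eq_zero_iff[OF V, of b b] by (intro exI[of _ 1]) simp
        next
          case False
          then have "x \<in> N" "x \<in> carrier V"
            using base sub B by auto
          then show ?thesis
            using bV V by (intro exI[of _ 0]) simp
        qed
      next
        case zero
        then show ?case
          using bV V N' by (intro exI[of _ 0]) simp
      next
        case (add x y)
        then obtain s t where "x \<oplus>\<^bsub>V\<^esub> (- s) \<odot>\<^bsub>V\<^esub> b \<in> N" "y \<oplus>\<^bsub>V\<^esub> (- t) \<odot>\<^bsub>V\<^esub> b \<in> N"
          by auto
        then have "(x \<oplus>\<^bsub>V\<^esub> (- s) \<odot>\<^bsub>V\<^esub> b) \<oplus>\<^bsub>V\<^esub> (y \<oplus>\<^bsub>V\<^esub> (- t) \<odot>\<^bsub>V\<^esub> b) \<in> N"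
          using N' by blast
        also have "(x \<oplus>\<^bsub>V\<^esub> (- s) \<odot>\<^bsub>V\<^esub> b) \<oplus>\<^bsub>V\<^esub> (y \<oplus>\<^bsub>V\<^esub> (- t) \<odot>\<^bsub>V\<^esub> b)
          = (x \<oplus>\<^bsub>V\<^esub> y) \<oplus>\<^bsub>V\<^esub> (- (s + t)) \<odot>\<^bsub>V\<^esub> b"
          using add bV V vs_add_smult[OF V, of b "- s" "- t"]
          by (simp add: vs_add_assoc vs_add_left_comm)
        finally show ?case ..
      next
        case (smult c x)
        then obtain s where "x \<oplus>\<^bsub>V\<^esub> (- s) \<odot>\<^bsub>V\<^esub> b \<in> N"
          by auto
        then have "c \<odot>\<^bsub>V\<^esub> (x \<oplus>\<^bsub>V\<^esub> (- s) \<odot>\<^bsub>V\<^esub> b) \<in> N"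
          using N' by blast
        also have "c \<odot>\<^bsub>V\<^esub> (x \<oplus>\<^bsub>V\<^esub> (- s) \<odot>\<^bsub>V\<^esub> b) = c \<odot>\<^bsub>V\<^esub> x \<oplus>\<^bsub>V\<^esub> (- (c * s)) \<odot>\<^bsub>V\<^esub> b"
          using smult bV V by (simp add: vs_smult_add)
        finally show ?case ..
      qed
    qed
    ultimately have "\<exists>d\<in>carrier (dual_space V). d b = 1 \<and> (\<forall>x\<in>N. d x = 0)"
      using coordinate_functional[OF V N bV] by blast
    then show ?thesis
      using sub by blast
  qed
  then obtain D where D: "\<And>b. b \<in> B \<Longrightarrow> D b \<in> carrier (dual_space V) \<and> D b b = 1 \<and> (\<forall>x\<in>B - {b}. D b x = 0)"
    by metis
  obtain e where e: "bij_betw e {..<card B} B"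
    using ex_bij_betw_nat_finite[OF B(1)] by (auto simp: atLeast0LessThan)
  have eB: "e i \<in> B" if "i < card B" for i
    using e that by (auto simp: bij_betw_def)
  have "dual_bases V (card B) e (\<lambda>i. D (e i))"
    unfolding dual_bases_def
  proof (intro conjI allI impI)
    have im: "e ` {..<card B} = B"
      using e by (simp add: bij_betw_def)
    show "e ` {..<card B} \<subseteq> carrier V" "lin_span V (e ` {..<card B}) = carrier V"
      using im B by auto
    show "(\<lambda>i. D (e i)) ` {..<card B} \<subseteq> carrier (dual_space V)"
      using D eB by auto
    fix i j assume ij: "i < card B" "j < card B"
    show "D (e i) (e j) = (if i = j then 1 else 0)"
    proof (cases "i = j")
      case True
      then show ?thesis using D eB ij by simp
    next
      case False
      then have "e j \<noteq> e i"
        using e ij by (auto simp: bij_betw_def inj_on_def)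
      then show ?thesis using D[of "e i"] eB ij False by auto
    qed
  qed
  then show ?thesis
    by blast
qed

lemma coordinate_expansion:
  assumes V: "vec_space V" and I: "finite I" and e: "\<And>i. i \<in> I \<Longrightarrow> e i \<in> carrier V"
    and c: "\<And>i. i \<in> I \<Longrightarrow> lin V base_field (c i)"
    and dual: "\<And>i j. i \<in> I \<Longrightarrow> j \<in> I \<Longrightarrow> c i (e j) = (if i = j then 1 else 0)"
    and span: "lin_span V (e ` I) = carrier V" and x: "x \<in> carrier V"
  shows "x = finsum V (\<lambda>i. c i x \<odot>\<^bsub>V\<^esub> e i) I"
proof (rule lin_ext[OF V V lin_ident _ _ span _ x])
  show "lin V V (\<lambda>x. finsum V (\<lambda>i. c i x \<odot>\<^bsub>V\<^esub> e i) I)"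
    using c e V I by (intro lin_finsum_fun lin_scale_fun) auto
  show "e ` I \<subseteq> carrier V"
    using e by auto
  fix x assume "x \<in> e ` I"
  then obtain i where i: "i \<in> I" "x = e i"
    by auto
  have "finsum V (\<lambda>j. c j (e i) \<odot>\<^bsub>V\<^esub> e j) I = c i (e i) \<odot>\<^bsub>V\<^esub> e i"
    using i e V I by (intro vs_finsum_single) (auto simp: dual)
  then show "x = finsum V (\<lambda>i. c i x \<odot>\<^bsub>V\<^esub> e i) I"
    using i e V by (simp add: dual)
qed

lemma dual_basesD:
  assumes "dual_bases V n b d"
  shows "\<And>i. i < n \<Longrightarrow> b i \<in> carrier V" "\<And>i. i < n \<Longrightarrow> d i \<in> carrier (dual_space V)"
    "\<And>i. i < n \<Longrightarrow> lin V base_field (d i)"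
    "\<And>i j. i < n \<Longrightarrow> j < n \<Longrightarrow> d i (b j) = (if i = j then 1 else 0)"
    "lin_span V (b ` {..<n}) = carrier V"
  using assms by (auto simp: dual_bases_def intro!: dual_space_lin)

lemma dual_bases_expansion:
  assumes V: "vec_space V" and db: "dual_bases V n b d" and x: "x \<in> carrier V"
  shows "x = finsum V (\<lambda>j. d j x \<odot>\<^bsub>V\<^esub> b j) {..<n}"
  by (rule coordinate_expansion[OF V finite_lessThan _ _ _ dual_basesD(5)[OF db] x])
    (simp_all add: dual_basesD[OF db])

lemma dual_bases_dual_expansion:
  assumes V: "vec_space V" and db: "dual_bases V n b d" and f: "f \<in> carrier (dual_space V)"
  shows "f = finsum (dual_space V) (\<lambda>j. f (b j) \<odot>\<^bsub>dual_space V\<^esub> d j) {..<n}"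
proof (rule lin_maps_eqI)
  note D = dual_basesD[OF db] and W = vec_space_dual_space[OF V]
  show "f \<in> lin_maps V base_field"
    using f by (simp add: carrier_dual_space)
  have cl: "f (b j) \<odot>\<^bsub>dual_space V\<^esub> d j \<in> carrier (dual_space V)" if "j < n" for j
    using D W that by simp
  then have "finsum (dual_space V) (\<lambda>j. f (b j) \<odot>\<^bsub>dual_space V\<^esub> d j) {..<n} \<in> carrier (dual_space V)"
    using W by (intro vs_finsum_closed) auto
  then show "finsum (dual_space V) (\<lambda>j. f (b j) \<odot>\<^bsub>dual_space V\<^esub> d j) {..<n} \<in> lin_maps V base_field"
    by (simp add: carrier_dual_space)
  fix x assume x: "x \<in> carrier V"
  have "f x = f (finsum V (\<lambda>j. d j x \<odot>\<^bsub>V\<^esub> b j) {..<n})"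
    using dual_bases_expansion[OF V db x] by simp
  also have "\<dots> = finsum base_field (\<lambda>j. f (d j x \<odot>\<^bsub>V\<^esub> b j)) {..<n}"
    using D V by (intro lin_finsum vec_space_base_field dual_space_lin f) auto
  also have "\<dots> = finsum base_field (\<lambda>j. (f (b j) \<odot>\<^bsub>dual_space V\<^esub> d j) x) {..<n}"
    using D dual_space_lin[OF f] x
    by (intro vs_finsum_cong vec_space_base_field) (auto simp: lin_smult)
  also have "\<dots> = (finsum (dual_space V) (\<lambda>j. f (b j) \<odot>\<^bsub>dual_space V\<^esub> d j) {..<n}) x"
    using cl x by (intro lin_finsum[OF W vec_space_base_field lin_eval_dual, symmetric]) auto
  finally show "f x = (finsum (dual_space V) (\<lambda>j. f (b j) \<odot>\<^bsub>dual_space V\<^esub> d j) {..<n}) x" .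
qed

section \<open>Algebras and quotients\<close>

lemma assoc_algebraI:
  assumes V: "vec_space A" and one: "\<one>\<^bsub>A\<^esub> \<in> carrier A"
    and bil: "bilin A A A (\<lambda>x y. x \<otimes>\<^bsub>A\<^esub> y)"
    and assoc: "\<And>x y z. x \<in> carrier A \<Longrightarrow> y \<in> carrier A \<Longrightarrow> z \<in> carrier A \<Longrightarrow>
           (x \<otimes>\<^bsub>A\<^esub> y) \<otimes>\<^bsub>A\<^esub> z = x \<otimes>\<^bsub>A\<^esub> (y \<otimes>\<^bsub>A\<^esub> z)"
    and l_one: "\<And>x. x \<in> carrier A \<Longrightarrow> \<one>\<^bsub>A\<^esub> \<otimes>\<^bsub>A\<^esub> x = x"
    and r_one: "\<And>x. x \<in> carrier A \<Longrightarrow> x \<otimes>\<^bsub>A\<^esub> \<one>\<^bsub>A\<^esub> = x"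
  shows "assoc_algebra A"
proof -
  have "ring A"
  proof (rule ringI)
    show "Group.monoid A"
      by (rule monoidI) (simp_all add: one assoc l_one r_one bilinD(1)[OF bil])
  qed (simp_all add: vs_abelian_group[OF V] bilinD[OF bil])
  then show ?thesis
    using V bilinD[OF bil] by (simp add: assoc_algebra_def)
qed

context
  fixes A :: "('k::field, 'a, 'x) module_scheme"
  assumes A: "assoc_algebra A"
begin

lemma alg_vec_space [simp]: "vec_space A"
  using A by (simp add: assoc_algebra_def)

lemma alg_ring: "ring A"
  using A by (simp add: assoc_algebra_def)

interpretation ring A
  by (rule alg_ring)

lemma alg_one_closed [simp]: "\<one>\<^bsub>A\<^esub> \<in> carrier A"
  by simp

lemma alg_mult_closed [simp]: "x \<in> carrier A \<Longrightarrow> y \<in> carrier A \<Longrightarrow> x \<otimes>\<^bsub>A\<^esub> y \<in> carrier A"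
  by simp

lemma alg_l_one [simp]: "x \<in> carrier A \<Longrightarrow> \<one>\<^bsub>A\<^esub> \<otimes>\<^bsub>A\<^esub> x = x"
  by simp

lemma alg_r_one [simp]: "x \<in> carrier A \<Longrightarrow> x \<otimes>\<^bsub>A\<^esub> \<one>\<^bsub>A\<^esub> = x"
  by simp

lemma alg_mult_assoc:
  "x \<in> carrier A \<Longrightarrow> y \<in> carrier A \<Longrightarrow> z \<in> carrier A \<Longrightarrow>
   (x \<otimes>\<^bsub>A\<^esub> y) \<otimes>\<^bsub>A\<^esub> z = x \<otimes>\<^bsub>A\<^esub> (y \<otimes>\<^bsub>A\<^esub> z)"
  by (rule m_assoc)

lemma alg_mult_bilin: "bilin A A A (\<lambda>x y. x \<otimes>\<^bsub>A\<^esub> y)"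
  using A by (intro bilinI) (simp_all add: l_distr r_distr assoc_algebra_def)

lemma alg_mult_zero [simp]: "x \<in> carrier A \<Longrightarrow> x \<otimes>\<^bsub>A\<^esub> \<zero>\<^bsub>A\<^esub> = \<zero>\<^bsub>A\<^esub>"
  by simp

lemma alg_zero_mult [simp]: "x \<in> carrier A \<Longrightarrow> \<zero>\<^bsub>A\<^esub> \<otimes>\<^bsub>A\<^esub> x = \<zero>\<^bsub>A\<^esub>"
  by simp

lemma ideal_subspace:
  assumes I: "ideal I A"
  shows "lin_subspace A I"
proof (rule lin_subspaceI[OF alg_vec_space])
  interpret I: ideal I A by (rule I)
  show "I \<subseteq> carrier A" "\<zero>\<^bsub>A\<^esub> \<in> I"
    by (simp_all add: I.a_subset)
  show "x \<oplus>\<^bsub>A\<^esub> y \<in> I" if "x \<in> I" "y \<in> I" for x y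
    using that by simp
  show "c \<odot>\<^bsub>A\<^esub> x \<in> I" if x: "x \<in> I" for c x
  proof -
    have xA: "x \<in> carrier A"
      using x I.a_subset by auto
    then have "(c \<odot>\<^bsub>A\<^esub> \<one>\<^bsub>A\<^esub>) \<otimes>\<^bsub>A\<^esub> x \<in> I"
      using x by (intro I.I_l_closed) auto
    then show ?thesis
      using xA bilinD(3)[OF alg_mult_bilin, of "\<one>\<^bsub>A\<^esub>" x c] by simp
  qed
qed

lemma subspace_idealI:
  assumes I: "lin_subspace A I"
    and l: "\<And>x a. x \<in> I \<Longrightarrow> a \<in> carrier A \<Longrightarrow> a \<otimes>\<^bsub>A\<^esub> x \<in> I"
    and r: "\<And>x a. x \<in> I \<Longrightarrow> a \<in> carrier A \<Longrightarrow> x \<otimes>\<^bsub>A\<^esub> a \<in> I"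
  shows "ideal I A"
proof (rule idealI[OF alg_ring])
  show "subgroup I (add_monoid A)"
    using I by (simp add: lin_subspace_def submodule_def)
qed (use l r in auto)

lemma Idl_ideal: "S \<subseteq> carrier A \<Longrightarrow> ideal (Idl\<^bsub>A\<^esub> S) A"
  by (rule genideal_ideal)

lemma Idl_superset: "S \<subseteq> Idl\<^bsub>A\<^esub> S"
  by (auto simp: genideal_def)

lemma Idl_least: "ideal I A \<Longrightarrow> S \<subseteq> I \<Longrightarrow> Idl\<^bsub>A\<^esub> S \<subseteq> I"
  by (rule genideal_minimal)

end

subsection \<open>Algebra homomorphisms\<close>

definition alg_hom ::
  "('k::field, 'a, 'x) module_scheme \<Rightarrow> ('k, 'b, 'y) module_scheme \<Rightarrow> ('a \<Rightarrow> 'b) \<Rightarrow> bool" where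
  "alg_hom A B f \<longleftrightarrow> lin A B f \<and> f \<one>\<^bsub>A\<^esub> = \<one>\<^bsub>B\<^esub> \<and>
     (\<forall>x\<in>carrier A. \<forall>y\<in>carrier A. f (x \<otimes>\<^bsub>A\<^esub> y) = f x \<otimes>\<^bsub>B\<^esub> f y)"

lemma alg_homI:
  assumes "lin A B f" "f \<one>\<^bsub>A\<^esub> = \<one>\<^bsub>B\<^esub>"
    and "\<And>x y. x \<in> carrier A \<Longrightarrow> y \<in> carrier A \<Longrightarrow> f (x \<otimes>\<^bsub>A\<^esub> y) = f x \<otimes>\<^bsub>B\<^esub> f y"
  shows "alg_hom A B f"
  using assms by (simp add: alg_hom_def)

lemma alg_homD:
  assumes "alg_hom A B f"
  shows alg_hom_lin: "lin A B f" and alg_hom_one: "f \<one>\<^bsub>A\<^esub> = \<one>\<^bsub>B\<^esub>"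
    and alg_hom_mult: "\<And>x y. x \<in> carrier A \<Longrightarrow> y \<in> carrier A \<Longrightarrow> f (x \<otimes>\<^bsub>A\<^esub> y) = f x \<otimes>\<^bsub>B\<^esub> f y"
    and alg_hom_closed: "\<And>x. x \<in> carrier A \<Longrightarrow> f x \<in> carrier B"
  using assms by (simp_all add: alg_hom_def lin_def)

lemma alg_hom_comp: "alg_hom A B f \<Longrightarrow> alg_hom B C g \<Longrightarrow> alg_hom A C (\<lambda>x. g (f x))"
  by (simp add: alg_hom_def lin_def)

lemma alg_hom_restrict [simp]:
  assumes "assoc_algebra A"
  shows "alg_hom A B (restrict f (carrier A)) \<longleftrightarrow> alg_hom A B f"
  using assms by (simp add: alg_hom_def)

lemma ring_hom_lin_maps_iff:
  "f \<in> ring_hom A B \<inter> lin_maps A B \<longleftrightarrow> alg_hom A B f \<and> f \<in> extensional (carrier A)"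
  by (auto simp: alg_hom_def lin_maps_iff ring_hom_def lin_def)

lemma QA_hom_iff:
  "f \<in> QA_hom A B \<longleftrightarrow> alg_hom A B f \<and> f \<in> extensional (carrier A) \<and> f ` gens A \<subseteq> gens B"
  using ring_hom_lin_maps_iff[of f A B] by (auto simp: QA_hom_def)

lemma alg_hom_preimage_ideal:
  assumes A: "assoc_algebra A" and B: "assoc_algebra B" and f: "alg_hom A B f" and I: "ideal I B"
  shows "ideal {x \<in> carrier A. f x \<in> I} A"
proof (rule subspace_idealI[OF A])
  show "lin_subspace A {x \<in> carrier A. f x \<in> I}"
    by (rule lin_subspace_vimage[OF alg_vec_space[OF A] alg_vec_space[OF B] alg_hom_lin[OF f] ideal_subspace[OF B I]])
qed (use A B f in \<open>auto simp: alg_homD ideal.I_l_closed[OF I] ideal.I_r_closed[OF I]\<close>)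

lemma alg_hom_kernel_ideal:
  assumes A: "assoc_algebra A" and B: "assoc_algebra B" and f: "alg_hom A B f"
  shows "ideal {x \<in> carrier A. f x = \<zero>\<^bsub>B\<^esub>} A"
proof -
  have "ideal {\<zero>\<^bsub>B\<^esub>} B"
    by (rule ring.zeroideal[OF alg_ring[OF B]])
  from alg_hom_preimage_ideal[OF A B f this] show ?thesis
    by simp
qed

lemma alg_hom_zero_on_Idl:
  assumes A: "assoc_algebra A" and B: "assoc_algebra B" and f: "alg_hom A B f"
    and S: "S \<subseteq> carrier A" "\<And>x. x \<in> S \<Longrightarrow> f x = \<zero>\<^bsub>B\<^esub>" and x: "x \<in> Idl\<^bsub>A\<^esub> S"
  shows "f x = \<zero>\<^bsub>B\<^esub>"
  using Idl_least[OF A alg_hom_kernel_ideal[OF A B f], of S] S x by auto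

lemma subalgebra_gen_least:
  assumes "subring B A" "lin_subspace A B" "S \<subseteq> B"
  shows "subalgebra_gen A S \<subseteq> B"
  using assms by (auto simp: subalgebra_gen_def)

lemma subalgebra_gen_superset: "S \<subseteq> subalgebra_gen A S"
  by (auto simp: subalgebra_gen_def)

lemma subring_of_subspace:
  assumes A: "assoc_algebra A" and B: "lin_subspace A B" and one: "\<one>\<^bsub>A\<^esub> \<in> B"
    and mult: "\<And>x y. x \<in> B \<Longrightarrow> y \<in> B \<Longrightarrow> x \<otimes>\<^bsub>A\<^esub> y \<in> B"
  shows "subring B A"
proof (rule subring.intro)
  show "subgroup B (add_monoid A)"
    using B by (simp add: lin_subspace_def submodule_def)
  show "submonoid B A"
    by (rule submonoid.intro) (use lin_subspaceD[OF alg_vec_space[OF A] B] one mult in auto)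
qed

lemma subringD:
  assumes "subring B A"
  shows "\<one>\<^bsub>A\<^esub> \<in> B" "\<And>x y. x \<in> B \<Longrightarrow> y \<in> B \<Longrightarrow> x \<otimes>\<^bsub>A\<^esub> y \<in> B"
  using assms by (auto simp: subring_def submonoid_def)

lemma subalgebra_gen_subalgebra:
  assumes A: "assoc_algebra A" and S: "S \<subseteq> carrier A"
  shows "lin_subspace A (subalgebra_gen A S)" "subring (subalgebra_gen A S) A"
proof -
  have V: "vec_space A"
    using A by simp
  have "subring (carrier A) A"
    using A by (intro subring_of_subspace lin_subspace_carrier) auto
  then have sub: "subalgebra_gen A S \<subseteq> carrier A"
    using V S by (intro subalgebra_gen_least lin_subspace_carrier)
  show *: "lin_subspace A (subalgebra_gen A S)"
  proof (rule lin_subspaceI[OF V sub])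
  qed (auto simp: subalgebra_gen_def lin_subspaceD[OF V])
  show "subring (subalgebra_gen A S) A"
    by (rule subring_of_subspace[OF A *]) (auto simp: subalgebra_gen_def subringD)
qed

lemma assoc_algebra_image:
  assumes A: "assoc_algebra A" and im: "f ` carrier A = carrier B"
    and add: "\<And>x y. x \<in> carrier A \<Longrightarrow> y \<in> carrier A \<Longrightarrow> f x \<oplus>\<^bsub>B\<^esub> f y = f (x \<oplus>\<^bsub>A\<^esub> y)"
    and smult: "\<And>c x. x \<in> carrier A \<Longrightarrow> c \<odot>\<^bsub>B\<^esub> f x = f (c \<odot>\<^bsub>A\<^esub> x)"
    and zero: "\<zero>\<^bsub>B\<^esub> = f \<zero>\<^bsub>A\<^esub>"
    and mult: "\<And>x y. x \<in> carrier A \<Longrightarrow> y \<in> carrier A \<Longrightarrow> f x \<otimes>\<^bsub>B\<^esub> f y = f (x \<otimes>\<^bsub>A\<^esub> y)"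
    and one: "\<one>\<^bsub>B\<^esub> = f \<one>\<^bsub>A\<^esub>"
  shows "assoc_algebra B"
proof (rule assoc_algebraI)
  note b = bilinD[OF alg_mult_bilin[OF A]]
  show "vec_space B"
    using A by (intro vec_space_image[OF _ im add smult zero]) auto
  show "bilin B B B (\<lambda>x y. x \<otimes>\<^bsub>B\<^esub> y)"
    by (rule bilinI; unfold im[symmetric]) (use A in \<open>auto simp: add smult mult b\<close>)
  show "\<one>\<^bsub>B\<^esub> \<in> carrier B"
    unfolding im[symmetric] one using A by simp
  show "(x \<otimes>\<^bsub>B\<^esub> y) \<otimes>\<^bsub>B\<^esub> z = x \<otimes>\<^bsub>B\<^esub> (y \<otimes>\<^bsub>B\<^esub> z)"
    if "x \<in> carrier B" "y \<in> carrier B" "z \<in> carrier B" for x y z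
    using that A unfolding im[symmetric] by (auto simp: mult alg_mult_assoc)
  show "\<one>\<^bsub>B\<^esub> \<otimes>\<^bsub>B\<^esub> x = x" "x \<otimes>\<^bsub>B\<^esub> \<one>\<^bsub>B\<^esub> = x" if "x \<in> carrier B" for x
    using that A unfolding im[symmetric] by (auto simp: mult one)
qed

subsection \<open>Quotients\<close>

lemma subspace_abelian_subgroup:
  assumes "vec_space V" "lin_subspace V N"
  shows "abelian_subgroup N V"
  using assms
  by (intro abelian_subgroupI3 additive_subgroup.intro vs_abelian_group)
    (auto simp: lin_subspace_def submodule_def)

context
  fixes V :: "('k::field, 'v, 'x) module_scheme" and N :: "'v set"
  assumes V: "vec_space V" and N: "lin_subspace V N"
begin

interpretation abelian_subgroup N V
  by (rule subspace_abelian_subgroup[OF V N])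

lemma quot_carrier: "carrier (quot_algebra V N) = (\<lambda>x. N +>\<^bsub>V\<^esub> x) ` carrier V"
  by (auto simp: quot_algebra_def FactRing_simps)

lemma quot_add:
  "x \<in> carrier V \<Longrightarrow> y \<in> carrier V \<Longrightarrow>
   (N +>\<^bsub>V\<^esub> x) \<oplus>\<^bsub>quot_algebra V N\<^esub> (N +>\<^bsub>V\<^esub> y) = N +>\<^bsub>V\<^esub> (x \<oplus>\<^bsub>V\<^esub> y)"
  by (simp add: quot_algebra_def FactRing_simps a_rcos_sum)

lemma quot_zero: "\<zero>\<^bsub>quot_algebra V N\<^esub> = N +>\<^bsub>V\<^esub> \<zero>\<^bsub>V\<^esub>"
  by (simp add: quot_algebra_def FactRing_simps a_subset)

lemma quot_eq_iff:
  assumes "x \<in> carrier V" "y \<in> carrier V"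
  shows "N +>\<^bsub>V\<^esub> x = N +>\<^bsub>V\<^esub> y \<longleftrightarrow> x \<oplus>\<^bsub>V\<^esub> (- 1) \<odot>\<^bsub>V\<^esub> y \<in> N"
proof -
  have "x \<oplus>\<^bsub>V\<^esub> (- 1) \<odot>\<^bsub>V\<^esub> y \<in> N \<longleftrightarrow> x \<in> N +>\<^bsub>V\<^esub> y"
    using assms a_rcos_module[of y x] by (simp add: vs_neg[OF V, symmetric])
  also have "\<dots> \<longleftrightarrow> N +>\<^bsub>V\<^esub> x = N +>\<^bsub>V\<^esub> y"
    using assms a_repr_independence' a_rcos_self by metis
  finally show ?thesis ..
qed

lemma quot_smult:
  assumes "x \<in> carrier V"
  shows "c \<odot>\<^bsub>quot_algebra V N\<^esub> (N +>\<^bsub>V\<^esub> x) = N +>\<^bsub>V\<^esub> (c \<odot>\<^bsub>V\<^esub> x)"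
proof -
  have "N +>\<^bsub>V\<^esub> (c \<odot>\<^bsub>V\<^esub> y) = N +>\<^bsub>V\<^esub> (c \<odot>\<^bsub>V\<^esub> x)" if y: "y \<in> N +>\<^bsub>V\<^esub> x" for y
  proof -
    have yV: "y \<in> carrier V"
      using y assms a_elemrcos_carrier by blast
    have "N +>\<^bsub>V\<^esub> y = N +>\<^bsub>V\<^esub> x"
      using y assms a_repr_independence' by metis
    then have "c \<odot>\<^bsub>V\<^esub> (y \<oplus>\<^bsub>V\<^esub> (- 1) \<odot>\<^bsub>V\<^esub> x) \<in> N"
      using assms yV quot_eq_iff lin_subspace_smult[OF V N] by simp
    also have "c \<odot>\<^bsub>V\<^esub> (y \<oplus>\<^bsub>V\<^esub> (- 1) \<odot>\<^bsub>V\<^esub> x) = c \<odot>\<^bsub>V\<^esub> y \<oplus>\<^bsub>V\<^esub> (- 1) \<odot>\<^bsub>V\<^esub> (c \<odot>\<^bsub>V\<^esub> x)"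
      using assms yV V by (simp add: vs_smult_add)
    finally show ?thesis
      using assms yV V by (subst quot_eq_iff) auto
  qed
  moreover have "x \<in> N +>\<^bsub>V\<^esub> x"
    using assms by (rule a_rcos_self)
  ultimately have "(\<Union>y\<in>N +>\<^bsub>V\<^esub> x. N +>\<^bsub>V\<^esub> (c \<odot>\<^bsub>V\<^esub> y)) = N +>\<^bsub>V\<^esub> (c \<odot>\<^bsub>V\<^esub> x)"
    by blast
  then show ?thesis
    by (simp add: quot_algebra_def)
qed

lemma vec_space_quot: "vec_space (quot_algebra V N)"
  by (rule vec_spaceI)
    (use V in \<open>auto simp: quot_carrier quot_add quot_zero quot_smult vs_add_assoc vs_add_comm vs_add_left_comm
      vs_neg_add vs_add_neg1 vs_add_smult vs_smult_add\<close>)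

lemma lin_quot_proj: "lin V (quot_algebra V N) (\<lambda>x. N +>\<^bsub>V\<^esub> x)"
  by (rule linI) (simp_all add: quot_carrier quot_add quot_smult)

lemma quot_proj_eq_zero_iff: "x \<in> carrier V \<Longrightarrow> N +>\<^bsub>V\<^esub> x = \<zero>\<^bsub>quot_algebra V N\<^esub> \<longleftrightarrow> x \<in> N"
  using V by (simp add: quot_zero quot_eq_iff)

lemma quot_lift:
  assumes U: "vec_space U" and f: "lin V U f" and ker: "\<And>x. x \<in> N \<Longrightarrow> f x = \<zero>\<^bsub>U\<^esub>"
  shows "\<exists>g\<in>lin_maps (quot_algebra V N) U. \<forall>x\<in>carrier V. g (N +>\<^bsub>V\<^esub> x) = f x"
proof -
  define g where "g = (\<lambda>X\<in>carrier (quot_algebra V N). f (SOME x. x \<in> carrier V \<and> X = N +>\<^bsub>V\<^esub> x))"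
  have g: "g (N +>\<^bsub>V\<^esub> x) = f x" if x: "x \<in> carrier V" for x
  proof -
    define y where "y = (SOME y. y \<in> carrier V \<and> N +>\<^bsub>V\<^esub> x = N +>\<^bsub>V\<^esub> y)"
    have y: "y \<in> carrier V" "N +>\<^bsub>V\<^esub> x = N +>\<^bsub>V\<^esub> y"
      using someI[of "\<lambda>y. y \<in> carrier V \<and> N +>\<^bsub>V\<^esub> x = N +>\<^bsub>V\<^esub> y" x] x by (auto simp: y_def)
    then have "f (x \<oplus>\<^bsub>V\<^esub> (- 1) \<odot>\<^bsub>V\<^esub> y) = \<zero>\<^bsub>U\<^esub>"
      using ker x quot_eq_iff by simp
    then have "f x = f y"
      using f x y V U by (simp add: linD vs_minus_eq_zero_iff)
    moreover have "g (N +>\<^bsub>V\<^esub> x) = f y"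
      using x by (simp add: g_def y_def quot_carrier)
    ultimately show ?thesis
      by simp
  qed
  have "lin (quot_algebra V N) U g"
    by (rule linI) (use f g V in \<open>auto simp: quot_carrier quot_add quot_smult linD\<close>)
  then have "g \<in> lin_maps (quot_algebra V N) U"
    by (auto simp: lin_maps_iff g_def)
  then show ?thesis
    using g by blast
qed

end

context
  fixes A :: "('k::field, 'a, 'x) module_scheme" and I :: "'a set"
  assumes A: "assoc_algebra A" and I: "ideal I A"
begin

lemma quot_mult:
  "x \<in> carrier A \<Longrightarrow> y \<in> carrier A \<Longrightarrow>
   (I +>\<^bsub>A\<^esub> x) \<otimes>\<^bsub>quot_algebra A I\<^esub> (I +>\<^bsub>A\<^esub> y) = I +>\<^bsub>A\<^esub> (x \<otimes>\<^bsub>A\<^esub> y)"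
  using ideal.rcoset_mult_add[OF I] by (simp add: quot_algebra_def FactRing_def)

lemma quot_one: "\<one>\<^bsub>quot_algebra A I\<^esub> = I +>\<^bsub>A\<^esub> \<one>\<^bsub>A\<^esub>"
  by (simp add: quot_algebra_def FactRing_def)

lemmas quot_alg_simps = quot_carrier[OF alg_vec_space[OF A] ideal_subspace[OF A I]]
  quot_add[OF alg_vec_space[OF A] ideal_subspace[OF A I]]
  quot_smult[OF alg_vec_space[OF A] ideal_subspace[OF A I]]
  quot_zero[OF alg_vec_space[OF A] ideal_subspace[OF A I]]
  quot_mult quot_one

lemma assoc_algebra_quot: "assoc_algebra (quot_algebra A I)"
proof (rule assoc_algebraI)
  show "vec_space (quot_algebra A I)"
    using A by (intro vec_space_quot ideal_subspace[OF A I]) simp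
  show "bilin (quot_algebra A I) (quot_algebra A I) (quot_algebra A I) (\<lambda>x y. x \<otimes>\<^bsub>quot_algebra A I\<^esub> y)"
    by (rule bilinI) (use A in \<open>auto simp: quot_alg_simps bilinD[OF alg_mult_bilin[OF A]]\<close>)
qed (use A in \<open>auto simp: quot_alg_simps alg_mult_assoc\<close>)

lemma alg_hom_quot_proj: "alg_hom A (quot_algebra A I) (\<lambda>x. I +>\<^bsub>A\<^esub> x)"
  using A by (intro alg_homI lin_quot_proj ideal_subspace[OF A I]) (auto simp: quot_alg_simps)

lemma quot_lift_alg_hom:
  assumes B: "assoc_algebra B" and f: "alg_hom A B f" and ker: "\<And>x. x \<in> I \<Longrightarrow> f x = \<zero>\<^bsub>B\<^esub>"
  shows "\<exists>g\<in>extensional (carrier (quot_algebra A I)).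
    alg_hom (quot_algebra A I) B g \<and> (\<forall>x\<in>carrier A. g (I +>\<^bsub>A\<^esub> x) = f x)"
proof -
  obtain g where g: "g \<in> lin_maps (quot_algebra A I) B" "\<And>x. x \<in> carrier A \<Longrightarrow> g (I +>\<^bsub>A\<^esub> x) = f x"
    using quot_lift[OF alg_vec_space[OF A] ideal_subspace[OF A I] alg_vec_space[OF B] alg_hom_lin[OF f] ker]
    by blast
  have "alg_hom (quot_algebra A I) B g"
    by (rule alg_homI) (use g f A in \<open>auto simp: lin_maps_lin quot_alg_simps alg_homD\<close>)
  then show ?thesis
    using g by (auto simp: lin_maps_iff)
qed

end

section \<open>Monoid algebras\<close>

lemma lookup_scale [simp]:
  "Poly_Mapping.lookup (Poly_Mapping.map ((*) c) p) x = (c::'k::field) * Poly_Mapping.lookup p x"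
  by (simp add: Poly_Mapping.map.rep_eq when_def)

lemma keys_scale: "Poly_Mapping.keys (Poly_Mapping.map ((*) (c::'k::field)) p) \<subseteq> Poly_Mapping.keys p"
  by (auto simp: in_keys_iff)

lemma scale_single [simp]:
  "Poly_Mapping.map ((*) (c::'k::field)) (Poly_Mapping.single x a) = Poly_Mapping.single x (c * a)"
  by (rule poly_mapping_eqI) (simp add: lookup_single when_def)

lemma monoid_algebra_simps [simp]:
  "carrier (monoid_algebra G) = {p. Poly_Mapping.keys p \<subseteq> carrier G}"
  "\<zero>\<^bsub>monoid_algebra G\<^esub> = 0"
  "p \<oplus>\<^bsub>monoid_algebra G\<^esub> q = p + q"
  "c \<odot>\<^bsub>monoid_algebra G\<^esub> p = Poly_Mapping.map ((*) c) p"
  "\<one>\<^bsub>monoid_algebra G\<^esub> = Poly_Mapping.single \<one>\<^bsub>G\<^esub> 1"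
  by (simp_all add: monoid_algebra_def)

lemma keys_addI: "Poly_Mapping.keys p \<subseteq> S \<Longrightarrow> Poly_Mapping.keys q \<subseteq> S \<Longrightarrow> Poly_Mapping.keys (p + q) \<subseteq> S"
  using Poly_Mapping.keys_add[of p q] by blast

lemma keys_diffI:
  "Poly_Mapping.keys p \<subseteq> S \<Longrightarrow> Poly_Mapping.keys q \<subseteq> S \<Longrightarrow> Poly_Mapping.keys (p - q :: 'a \<Rightarrow>\<^sub>0 'k::field) \<subseteq> S"
  using keys_diff[of p q] by blast

lemma keys_singleI: "x \<in> S \<Longrightarrow> Poly_Mapping.keys (Poly_Mapping.single x a) \<subseteq> S"
  by simp

lemma keys_sumI:
  "(\<And>i. i \<in> I \<Longrightarrow> Poly_Mapping.keys (f i) \<subseteq> S) \<Longrightarrow> Poly_Mapping.keys (sum f I) \<subseteq> S"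
proof (induction I rule: infinite_finite_induct)
  case (insert i I)
  then have "Poly_Mapping.keys (f i + sum f I) \<subseteq> S"
    by (intro keys_addI) simp_all
  then show ?case
    using insert by simp
qed simp_all

lemma vec_space_monoid_algebra:
  "vec_space (monoid_algebra G :: ('k::field, 'm \<Rightarrow>\<^sub>0 'k) module)" (is "vec_space ?A")
proof (rule vec_spaceI)
  fix c :: 'k and p q :: "'m \<Rightarrow>\<^sub>0 'k"
  assume p: "p \<in> carrier ?A"
  then show "c \<odot>\<^bsub>?A\<^esub> p \<in> carrier ?A"
    using keys_scale[of c p] by auto
  show "p \<oplus>\<^bsub>?A\<^esub> q \<in> carrier ?A" if "q \<in> carrier ?A"
    using p that keys_addI[of p _ q] by simp
qed (auto intro!: poly_mapping_eqI simp: lookup_add algebra_simps)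

lemma monoid_algebra_diff:
  "p - q = p \<oplus>\<^bsub>monoid_algebra G\<^esub> (- 1) \<odot>\<^bsub>monoid_algebra G\<^esub> (q :: 'm \<Rightarrow>\<^sub>0 'k::field)"
  by (rule poly_mapping_eqI) (simp add: lookup_add lookup_minus)

lemma lin_monoid_algebra_diff:
  assumes "lin (monoid_algebra G) U f" "vec_space U"
    and "Poly_Mapping.keys p \<subseteq> carrier G" "Poly_Mapping.keys q \<subseteq> carrier G"
  shows "f (p - q) = f p \<oplus>\<^bsub>U\<^esub> (- 1) \<odot>\<^bsub>U\<^esub> f q"
  using assms keys_scale[of "- 1" q]
  by (subst monoid_algebra_diff[of p q G], subst lin_add[OF assms(1)], simp, force)
    (subst lin_smult[OF assms(1)], simp_all)

lemma monoid_algebra_span: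
  "lin_span (monoid_algebra G) ((\<lambda>x. Poly_Mapping.single x (1::'k::field)) ` carrier G) = carrier (monoid_algebra G)"
    (is "lin_span ?A ?S = _")
proof
  have S: "?S \<subseteq> carrier ?A"
    by auto
  note sub = lin_subspaceD[OF vec_space_monoid_algebra lin_span_subspace[OF vec_space_monoid_algebra S]]
  show "lin_span ?A ?S \<subseteq> carrier ?A"
    by (rule sub)
  have "p \<in> lin_span ?A ?S" if "finite F" "F \<subseteq> carrier G" "Poly_Mapping.keys p \<subseteq> F" for p F
    using that
  proof (induction F arbitrary: p)
    case empty
    then show ?case
      using sub(2) by simp
  next
    case (insert x F)
    let ?q = "Poly_Mapping.single x (Poly_Mapping.lookup p x)"
    have "Poly_Mapping.keys (p - ?q) \<subseteq> F"
    proof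
      fix y assume "y \<in> Poly_Mapping.keys (p - ?q)"
      then show "y \<in> F"
        using insert.prems by (cases "y = x") (auto simp: in_keys_iff lookup_minus lookup_single)
    qed
    then have 1: "p - ?q \<in> lin_span ?A ?S"
      using insert by auto
    have "Poly_Mapping.single x 1 \<in> lin_span ?A ?S"
      using insert lin_span_superset[of ?S ?A] by auto
    then have "Poly_Mapping.lookup p x \<odot>\<^bsub>?A\<^esub> Poly_Mapping.single x 1 \<in> lin_span ?A ?S"
      by (rule sub)
    with 1 have "(p - ?q) \<oplus>\<^bsub>?A\<^esub> Poly_Mapping.lookup p x \<odot>\<^bsub>?A\<^esub> Poly_Mapping.single x 1 \<in> lin_span ?A ?S"
      by (rule sub)
    then show ?case
      by simp
  qed
  then show "carrier ?A \<subseteq> lin_span ?A ?S"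
    by (metis (no_types, lifting) finite_keys mem_Collect_eq monoid_algebra_simps(1) order_refl subsetI)
qed

text \<open>The extension of \<open>f\<close> from the basis \<open>carrier G\<close> to the free vector space.\<close>

definition free_lift ::
  "('k::field, 'u, 'x) module_scheme \<Rightarrow> ('m \<Rightarrow> 'u) \<Rightarrow> ('m \<Rightarrow>\<^sub>0 'k) \<Rightarrow> 'u" where
  "free_lift U f p = finsum U (\<lambda>x. Poly_Mapping.lookup p x \<odot>\<^bsub>U\<^esub> f x) (Poly_Mapping.keys p)"

lemma free_lift_superset:
  assumes U: "vec_space U" and "finite F" "Poly_Mapping.keys p \<subseteq> F" and f: "\<And>x. x \<in> F \<Longrightarrow> f x \<in> carrier U"
  shows "free_lift U f p = finsum U (\<lambda>x. Poly_Mapping.lookup p x \<odot>\<^bsub>U\<^esub> f x) F"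
  unfolding free_lift_def
  by (rule vs_finsum_mono_neutral[symmetric]) (use assms in \<open>auto simp: in_keys_iff subset_iff\<close>)

lemma lin_free_lift:
  fixes U :: "('k::field, 'u, 'x) module_scheme" and f :: "'m \<Rightarrow> 'u"
  assumes U: "vec_space U" and f: "\<And>x. x \<in> carrier G \<Longrightarrow> f x \<in> carrier U"
  shows "lin (monoid_algebra G) U (free_lift U f)"
proof (rule linI)
  fix p q :: "'m \<Rightarrow>\<^sub>0 'k"
  assume "p \<in> carrier (monoid_algebra G)" "q \<in> carrier (monoid_algebra G)"
  then have pq: "Poly_Mapping.keys p \<subseteq> carrier G" "Poly_Mapping.keys q \<subseteq> carrier G"
    by auto
  have cl: "c \<odot>\<^bsub>U\<^esub> f x \<in> carrier U" if "x \<in> carrier G" for c x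
    using that U f by simp
  define F where "F = Poly_Mapping.keys p \<union> Poly_Mapping.keys q"
  have F: "finite F" "F \<subseteq> carrier G" "Poly_Mapping.keys (p + q) \<subseteq> F"
    using pq Poly_Mapping.keys_add[of p q] by (auto simp: F_def)
  have "free_lift U f (p + q) = finsum U (\<lambda>x. Poly_Mapping.lookup (p + q) x \<odot>\<^bsub>U\<^esub> f x) F"
    using F f U by (intro free_lift_superset) auto
  also have "\<dots> = finsum U (\<lambda>x. Poly_Mapping.lookup p x \<odot>\<^bsub>U\<^esub> f x \<oplus>\<^bsub>U\<^esub> Poly_Mapping.lookup q x \<odot>\<^bsub>U\<^esub> f x) F"
    using F f U by (intro vs_finsum_cong) (auto simp: lookup_add vs_add_smult subset_iff)
  also have "\<dots> = finsum U (\<lambda>x. Poly_Mapping.lookup p x \<odot>\<^bsub>U\<^esub> f x) F \<oplus>\<^bsub>U\<^esub> finsum U (\<lambda>x. Poly_Mapping.lookup q x \<odot>\<^bsub>U\<^esub> f x) F"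
    using F cl U by (intro vs_finsum_add) auto
  also have "\<dots> = free_lift U f p \<oplus>\<^bsub>U\<^esub> free_lift U f q"
    using F(2) f by (subst (1 2) free_lift_superset[OF U F(1)]) (auto simp: F_def)
  finally show "free_lift U f (p \<oplus>\<^bsub>monoid_algebra G\<^esub> q) = free_lift U f p \<oplus>\<^bsub>U\<^esub> free_lift U f q"
    by simp
next
  fix c and p :: "'m \<Rightarrow>\<^sub>0 'k" assume "p \<in> carrier (monoid_algebra G)"
  then have p: "Poly_Mapping.keys p \<subseteq> carrier G"
    by auto
  have cl: "c \<odot>\<^bsub>U\<^esub> f x \<in> carrier U" if "x \<in> carrier G" for c x
    using that U f by simp
  have "free_lift U f (Poly_Mapping.map ((*) c) p)
    = finsum U (\<lambda>x. (c * Poly_Mapping.lookup p x) \<odot>\<^bsub>U\<^esub> f x) (Poly_Mapping.keys p)"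
    using free_lift_superset[OF U _ keys_scale[of c p], of f] p f by auto
  also have "\<dots> = c \<odot>\<^bsub>U\<^esub> free_lift U f p"
    unfolding free_lift_def using U p f cl
    by (subst vs_smult_finsum) (auto intro!: vs_finsum_cong)
  finally show "free_lift U f (c \<odot>\<^bsub>monoid_algebra G\<^esub> p) = c \<odot>\<^bsub>U\<^esub> free_lift U f p"
    by simp
next
  fix p :: "'m \<Rightarrow>\<^sub>0 'k" assume "p \<in> carrier (monoid_algebra G)"
  then show "free_lift U f p \<in> carrier U"
    unfolding free_lift_def using U f by (intro vs_finsum_closed) auto
qed

lemma free_lift_single:
  assumes U: "vec_space U" and f: "f x \<in> carrier U"
  shows "free_lift U f (Poly_Mapping.single x c) = c \<odot>\<^bsub>U\<^esub> f x"
proof -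
  have "free_lift U f (Poly_Mapping.single x c)
    = finsum U (\<lambda>y. Poly_Mapping.lookup (Poly_Mapping.single x c) y \<odot>\<^bsub>U\<^esub> f y) {x}"
    using assms by (intro free_lift_superset) auto
  also have "\<dots> = Poly_Mapping.lookup (Poly_Mapping.single x c) x \<odot>\<^bsub>U\<^esub> f x"
    using assms by (intro vs_finsum_single) auto
  finally show ?thesis
    by simp
qed

lemma monoid_algebra_eqI:
  fixes U :: "('k::field, 'u, 'x) module_scheme"
  assumes "vec_space U" "lin (monoid_algebra G) U f" "lin (monoid_algebra G) U g"
    and "\<And>x. x \<in> carrier G \<Longrightarrow> f (Poly_Mapping.single x 1) = g (Poly_Mapping.single x 1)"
    and "p \<in> carrier (monoid_algebra G)"
  shows "f p = g p"
proof (rule lin_eq_on_span[OF vec_space_monoid_algebra assms(1-3)])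
  show "(\<lambda>x. Poly_Mapping.single x 1) ` carrier G \<subseteq> carrier (monoid_algebra G)"
    by auto
  show "f x = g x" if "x \<in> (\<lambda>x. Poly_Mapping.single x 1) ` carrier G" for x
    using that assms(4) by blast
  show "p \<in> lin_span (monoid_algebra G) ((\<lambda>x. Poly_Mapping.single x 1) ` carrier G)"
    using assms(5) by (simp only: monoid_algebra_span)
qed

lemma monoid_algebra_bilin_eqI:
  assumes U: "vec_space U" and f: "bilin (monoid_algebra G) (monoid_algebra H) U f"
    and g: "bilin (monoid_algebra G) (monoid_algebra H) U g"
    and eq: "\<And>x y. x \<in> carrier G \<Longrightarrow> y \<in> carrier H \<Longrightarrow>
      f (Poly_Mapping.single x 1) (Poly_Mapping.single y 1) = g (Poly_Mapping.single x 1) (Poly_Mapping.single y 1)"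
    and p: "p \<in> carrier (monoid_algebra G)" and q: "q \<in> carrier (monoid_algebra H)"
  shows "f p q = g p q"
proof (rule monoid_algebra_eqI[OF U bilin_lin_left[OF f q] bilin_lin_left[OF g q] _ p])
  fix x assume "x \<in> carrier G"
  then show "f (Poly_Mapping.single x 1) q = g (Poly_Mapping.single x 1) q"
    by (intro monoid_algebra_eqI[OF U bilin_lin_right[OF f] bilin_lin_right[OF g] _ q] eq) auto
qed

lemma monoid_algebra_mult_superset:
  fixes p q :: "'m \<Rightarrow>\<^sub>0 'k::field"
  assumes "finite E" "Poly_Mapping.keys p \<subseteq> E" "finite F" "Poly_Mapping.keys q \<subseteq> F"
  shows "p \<otimes>\<^bsub>monoid_algebra G\<^esub> q = (\<Sum>x\<in>E. \<Sum>y\<in>F.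
    Poly_Mapping.single (x \<otimes>\<^bsub>G\<^esub> y) (Poly_Mapping.lookup p x * Poly_Mapping.lookup q y))"
proof -
  have "p \<otimes>\<^bsub>monoid_algebra G\<^esub> q = (\<Sum>x\<in>Poly_Mapping.keys p. \<Sum>y\<in>F.
    Poly_Mapping.single (x \<otimes>\<^bsub>G\<^esub> y) (Poly_Mapping.lookup p x * Poly_Mapping.lookup q y))"
    unfolding monoid_algebra_def monoid.simps using assms
    by (intro sum.cong refl sum.mono_neutral_left) (auto simp: not_in_keys_iff_lookup_eq_zero)
  also have "\<dots> = (\<Sum>x\<in>E. \<Sum>y\<in>F.
    Poly_Mapping.single (x \<otimes>\<^bsub>G\<^esub> y) (Poly_Mapping.lookup p x * Poly_Mapping.lookup q y))"
    using assms by (intro sum.mono_neutral_left) (auto simp: in_keys_iff)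
  finally show ?thesis .
qed

lemma monoid_algebra_mult_single [simp]:
  "Poly_Mapping.single x a \<otimes>\<^bsub>monoid_algebra G\<^esub> Poly_Mapping.single y b
    = Poly_Mapping.single (x \<otimes>\<^bsub>G\<^esub> y) (a * b :: 'k::field)"
  by (subst monoid_algebra_mult_superset[of "{x}" _ "{y}"]) auto

lemma sum_scale:
  "Poly_Mapping.map ((*) (c::'k::field)) (sum f I) = (\<Sum>i\<in>I. Poly_Mapping.map ((*) c) (f i))"
  by (rule poly_mapping_eqI) (simp add: lookup_sum sum_distrib_left)

lemma monoid_algebra_mult_bilin:
  assumes G: "\<And>x y. x \<in> carrier G \<Longrightarrow> y \<in> carrier G \<Longrightarrow> x \<otimes>\<^bsub>G\<^esub> y \<in> carrier G"
  shows "bilin (monoid_algebra G) (monoid_algebra G) (monoid_algebra G :: ('k::field, 'm \<Rightarrow>\<^sub>0 'k) module)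
    (\<lambda>p q. p \<otimes>\<^bsub>monoid_algebra G\<^esub> q)"
proof (rule bilinI)
  fix p q :: "'m \<Rightarrow>\<^sub>0 'k"
  assume "p \<in> carrier (monoid_algebra G)" "q \<in> carrier (monoid_algebra G)"
  then show "p \<otimes>\<^bsub>monoid_algebra G\<^esub> q \<in> carrier (monoid_algebra G)"
    using G by (simp, subst monoid_algebra_mult_superset[OF finite_keys order_refl finite_keys order_refl])
      (intro keys_sumI keys_singleI, auto)
next
  fix p p' q :: "'m \<Rightarrow>\<^sub>0 'k"
  let ?E = "Poly_Mapping.keys p \<union> Poly_Mapping.keys p'"
  have E: "finite ?E" "Poly_Mapping.keys (p + p') \<subseteq> ?E"
    using Poly_Mapping.keys_add[of p p'] by auto
  show "(p \<oplus>\<^bsub>monoid_algebra G\<^esub> p') \<otimes>\<^bsub>monoid_algebra G\<^esub> q =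
    p \<otimes>\<^bsub>monoid_algebra G\<^esub> q \<oplus>\<^bsub>monoid_algebra G\<^esub> p' \<otimes>\<^bsub>monoid_algebra G\<^esub> q"
    using monoid_algebra_mult_superset[OF E(1) E(2) finite_keys order_refl, of G q]
      monoid_algebra_mult_superset[OF E(1) Un_upper1 finite_keys order_refl, of G q]
      monoid_algebra_mult_superset[OF E(1) Un_upper2 finite_keys order_refl, of G q]
    by (simp add: lookup_add distrib_right single_add sum.distrib)
next
  fix p q q' :: "'m \<Rightarrow>\<^sub>0 'k"
  let ?E = "Poly_Mapping.keys q \<union> Poly_Mapping.keys q'"
  have E: "finite ?E" "Poly_Mapping.keys (q + q') \<subseteq> ?E"
    using Poly_Mapping.keys_add[of q q'] by auto
  show "p \<otimes>\<^bsub>monoid_algebra G\<^esub> (q \<oplus>\<^bsub>monoid_algebra G\<^esub> q') =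
    p \<otimes>\<^bsub>monoid_algebra G\<^esub> q \<oplus>\<^bsub>monoid_algebra G\<^esub> p \<otimes>\<^bsub>monoid_algebra G\<^esub> q'"
    using monoid_algebra_mult_superset[OF finite_keys order_refl E(1) E(2), of G p]
      monoid_algebra_mult_superset[OF finite_keys order_refl E(1) Un_upper1, of G p]
      monoid_algebra_mult_superset[OF finite_keys order_refl E(1) Un_upper2, of G p]
    by (simp add: lookup_add distrib_left single_add sum.distrib)
next
  fix c and p q :: "'m \<Rightarrow>\<^sub>0 'k"
  show "(c \<odot>\<^bsub>monoid_algebra G\<^esub> p) \<otimes>\<^bsub>monoid_algebra G\<^esub> q = c \<odot>\<^bsub>monoid_algebra G\<^esub> (p \<otimes>\<^bsub>monoid_algebra G\<^esub> q)"
    using monoid_algebra_mult_superset[OF finite_keys keys_scale[of c p] finite_keys order_refl, of G q]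
      monoid_algebra_mult_superset[OF finite_keys order_refl finite_keys order_refl, of G p q]
    by (simp add: sum_scale mult.assoc)
  show "p \<otimes>\<^bsub>monoid_algebra G\<^esub> (c \<odot>\<^bsub>monoid_algebra G\<^esub> q) = c \<odot>\<^bsub>monoid_algebra G\<^esub> (p \<otimes>\<^bsub>monoid_algebra G\<^esub> q)"
    using monoid_algebra_mult_superset[OF finite_keys order_refl finite_keys keys_scale[of c q], of G p]
      monoid_algebra_mult_superset[OF finite_keys order_refl finite_keys order_refl, of G p q]
    by (simp add: sum_scale mult.left_commute)
qed

lemma assoc_algebra_monoid_algebra:
  assumes G: "Group.monoid G"
  shows "assoc_algebra (monoid_algebra G :: ('k::field, 'm \<Rightarrow>\<^sub>0 'k) module)" (is "assoc_algebra ?A")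
proof -
  interpret monoid G by (rule G)
  have bil: "bilin ?A ?A ?A (\<lambda>p q. p \<otimes>\<^bsub>?A\<^esub> q)"
    by (rule monoid_algebra_mult_bilin) simp
  note V = vec_space_monoid_algebra[of G, where 'k = 'k]
  note bl = bilin_lin_left[OF bil] and br = bilin_lin_right[OF bil]
  note s = monoid_algebra_eqI[OF V]
  have cl: "p \<otimes>\<^bsub>?A\<^esub> q \<in> carrier ?A" if "p \<in> carrier ?A" "q \<in> carrier ?A" for p q
    using bilinD(1)[OF bil that] .
  have sc: "Poly_Mapping.single x 1 \<in> carrier ?A" if "x \<in> carrier G" for x
    using that by simp
  have 3: "(p \<otimes>\<^bsub>?A\<^esub> q) \<otimes>\<^bsub>?A\<^esub> r = p \<otimes>\<^bsub>?A\<^esub> (q \<otimes>\<^bsub>?A\<^esub> r)"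
    if p: "p \<in> carrier ?A" and q: "q \<in> carrier ?A" and r: "r \<in> carrier ?A" for p q r
  proof (rule s[OF lin_comp[OF bl[OF q] bl[OF r]] bl[OF cl[OF q r]] _ p])
    fix x assume x: "x \<in> carrier G"
    let ?x = "Poly_Mapping.single x 1 :: 'm \<Rightarrow>\<^sub>0 'k"
    show "(?x \<otimes>\<^bsub>?A\<^esub> q) \<otimes>\<^bsub>?A\<^esub> r = ?x \<otimes>\<^bsub>?A\<^esub> (q \<otimes>\<^bsub>?A\<^esub> r)"
    proof (rule s[OF lin_comp[OF br[OF sc[OF x]] bl[OF r]] lin_comp[OF bl[OF r] br[OF sc[OF x]]] _ q])
      fix y assume y: "y \<in> carrier G"
      let ?y = "Poly_Mapping.single y 1 :: 'm \<Rightarrow>\<^sub>0 'k"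
      have "?x \<otimes>\<^bsub>?A\<^esub> ?y \<in> carrier ?A"
        using x y by simp
      then show "(?x \<otimes>\<^bsub>?A\<^esub> ?y) \<otimes>\<^bsub>?A\<^esub> r = ?x \<otimes>\<^bsub>?A\<^esub> (?y \<otimes>\<^bsub>?A\<^esub> r)"
        by (rule s[OF br lin_comp[OF br[OF sc[OF y]] br[OF sc[OF x]]] _ r])
          (use x y in \<open>simp add: m_assoc\<close>)
    qed
  qed
  show ?thesis
  proof (rule assoc_algebraI[OF V _ bil 3])
    show one: "\<one>\<^bsub>?A\<^esub> \<in> carrier ?A"
      by simp
    show "\<one>\<^bsub>?A\<^esub> \<otimes>\<^bsub>?A\<^esub> p = p" if "p \<in> carrier ?A" for p
      by (rule s[OF br[OF one] lin_ident _ that]) simp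
    show "p \<otimes>\<^bsub>?A\<^esub> \<one>\<^bsub>?A\<^esub> = p" if "p \<in> carrier ?A" for p
      by (rule s[OF bl[OF one] lin_ident _ that]) simp
  qed
qed

lemma alg_hom_free_lift:
  assumes G: "Group.monoid G" and B: "assoc_algebra B"
    and f: "\<And>x. x \<in> carrier G \<Longrightarrow> f x \<in> carrier B" "f \<one>\<^bsub>G\<^esub> = \<one>\<^bsub>B\<^esub>"
      "\<And>x y. x \<in> carrier G \<Longrightarrow> y \<in> carrier G \<Longrightarrow> f (x \<otimes>\<^bsub>G\<^esub> y) = f x \<otimes>\<^bsub>B\<^esub> f y"
  shows "alg_hom (monoid_algebra G) B (free_lift B f)"
proof -
  interpret monoid G by (rule G)
  let ?A = "monoid_algebra G"
  have A: "assoc_algebra ?A"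
    by (rule assoc_algebra_monoid_algebra[OF G])
  have l: "lin ?A B (free_lift B f)"
    using B f by (intro lin_free_lift) auto
  have s: "free_lift B f (Poly_Mapping.single x 1) = f x" if "x \<in> carrier G" for x
    using that f(1) B by (simp add: free_lift_single)
  show ?thesis
  proof (rule alg_homI[OF l])
    show "free_lift B f \<one>\<^bsub>?A\<^esub> = \<one>\<^bsub>B\<^esub>"
      using f s by simp
    show "free_lift B f (p \<otimes>\<^bsub>?A\<^esub> q) = free_lift B f p \<otimes>\<^bsub>B\<^esub> free_lift B f q"
      if pq: "p \<in> carrier ?A" "q \<in> carrier ?A" for p q
    proof (rule monoid_algebra_bilin_eqI[OF alg_vec_space[OF B] _ _ _ pq])
      show "bilin ?A ?A B (\<lambda>p q. free_lift B f (p \<otimes>\<^bsub>?A\<^esub> q))"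
        by (rule bilin_comp[OF alg_mult_bilin[OF A] lin_ident lin_ident l])
      show "bilin ?A ?A B (\<lambda>p q. free_lift B f p \<otimes>\<^bsub>B\<^esub> free_lift B f q)"
        by (rule bilin_comp[OF alg_mult_bilin[OF B] l l lin_ident])
    qed (simp add: s f)
  qed
qed

section \<open>Tensor products\<close>

lemma DirProd_simps [simp]:
  "carrier (G \<times>\<times> H) = carrier G \<times> carrier H"
  "(g, h) \<otimes>\<^bsub>G \<times>\<times> H\<^esub> (g', h') = (g \<otimes>\<^bsub>G\<^esub> g', h \<otimes>\<^bsub>H\<^esub> h')"
  "\<one>\<^bsub>G \<times>\<times> H\<^esub> = (\<one>\<^bsub>G\<^esub>, \<one>\<^bsub>H\<^esub>)"
  by (simp_all add: DirProd_def)

lemma add_scale_uminus: "p + Poly_Mapping.map ((*) (- 1)) q = p - (q :: 'm \<Rightarrow>\<^sub>0 'k::field)"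
  by (rule poly_mapping_eqI) (simp add: lookup_add lookup_minus)

text \<open>
  The four families of bilinearity relations, separated from their span for case distinctions.
\<close>

definition tensor_gens ::
  "('k::field, 'v, 'x) module_scheme \<Rightarrow> ('k, 'w, 'y) module_scheme \<Rightarrow> ('v \<times> 'w \<Rightarrow>\<^sub>0 'k) set" where
  "tensor_gens V W =
     ({Poly_Mapping.single (v \<oplus>\<^bsub>V\<^esub> v', w) 1 - Poly_Mapping.single (v, w) 1
         - Poly_Mapping.single (v', w) 1
         | v v' w. v \<in> carrier V \<and> v' \<in> carrier V \<and> w \<in> carrier W} \<union>
      {Poly_Mapping.single (v, w \<oplus>\<^bsub>W\<^esub> w') 1 - Poly_Mapping.single (v, w) 1
         - Poly_Mapping.single (v, w') 1
         | v w w'. v \<in> carrier V \<and> w \<in> carrier W \<and> w' \<in> carrier W} \<union>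
      {Poly_Mapping.single (c \<odot>\<^bsub>V\<^esub> v, w) 1 - Poly_Mapping.single (v, w) c
         | c v w. v \<in> carrier V \<and> w \<in> carrier W} \<union>
      {Poly_Mapping.single (v, c \<odot>\<^bsub>W\<^esub> w) 1 - Poly_Mapping.single (v, w) c
         | c v w. v \<in> carrier V \<and> w \<in> carrier W})"

lemma tensor_rels_eq: "tensor_rels V W = lin_span (monoid_algebra (V \<times>\<times> W)) (tensor_gens V W)"
  by (simp only: tensor_rels_def tensor_gens_def)

lemma tensor_gens_cases [consumes 1, case_names addl addr smultl smultr]:
  assumes "p \<in> tensor_gens V W"
  obtains
    v v' w where "v \<in> carrier V" "v' \<in> carrier V" "w \<in> carrier W"
      "p = Poly_Mapping.single (v \<oplus>\<^bsub>V\<^esub> v', w) 1 - Poly_Mapping.single (v, w) 1 - Poly_Mapping.single (v', w) 1"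
  | v w w' where "v \<in> carrier V" "w \<in> carrier W" "w' \<in> carrier W"
      "p = Poly_Mapping.single (v, w \<oplus>\<^bsub>W\<^esub> w') 1 - Poly_Mapping.single (v, w) 1 - Poly_Mapping.single (v, w') 1"
  | c v w where "v \<in> carrier V" "w \<in> carrier W"
      "p = Poly_Mapping.single (c \<odot>\<^bsub>V\<^esub> v, w) 1 - Poly_Mapping.single (v, w) c"
  | c v w where "v \<in> carrier V" "w \<in> carrier W"
      "p = Poly_Mapping.single (v, c \<odot>\<^bsub>W\<^esub> w) 1 - Poly_Mapping.single (v, w) c"
  using assms unfolding tensor_gens_def by blast

lemma tensor_gensI:
  "v \<in> carrier V \<Longrightarrow> v' \<in> carrier V \<Longrightarrow> w \<in> carrier W \<Longrightarrow>
     Poly_Mapping.single (v \<oplus>\<^bsub>V\<^esub> v', w) 1 - Poly_Mapping.single (v, w) 1 - Poly_Mapping.single (v', w) 1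
       \<in> tensor_gens V W"
  "v \<in> carrier V \<Longrightarrow> w \<in> carrier W \<Longrightarrow> w' \<in> carrier W \<Longrightarrow>
     Poly_Mapping.single (v, w \<oplus>\<^bsub>W\<^esub> w') 1 - Poly_Mapping.single (v, w) 1 - Poly_Mapping.single (v, w') 1
       \<in> tensor_gens V W"
  "v \<in> carrier V \<Longrightarrow> w \<in> carrier W \<Longrightarrow>
     Poly_Mapping.single (c \<odot>\<^bsub>V\<^esub> v, w) 1 - Poly_Mapping.single (v, w) c \<in> tensor_gens V W"
  "v \<in> carrier V \<Longrightarrow> w \<in> carrier W \<Longrightarrow>
     Poly_Mapping.single (v, c \<odot>\<^bsub>W\<^esub> w) 1 - Poly_Mapping.single (v, w) c \<in> tensor_gens V W"
  unfolding tensor_gens_def by blast+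

context
  fixes V :: "('k::field, 'v, 'x) module_scheme" and W :: "('k, 'w, 'y) module_scheme"
  assumes V: "vec_space V" and W: "vec_space W"
begin

private abbreviation (input) "F \<equiv> monoid_algebra (V \<times>\<times> W) :: ('k, 'v \<times> 'w \<Rightarrow>\<^sub>0 'k) module"

lemma tensor_gens_subset: "tensor_gens V W \<subseteq> carrier F"
proof
  fix p assume "p \<in> tensor_gens V W"
  then show "p \<in> carrier F"
    using V W by (cases p rule: tensor_gens_cases) (simp_all add: keys_diffI)
qed

lemma tensor_rels_subspace: "lin_subspace F (tensor_rels V W)"
  unfolding tensor_rels_eq by (rule lin_span_subspace[OF vec_space_monoid_algebra tensor_gens_subset])

lemma vec_space_tensor: "vec_space (tensor V W)"
  unfolding tensor_def by (rule vec_space_quot[OF vec_space_monoid_algebra tensor_rels_subspace])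

lemma lin_tensor_proj: "lin F (tensor V W) (\<lambda>p. tensor_rels V W +>\<^bsub>F\<^esub> p)"
  unfolding tensor_def by (rule lin_quot_proj[OF vec_space_monoid_algebra tensor_rels_subspace])

lemma tensor_proj_gens:
  assumes "p - q \<in> tensor_gens V W" "p \<in> carrier F" "q \<in> carrier F"
  shows "tensor_rels V W +>\<^bsub>F\<^esub> p = tensor_rels V W +>\<^bsub>F\<^esub> q"
proof -
  have "p - q \<in> tensor_rels V W"
    unfolding tensor_rels_eq by (rule subsetD[OF lin_span_superset assms(1)])
  then show ?thesis
    by (subst quot_eq_iff[OF vec_space_monoid_algebra tensor_rels_subspace assms(2,3)])
      (simp add: add_scale_uminus)
qed

lemma pure_tensor_bilin: "bilin V W (tensor V W) (pure_tensor V W)"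
proof (rule bilinI)
  note pd = pure_tensor_def[of V W]
  have sc: "Poly_Mapping.single (v, w) c \<in> carrier F" if "v \<in> carrier V" "w \<in> carrier W" for v w c
    using that by simp
  note add = lin_add[OF lin_tensor_proj sc sc, symmetric] and smult = lin_smult[OF lin_tensor_proj sc, symmetric]
  fix v w assume vw: "v \<in> carrier V" "w \<in> carrier W"
  show "pure_tensor V W v w \<in> carrier (tensor V W)"
    using lin_closed[OF lin_tensor_proj sc[OF vw]] by (simp only: pd)
  show "pure_tensor V W (v \<oplus>\<^bsub>V\<^esub> v') w = pure_tensor V W v w \<oplus>\<^bsub>tensor V W\<^esub> pure_tensor V W v' w"
    if "v' \<in> carrier V" for v'
    unfolding pd add[OF vw that vw(2)]
    using vw that V W tensor_gensI(1)[OF vw(1) that vw(2)]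
    by (intro tensor_proj_gens) (simp_all add: keys_addI diff_diff_eq)
  show "pure_tensor V W (c \<odot>\<^bsub>V\<^esub> v) w = c \<odot>\<^bsub>tensor V W\<^esub> pure_tensor V W v w" for c
    unfolding pd smult[OF vw] using vw V W tensor_gensI(3)[OF vw, of c]
    by (intro tensor_proj_gens) auto
  show "pure_tensor V W v (w \<oplus>\<^bsub>W\<^esub> w') = pure_tensor V W v w \<oplus>\<^bsub>tensor V W\<^esub> pure_tensor V W v w'"
    if "w' \<in> carrier W" for w'
    unfolding pd add[OF vw vw(1) that]
    using vw that V W tensor_gensI(2)[OF vw that]
    by (intro tensor_proj_gens) (simp_all add: keys_addI diff_diff_eq)
  show "pure_tensor V W v (c \<odot>\<^bsub>W\<^esub> w) = c \<odot>\<^bsub>tensor V W\<^esub> pure_tensor V W v w" for c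
    unfolding pd smult[OF vw] using vw V W tensor_gensI(4)[OF vw, of c]
    by (intro tensor_proj_gens) auto
qed

lemma pure_tensor_closed: "v \<in> carrier V \<Longrightarrow> w \<in> carrier W \<Longrightarrow> pure_tensor V W v w \<in> carrier (tensor V W)"
  by (rule bilinD(1)[OF pure_tensor_bilin])

lemma tensor_span:
  "lin_span (tensor V W) {pure_tensor V W v w | v w. v \<in> carrier V \<and> w \<in> carrier W} = carrier (tensor V W)"
proof -
  let ?S = "(\<lambda>x. Poly_Mapping.single x 1) ` carrier (V \<times>\<times> W) :: ('v \<times> 'w \<Rightarrow>\<^sub>0 'k) set"
  let ?p = "\<lambda>p. tensor_rels V W +>\<^bsub>F\<^esub> p"
  have S: "?S \<subseteq> carrier F"
    by auto
  have "carrier (tensor V W) = ?p ` carrier F"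
    unfolding tensor_def by (rule quot_carrier[OF vec_space_monoid_algebra tensor_rels_subspace])
  also have "\<dots> = ?p ` lin_span F ?S"
    by (simp only: monoid_algebra_span)
  also have "\<dots> = lin_span (tensor V W) (?p ` ?S)"
    by (rule lin_span_image[OF vec_space_monoid_algebra vec_space_tensor lin_tensor_proj S])
  also have "?p ` ?S = {pure_tensor V W v w | v w. v \<in> carrier V \<and> w \<in> carrier W}"
    by (auto simp: pure_tensor_def image_iff)
  finally show ?thesis ..
qed

lemma pure_tensors_subset:
  "{pure_tensor V W v w | v w. v \<in> carrier V \<and> w \<in> carrier W} \<subseteq> carrier (tensor V W)"
  using pure_tensor_closed by auto

lemma tensor_ext:
  assumes "vec_space U" "lin (tensor V W) U f" "lin (tensor V W) U g"
    and "\<And>v w. v \<in> carrier V \<Longrightarrow> w \<in> carrier W \<Longrightarrow> f (pure_tensor V W v w) = g (pure_tensor V W v w)"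
    and "x \<in> carrier (tensor V W)"
  shows "f x = g x"
  by (rule lin_ext[OF vec_space_tensor assms(1-3) pure_tensors_subset tensor_span _ assms(5)]) (use assms(4) in auto)

lemma tensor_lift:
  assumes U: "vec_space U" and f: "bilin V W U f"
  shows "\<exists>h\<in>lin_maps (tensor V W) U. \<forall>v\<in>carrier V. \<forall>w\<in>carrier W. h (pure_tensor V W v w) = f v w"
proof -
  let ?l = "free_lift U (\<lambda>(v, w). f v w)"
  note b = bilinD[OF f]
  have l: "lin F U ?l"
    using b(1) by (intro lin_free_lift[OF U]) auto
  have s: "?l (Poly_Mapping.single (v, w) c) = c \<odot>\<^bsub>U\<^esub> f v w" if "v \<in> carrier V" "w \<in> carrier W" for v w c
    using b(1)[OF that] by (simp add: free_lift_single[OF U])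
  have d: "?l (p - q) = ?l p \<oplus>\<^bsub>U\<^esub> (- 1) \<odot>\<^bsub>U\<^esub> ?l q"
    if "Poly_Mapping.keys p \<subseteq> carrier (V \<times>\<times> W)" "Poly_Mapping.keys q \<subseteq> carrier (V \<times>\<times> W)" for p q
    by (rule lin_monoid_algebra_diff[OF l U that])
  have "?l p = \<zero>\<^bsub>U\<^esub>" if "p \<in> tensor_gens V W" for p
    using that
  proof (cases p rule: tensor_gens_cases)
    case (addl v v' w)
    then show ?thesis
      using V W U b by (simp add: d s keys_diffI vs_smult_add vs_add_assoc vs_add_left_comm vs_add_neg1)
  next
    case (addr v w w')
    then show ?thesis
      using V W U b by (simp add: d s keys_diffI vs_smult_add vs_add_assoc vs_add_left_comm vs_add_neg1)
  next
    case (smultl c v w)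
    then show ?thesis
      using V W U b vs_add_smult[OF U b(1), of v w c "- c"] by (simp add: d s)
  next
    case (smultr c v w)
    then show ?thesis
      using V W U b vs_add_smult[OF U b(1), of v w c "- c"] by (simp add: d s)
  qed
  then have "tensor_rels V W \<subseteq> {p \<in> carrier F. ?l p \<in> {\<zero>\<^bsub>U\<^esub>}}"
    unfolding tensor_rels_eq using tensor_gens_subset U
    by (intro lin_span_least lin_subspace_vimage[OF vec_space_monoid_algebra U l] lin_subspaceI[OF U]) auto
  then have "\<And>p. p \<in> tensor_rels V W \<Longrightarrow> ?l p = \<zero>\<^bsub>U\<^esub>"
    by auto
  from quot_lift[OF vec_space_monoid_algebra tensor_rels_subspace U l this]
  obtain h where h: "h \<in> lin_maps (tensor V W) U" "\<And>p. p \<in> carrier F \<Longrightarrow> h (tensor_rels V W +>\<^bsub>F\<^esub> p) = ?l p"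
    unfolding tensor_def by blast
  have "h (pure_tensor V W v w) = f v w" if "v \<in> carrier V" "w \<in> carrier W" for v w
    using that h(2)[of "Poly_Mapping.single (v, w) 1"] s[OF that, of 1] b(1)[OF that] U
    by (simp add: pure_tensor_def)
  then show ?thesis
    using h(1) by blast
qed

end

lemma fin_dim_tensor:
  assumes V: "vec_space V" "fin_dim V" and W: "vec_space W" "fin_dim W"
  shows "fin_dim (tensor V W)"
proof -
  obtain B where B: "finite B" "B \<subseteq> carrier V" "lin_span V B = carrier V"
    using V(2) by (auto simp: fin_dim_def)
  obtain C where C: "finite C" "C \<subseteq> carrier W" "lin_span W C = carrier W"
    using W(2) by (auto simp: fin_dim_def)
  let ?S = "{pure_tensor V W v w | v w. v \<in> B \<and> w \<in> C}"
  have "lin_span (tensor V W) ?S = carrier (tensor V W)"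
    by (rule bilin_span[OF V(1) W(1) vec_space_tensor[OF V(1) W(1)] pure_tensor_bilin[OF V(1) W(1)] B(2,3) C(2,3)
          tensor_span[OF V(1) W(1)]])
  moreover have "finite ?S"
    by (rule finite_image_set2) (simp_all add: B C)
  moreover have "?S \<subseteq> carrier (tensor V W)"
    using B C pure_tensor_closed[OF V(1) W(1)] by blast
  ultimately show ?thesis
    unfolding fin_dim_def by blast
qed

lemma tensor_map_spec:
  assumes V: "vec_space V" and W: "vec_space W" and V': "vec_space V'" and W': "vec_space W'"
    and f: "lin V V' f" and g: "lin W W' g"
  shows tensor_map_lin_maps: "tensor_map V W V' W' f g \<in> lin_maps (tensor V W) (tensor V' W')"
    and tensor_map_pure: "\<And>v w. v \<in> carrier V \<Longrightarrow> w \<in> carrier W \<Longrightarrow>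
      tensor_map V W V' W' f g (pure_tensor V W v w) = pure_tensor V' W' (f v) (g w)"
proof -
  let ?P = "\<lambda>h. h \<in> lin_maps (tensor V W) (tensor V' W') \<and>
     (\<forall>v\<in>carrier V. \<forall>w\<in>carrier W. h (pure_tensor V W v w) = pure_tensor V' W' (f v) (g w))"
  have "bilin V W (tensor V' W') (\<lambda>v w. pure_tensor V' W' (f v) (g w))"
    by (rule bilin_comp[OF pure_tensor_bilin[OF V' W'] f g lin_ident])
  then obtain h where h: "?P h"
    using tensor_lift[OF V W vec_space_tensor[OF V' W']] by blast
  have "?P (tensor_map V W V' W' f g)"
    unfolding tensor_map_def
  proof (rule theI[where P = ?P, OF h])
    fix h' assume h': "?P h'"
    show "h' = h"
    proof (rule lin_maps_eqI)
      show "h' x = h x" if "x \<in> carrier (tensor V W)" for x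
        by (rule tensor_ext[OF V W vec_space_tensor[OF V' W'] _ _ _ that]) (use h h' in \<open>auto simp: lin_maps_lin\<close>)
    qed (use h h' in auto)
  qed
  then show "tensor_map V W V' W' f g \<in> lin_maps (tensor V W) (tensor V' W')"
    "\<And>v w. v \<in> carrier V \<Longrightarrow> w \<in> carrier W \<Longrightarrow>
      tensor_map V W V' W' f g (pure_tensor V W v w) = pure_tensor V' W' (f v) (g w)"
    by auto
qed

subsection \<open>Tensor products of algebras\<close>

context
  fixes A :: "('k::field, 'a, 'x) module_scheme" and B :: "('k, 'b, 'y) module_scheme"
  assumes A: "assoc_algebra A" and B: "assoc_algebra B"
begin

private abbreviation (input) "FP \<equiv> monoid_algebra (A \<times>\<times> B) :: ('k, 'a \<times> 'b \<Rightarrow>\<^sub>0 'k) module"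

lemma assoc_algebra_pairs: "assoc_algebra FP"
proof (rule assoc_algebra_monoid_algebra)
  show "Group.monoid (A \<times>\<times> B)"
    using alg_ring[OF A] alg_ring[OF B] by (intro DirProd_monoid) (auto simp: ring_def)
qed

text \<open>
  Multiplication by a basis element maps each bilinearity relation to a relation of the same form,
  so the relations span an ideal.
\<close>

lemma tensor_rels_ideal: "ideal (tensor_rels A B) FP"
proof (rule subspace_idealI[OF assoc_algebra_pairs])
  have VA: "vec_space A" and VB: "vec_space B"
    using A B by simp_all
  note VF = vec_space_monoid_algebra[of "A \<times>\<times> B", where 'k = 'k]
  note T = tensor_rels_subspace[OF VA VB]
  note bil = alg_mult_bilin[OF assoc_algebra_pairs]
  note bA = bilinD[OF alg_mult_bilin[OF A]] and bB = bilinD[OF alg_mult_bilin[OF B]]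
  show "lin_subspace FP (tensor_rels A B)"
    by (rule T)
  have dl: "r \<otimes>\<^bsub>FP\<^esub> (p - q) = r \<otimes>\<^bsub>FP\<^esub> p - r \<otimes>\<^bsub>FP\<^esub> q" and dr: "(p - q) \<otimes>\<^bsub>FP\<^esub> r = p \<otimes>\<^bsub>FP\<^esub> r - q \<otimes>\<^bsub>FP\<^esub> r"
    if "Poly_Mapping.keys r \<subseteq> carrier (A \<times>\<times> B)" "Poly_Mapping.keys p \<subseteq> carrier (A \<times>\<times> B)" "Poly_Mapping.keys q \<subseteq> carrier (A \<times>\<times> B)" for p q r
    using lin_monoid_algebra_diff[OF bilin_lin_right[OF bil, of r] VF that(2,3)]
      lin_monoid_algebra_diff[OF bilin_lin_left[OF bil, of r] VF that(2,3)] that(1)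
    by (simp_all add: add_scale_uminus)
  have "Poly_Mapping.single (a, b) 1 \<otimes>\<^bsub>FP\<^esub> p \<in> tensor_gens A B
    \<and> p \<otimes>\<^bsub>FP\<^esub> Poly_Mapping.single (a, b) 1 \<in> tensor_gens A B"
    if ab: "a \<in> carrier A" "b \<in> carrier B" and p: "p \<in> tensor_gens A B" for a b p
    using p
  proof (cases p rule: tensor_gens_cases)
    case (addl v v' w)
    then show ?thesis
      using A B VA VB ab 
      by (simp add: dl dr keys_diffI bA bB tensor_gensI)
  next
    case (addr v w w')
    then show ?thesis
      using A B VA VB ab 
      by (simp add: dl dr keys_diffI bA bB tensor_gensI)
  next
    case (smultl c v w)
    then show ?thesis
      using A B VA VB ab 
      by (simp add: dl dr keys_diffI bA bB tensor_gensI)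
  next
    case (smultr c v w)
    then show ?thesis
      using A B VA VB ab 
      by (simp add: dl dr keys_diffI bA bB tensor_gensI)
  qed
  then have gl: "Poly_Mapping.single (a, b) 1 \<otimes>\<^bsub>FP\<^esub> p \<in> tensor_gens A B"
    and gr: "p \<otimes>\<^bsub>FP\<^esub> Poly_Mapping.single (a, b) 1 \<in> tensor_gens A B"
    if "a \<in> carrier A" "b \<in> carrier B" "p \<in> tensor_gens A B" for a b p
    using that by blast+
  have rel: "tensor_gens A B \<subseteq> tensor_rels A B"
    unfolding tensor_rels_eq by (rule lin_span_superset)
  have le: "tensor_rels A B \<subseteq> N" if "lin_subspace FP N" "tensor_gens A B \<subseteq> N" for N
    unfolding tensor_rels_eq using that by (rule lin_span_least)
  have le': "carrier FP \<subseteq> N" if "lin_subspace FP N" "\<And>a b. a \<in> carrier A \<Longrightarrow> b \<in> carrier B \<Longrightarrow> Poly_Mapping.single (a, b) 1 \<in> N" for N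
    using lin_span_least[OF that(1), of "(\<lambda>x. Poly_Mapping.single x 1) ` carrier (A \<times>\<times> B)"] that(2)
    unfolding monoid_algebra_span by auto
  have sc: "Poly_Mapping.single (a, b) 1 \<in> carrier FP" if "a \<in> carrier A" "b \<in> carrier B" for a b
    using that by simp
  have sl: "Poly_Mapping.single (a, b) 1 \<otimes>\<^bsub>FP\<^esub> x \<in> tensor_rels A B"
    and sr: "x \<otimes>\<^bsub>FP\<^esub> Poly_Mapping.single (a, b) 1 \<in> tensor_rels A B"
    if ab: "a \<in> carrier A" "b \<in> carrier B" and x: "x \<in> tensor_rels A B" for a b x
  proof -
    show "Poly_Mapping.single (a, b) 1 \<otimes>\<^bsub>FP\<^esub> x \<in> tensor_rels A B"
      using le[OF lin_subspace_vimage[OF VF VF bilin_lin_right[OF bil sc[OF ab]] T]] gl[OF ab] rel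
        tensor_gens_subset[OF VA VB] x by blast
    show "x \<otimes>\<^bsub>FP\<^esub> Poly_Mapping.single (a, b) 1 \<in> tensor_rels A B"
      using le[OF lin_subspace_vimage[OF VF VF bilin_lin_left[OF bil sc[OF ab]] T]] gr[OF ab] rel
        tensor_gens_subset[OF VA VB] x by blast
  qed
  fix x p assume x: "x \<in> tensor_rels A B" and p: "p \<in> carrier FP"
  have xF: "x \<in> carrier FP"
    using x lin_subspace_subset[OF VF T] by blast
  show "p \<otimes>\<^bsub>FP\<^esub> x \<in> tensor_rels A B"
    using le'[OF lin_subspace_vimage[OF VF VF bilin_lin_left[OF bil xF] T]] sl[OF _ _ x] sc p by blast
  show "x \<otimes>\<^bsub>FP\<^esub> p \<in> tensor_rels A B"
    using le'[OF lin_subspace_vimage[OF VF VF bilin_lin_right[OF bil xF] T]] sr[OF _ _ x] sc p by blast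
qed

lemma assoc_algebra_tensor: "assoc_algebra (tensor A B)"
  unfolding tensor_def by (rule assoc_algebra_quot[OF assoc_algebra_pairs tensor_rels_ideal])

lemma pure_tensor_mult:
  assumes "a \<in> carrier A" "a' \<in> carrier A" "b \<in> carrier B" "b' \<in> carrier B"
  shows "pure_tensor A B a b \<otimes>\<^bsub>tensor A B\<^esub> pure_tensor A B a' b'
    = pure_tensor A B (a \<otimes>\<^bsub>A\<^esub> a') (b \<otimes>\<^bsub>B\<^esub> b')"
  using assms quot_mult[OF assoc_algebra_pairs tensor_rels_ideal,
      of "Poly_Mapping.single (a, b) 1" "Poly_Mapping.single (a', b') 1"]
  by (simp add: tensor_def pure_tensor_def)

end

section \<open>Tensor algebras\<close>

lemma words_simps [simp]:
  "carrier (words V) = lists (carrier V)" "\<one>\<^bsub>words V\<^esub> = []" "x \<otimes>\<^bsub>words V\<^esub> y = x @ y"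
  by (simp_all add: words_def)

lemma monoid_words: "Group.monoid (words V)"
  by (rule monoidI) auto

text \<open>
  The linearity relations on words of length one, separated from the ideal that they generate.
\<close>

definition tensor_algebra_gens :: "('k::field, 'v, 'x) module_scheme \<Rightarrow> ('v list \<Rightarrow>\<^sub>0 'k) set" where
  "tensor_algebra_gens V =
     ({Poly_Mapping.single [v \<oplus>\<^bsub>V\<^esub> v'] 1 - Poly_Mapping.single [v] 1 - Poly_Mapping.single [v'] 1
         | v v'. v \<in> carrier V \<and> v' \<in> carrier V} \<union>
      {Poly_Mapping.single [c \<odot>\<^bsub>V\<^esub> v] 1 - Poly_Mapping.single [v] c
         | c v. v \<in> carrier V})"

lemma tensor_algebra_rels_eq:
  "tensor_algebra_rels V = Idl\<^bsub>(monoid_algebra (words V) :: ('k::field, 'v list \<Rightarrow>\<^sub>0 'k) module)\<^esub> (tensor_algebra_gens V)"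
  by (simp only: tensor_algebra_rels_def tensor_algebra_gens_def)

lemma assoc_algebra_words: "assoc_algebra (monoid_algebra (words V))"
  by (rule assoc_algebra_monoid_algebra[OF monoid_words])

context
  fixes V :: "('k::field, 'v, 'x) module_scheme"
  assumes V: "vec_space V"
begin

private abbreviation (input) "FW \<equiv> monoid_algebra (words V) :: ('k, 'v list \<Rightarrow>\<^sub>0 'k) module"

lemma tensor_algebra_gens_subset: "tensor_algebra_gens V \<subseteq> carrier FW"
  using V by (auto simp only: tensor_algebra_gens_def) (simp_all add: keys_diffI)

lemma tensor_algebra_rels_ideal: "ideal (tensor_algebra_rels V) FW"
  unfolding tensor_algebra_rels_eq by (rule Idl_ideal[OF assoc_algebra_words tensor_algebra_gens_subset])

lemma assoc_algebra_tensor_algebra: "assoc_algebra (tensor_algebra V)"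
  unfolding tensor_algebra_def by (rule assoc_algebra_quot[OF assoc_algebra_words tensor_algebra_rels_ideal])

lemma vec_space_tensor_algebra: "vec_space (tensor_algebra V)"
  by (rule alg_vec_space[OF assoc_algebra_tensor_algebra])

lemma alg_hom_words_proj: "alg_hom FW (tensor_algebra V) (\<lambda>p. tensor_algebra_rels V +>\<^bsub>FW\<^esub> p)"
  unfolding tensor_algebra_def by (rule alg_hom_quot_proj[OF assoc_algebra_words tensor_algebra_rels_ideal])

lemma words_proj_gens:
  assumes "p - q \<in> tensor_algebra_gens V" "p \<in> carrier FW" "q \<in> carrier FW"
  shows "tensor_algebra_rels V +>\<^bsub>FW\<^esub> p = tensor_algebra_rels V +>\<^bsub>FW\<^esub> q"
proof -
  have "p - q \<in> tensor_algebra_rels V"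
    unfolding tensor_algebra_rels_eq by (rule subsetD[OF Idl_superset[OF assoc_algebra_words] assms(1)])
  then show ?thesis
    by (subst quot_eq_iff[OF vec_space_monoid_algebra
          ideal_subspace[OF assoc_algebra_words tensor_algebra_rels_ideal] assms(2,3)])
      (simp add: add_scale_uminus)
qed

lemma lin_tensor_incl: "lin V (tensor_algebra V) (tensor_incl V)"
proof (rule linI)
  note pd = tensor_incl_def[of V] and l = alg_hom_lin[OF alg_hom_words_proj]
  have sc: "Poly_Mapping.single [v] c \<in> carrier FW" if "v \<in> carrier V" for v c
    using that by simp
  note add = lin_add[OF l sc sc, symmetric] and smult = lin_smult[OF l sc, symmetric]
  fix v assume v: "v \<in> carrier V"
  show "tensor_incl V v \<in> carrier (tensor_algebra V)"
    using lin_closed[OF l sc[OF v]] by (simp only: pd)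
  show "tensor_incl V (v \<oplus>\<^bsub>V\<^esub> v') = tensor_incl V v \<oplus>\<^bsub>tensor_algebra V\<^esub> tensor_incl V v'"
    if v': "v' \<in> carrier V" for v'
    unfolding pd add[OF v v']
  proof (rule words_proj_gens)
    show "Poly_Mapping.single [v \<oplus>\<^bsub>V\<^esub> v'] 1 - (Poly_Mapping.single [v] 1 \<oplus>\<^bsub>FW\<^esub> Poly_Mapping.single [v'] 1)
      \<in> tensor_algebra_gens V"
      using v v' unfolding tensor_algebra_gens_def monoid_algebra_simps diff_diff_eq[symmetric] by blast
  qed (use v v' V in \<open>simp_all add: keys_addI\<close>)
  show "tensor_incl V (c \<odot>\<^bsub>V\<^esub> v) = c \<odot>\<^bsub>tensor_algebra V\<^esub> tensor_incl V v" for c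
    unfolding pd smult[OF v]
  proof (rule words_proj_gens)
    have "Poly_Mapping.single [c \<odot>\<^bsub>V\<^esub> v] 1 - Poly_Mapping.single [v] c \<in> tensor_algebra_gens V"
      using v unfolding tensor_algebra_gens_def by blast
    then show "Poly_Mapping.single [c \<odot>\<^bsub>V\<^esub> v] 1 - c \<odot>\<^bsub>FW\<^esub> Poly_Mapping.single [v] 1 \<in> tensor_algebra_gens V"
      by simp
  qed (use v V in simp_all)
qed

lemma tensor_incl_closed: "v \<in> carrier V \<Longrightarrow> tensor_incl V v \<in> carrier (tensor_algebra V)"
  by (rule lin_closed[OF lin_tensor_incl])

lemma tensor_algebra_induct [consumes 1, case_names one incl add smult mult]:
  assumes x: "x \<in> carrier (tensor_algebra V)"
    and one: "P \<one>\<^bsub>tensor_algebra V\<^esub>"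
    and incl: "\<And>v. v \<in> carrier V \<Longrightarrow> P (tensor_incl V v)"
    and add: "\<And>x y. x \<in> carrier (tensor_algebra V) \<Longrightarrow> y \<in> carrier (tensor_algebra V) \<Longrightarrow> P x \<Longrightarrow> P y \<Longrightarrow>
      P (x \<oplus>\<^bsub>tensor_algebra V\<^esub> y)"
    and smult: "\<And>c x. x \<in> carrier (tensor_algebra V) \<Longrightarrow> P x \<Longrightarrow> P (c \<odot>\<^bsub>tensor_algebra V\<^esub> x)"
    and mult: "\<And>x y. x \<in> carrier (tensor_algebra V) \<Longrightarrow> y \<in> carrier (tensor_algebra V) \<Longrightarrow> P x \<Longrightarrow> P y \<Longrightarrow>
      P (x \<otimes>\<^bsub>tensor_algebra V\<^esub> y)"
  shows "P x"
proof -
  let ?T = "tensor_algebra V" and ?p = "\<lambda>p. tensor_algebra_rels V +>\<^bsub>FW\<^esub> p"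
  let ?S = "(\<lambda>w. Poly_Mapping.single w 1) ` carrier (words V) :: ('v list \<Rightarrow>\<^sub>0 'k) set"
  note VT = vec_space_tensor_algebra and h = alg_homD[OF alg_hom_words_proj]
  have word: "P (?p (Poly_Mapping.single w 1))" if "w \<in> lists (carrier V)" for w
    using that
  proof (induction w)
    case Nil
    then show ?case
      using one h(2) by simp
  next
    case (Cons v w)
    have "?p (Poly_Mapping.single (v # w) 1) = ?p (Poly_Mapping.single [v] 1 \<otimes>\<^bsub>FW\<^esub> Poly_Mapping.single w 1)"
      by simp
    also have "\<dots> = tensor_incl V v \<otimes>\<^bsub>?T\<^esub> ?p (Poly_Mapping.single w 1)"
      using Cons unfolding tensor_incl_def by (intro h(3)) auto
    finally show ?case
      using Cons incl h(4)[of "Poly_Mapping.single w 1"]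
      by (auto intro!: mult tensor_incl_closed)
  qed
  have wc: "?p (Poly_Mapping.single w 1) \<in> carrier ?T" if "w \<in> lists (carrier V)" for w
    using h(4)[of "Poly_Mapping.single w 1"] that by simp
  have "\<zero>\<^bsub>?T\<^esub> = 0 \<odot>\<^bsub>?T\<^esub> \<one>\<^bsub>?T\<^esub>"
    using assoc_algebra_tensor_algebra by simp
  then have zero: "P \<zero>\<^bsub>?T\<^esub>"
    using smult[OF alg_one_closed[OF assoc_algebra_tensor_algebra] one] by metis
  have sub: "lin_subspace ?T {x \<in> carrier ?T. P x}"
    by (rule lin_subspaceI[OF VT]) (use VT zero add smult in auto)
  have S: "?S \<subseteq> carrier FW"
    by auto
  have "carrier ?T = ?p ` carrier FW"
    unfolding tensor_algebra_def
    by (rule quot_carrier[OF vec_space_monoid_algebra ideal_subspace[OF assoc_algebra_words tensor_algebra_rels_ideal]])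
  also have "\<dots> = ?p ` lin_span FW ?S"
    by (simp only: monoid_algebra_span)
  also have "\<dots> = lin_span ?T (?p ` ?S)"
    by (rule lin_span_image[OF vec_space_monoid_algebra VT h(1) S])
  also have "\<dots> \<subseteq> {x \<in> carrier ?T. P x}"
    using word wc by (intro lin_span_least[OF sub]) auto
  finally show ?thesis
    using x by auto
qed

lemma tensor_algebra_ext:
  assumes "alg_hom (tensor_algebra V) B f" "alg_hom (tensor_algebra V) B g"
    and "\<And>v. v \<in> carrier V \<Longrightarrow> f (tensor_incl V v) = g (tensor_incl V v)"
    and "x \<in> carrier (tensor_algebra V)"
  shows "f x = g x"
  using assms(4)
  by (induction rule: tensor_algebra_induct)
    (use assms(3) alg_homD[OF assms(1)] alg_homD[OF assms(2)] linD[OF alg_hom_lin[OF assms(1)]]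
      linD[OF alg_hom_lin[OF assms(2)]] in simp_all)

lemma tensor_algebra_lift:
  assumes B: "assoc_algebra B" and f: "lin V B f"
  shows "\<exists>g\<in>extensional (carrier (tensor_algebra V)). alg_hom (tensor_algebra V) B g \<and>
    (\<forall>v\<in>carrier V. g (tensor_incl V v) = f v)"
proof -
  let ?w = "foldr (\<lambda>v b. f v \<otimes>\<^bsub>B\<^esub> b)"
  let ?l = "free_lift B (\<lambda>w. ?w w \<one>\<^bsub>B\<^esub>)"
  note VB = alg_vec_space[OF B]
  have cl: "?w x \<one>\<^bsub>B\<^esub> \<in> carrier B" if "x \<in> lists (carrier V)" for x
    using that by (induction x) (use B f in \<open>simp_all add: linD\<close>)
  have ap: "?w (x @ y) \<one>\<^bsub>B\<^esub> = ?w x \<one>\<^bsub>B\<^esub> \<otimes>\<^bsub>B\<^esub> ?w y \<one>\<^bsub>B\<^esub>"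
    if "x \<in> lists (carrier V)" "y \<in> lists (carrier V)" for x y
    using that(1)
  proof (induction x)
    case Nil
    then show ?case using B cl[OF that(2)] by simp
  next
    case (Cons v x)
    then show ?case
      using B f cl[OF that(2)] cl[of x] by (simp add: linD alg_mult_assoc)
  qed
  have h: "alg_hom FW B ?l"
    by (rule alg_hom_free_lift[OF monoid_words B]) (simp_all add: cl ap del: foldr_append)
  note l = alg_hom_lin[OF h]
  have s: "?l (Poly_Mapping.single [v] c) = c \<odot>\<^bsub>B\<^esub> f v" if "v \<in> carrier V" for v c
    using that cl[of "[v]"] B f by (subst free_lift_single[OF VB]) (simp_all add: linD)
  have d: "?l (p - q) = ?l p \<oplus>\<^bsub>B\<^esub> (- 1) \<odot>\<^bsub>B\<^esub> ?l q"
    if "Poly_Mapping.keys p \<subseteq> carrier (words V)" "Poly_Mapping.keys q \<subseteq> carrier (words V)" for p q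
    by (rule lin_monoid_algebra_diff[OF l VB that])
  have "?l p = \<zero>\<^bsub>B\<^esub>" if p: "p \<in> tensor_algebra_gens V" for p
  proof -
    consider v v' where "v \<in> carrier V" "v' \<in> carrier V"
        "p = Poly_Mapping.single [v \<oplus>\<^bsub>V\<^esub> v'] 1 - Poly_Mapping.single [v] 1 - Poly_Mapping.single [v'] 1"
      | c v where "v \<in> carrier V" "p = Poly_Mapping.single [c \<odot>\<^bsub>V\<^esub> v] 1 - Poly_Mapping.single [v] c"
      using p unfolding tensor_algebra_gens_def by blast
    then show ?thesis
    proof cases
      case (1 v v')
      then show ?thesis
        using V VB f by (simp add: d s keys_diffI linD vs_smult_add vs_add_assoc vs_add_left_comm vs_add_neg1)
    next
      case (2 c v)
      then show ?thesis
        using V VB f vs_add_smult[OF VB lin_closed[OF f], of v c "- c"] by (simp add: d s linD)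
    qed
  qed
  then have "\<And>p. p \<in> tensor_algebra_rels V \<Longrightarrow> ?l p = \<zero>\<^bsub>B\<^esub>"
    unfolding tensor_algebra_rels_eq
    by (rule alg_hom_zero_on_Idl[OF assoc_algebra_words B h tensor_algebra_gens_subset])
  from quot_lift_alg_hom[OF assoc_algebra_words tensor_algebra_rels_ideal B h this]
  obtain g where g: "g \<in> extensional (carrier (tensor_algebra V))" "alg_hom (tensor_algebra V) B g"
    "\<And>p. p \<in> carrier FW \<Longrightarrow> g (tensor_algebra_rels V +>\<^bsub>FW\<^esub> p) = ?l p"
    unfolding tensor_algebra_def by blast
  have "g (tensor_incl V v) = f v" if "v \<in> carrier V" for v
    using that g(3)[of "Poly_Mapping.single [v] 1"] s[OF that, of 1] VB lin_closed[OF f that]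
    by (simp add: tensor_incl_def)
  then show ?thesis
    using g by blast
qed

lemma tensor_algebra_generated:
  assumes B: "assoc_algebra B" and f: "alg_hom (tensor_algebra V) B f"
    and S: "\<And>v. v \<in> carrier V \<Longrightarrow> f (tensor_incl V v) \<in> S" "S \<subseteq> carrier B"
    and x: "x \<in> carrier (tensor_algebra V)"
  shows "f x \<in> subalgebra_gen B S"
proof -
  note C = lin_subspaceD[OF alg_vec_space[OF B] subalgebra_gen_subalgebra(1)[OF B S(2)]]
    subringD[OF subalgebra_gen_subalgebra(2)[OF B S(2)]]
  show ?thesis
    using x
    by (induction rule: tensor_algebra_induct)
      (use S(1) subalgebra_gen_superset[of S B] C alg_homD[OF f] linD[OF alg_hom_lin[OF f]] in auto)
qed

subsection \<open>The degree two component\<close>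

lemma sq_tensor_bilin_algebra: "bilin V V (tensor_algebra V) (sq_tensor V)"
  unfolding sq_tensor_def
  by (rule bilin_comp[OF alg_mult_bilin[OF assoc_algebra_tensor_algebra] lin_tensor_incl lin_tensor_incl lin_ident])

lemma sq_tensors_subset:
  "{sq_tensor V v v' | v v'. v \<in> carrier V \<and> v' \<in> carrier V} \<subseteq> carrier (tensor_algebra V)"
  using bilinD(1)[OF sq_tensor_bilin_algebra] by auto

lemma tensor_square_subspace: "lin_subspace (tensor_algebra V) (carrier (tensor_square V))"
  using lin_span_subspace[OF vec_space_tensor_algebra sq_tensors_subset] by (simp add: tensor_square_def)

lemma vec_space_tensor_square: "vec_space (tensor_square V)"
  using vec_space_subspace[OF vec_space_tensor_algebra tensor_square_subspace] by (simp add: tensor_square_def)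

lemma tensor_square_subset: "carrier (tensor_square V) \<subseteq> carrier (tensor_algebra V)"
  by (rule lin_subspace_subset[OF vec_space_tensor_algebra tensor_square_subspace])

lemma tensor_square_simps:
  "x \<oplus>\<^bsub>tensor_square V\<^esub> y = x \<oplus>\<^bsub>tensor_algebra V\<^esub> y" "c \<odot>\<^bsub>tensor_square V\<^esub> x = c \<odot>\<^bsub>tensor_algebra V\<^esub> x"
  "\<zero>\<^bsub>tensor_square V\<^esub> = \<zero>\<^bsub>tensor_algebra V\<^esub>"
  by (simp_all add: tensor_square_def)

lemma lin_tensor_square: "lin (tensor_algebra V) U f \<Longrightarrow> lin (tensor_square V) U f"
  using tensor_square_subset by (simp add: lin_def tensor_square_simps subset_iff)

lemma sq_tensor_closed: "v \<in> carrier V \<Longrightarrow> v' \<in> carrier V \<Longrightarrow> sq_tensor V v v' \<in> carrier (tensor_square V)"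
  using lin_span_superset[of _ "tensor_algebra V"] by (fastforce simp: tensor_square_def)

lemma sq_tensor_bilin: "bilin V V (tensor_square V) (sq_tensor V)"
  using bilinD[OF sq_tensor_bilin_algebra] by (intro bilinI) (simp_all add: tensor_square_simps sq_tensor_closed)

lemma tensor_square_span:
  "lin_span (tensor_square V) {sq_tensor V v v' | v v'. v \<in> carrier V \<and> v' \<in> carrier V} = carrier (tensor_square V)"
  (is "lin_span ?Q ?S = _")
proof
  have S: "?S \<subseteq> carrier ?Q"
    using sq_tensor_closed by auto
  note N = lin_subspaceD[OF vec_space_tensor_square lin_span_subspace[OF vec_space_tensor_square S]]
  show "lin_span ?Q ?S \<subseteq> carrier ?Q"
    by (rule N)
  have "lin_subspace (tensor_algebra V) (lin_span ?Q ?S)"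
    using N tensor_square_subset
    by (intro lin_subspaceI[OF vec_space_tensor_algebra]) (auto simp: tensor_square_simps)
  then have "lin_span (tensor_algebra V) ?S \<subseteq> lin_span ?Q ?S"
    by (rule lin_span_least[OF _ lin_span_superset])
  then show "carrier ?Q \<subseteq> lin_span ?Q ?S"
    by (simp add: tensor_square_def)
qed

lemma tensor_square_ext:
  assumes "vec_space U" "lin (tensor_square V) U f" "lin (tensor_square V) U g"
    and "\<And>v v'. v \<in> carrier V \<Longrightarrow> v' \<in> carrier V \<Longrightarrow> f (sq_tensor V v v') = g (sq_tensor V v v')"
    and "x \<in> carrier (tensor_square V)"
  shows "f x = g x"
  by (rule lin_ext[OF vec_space_tensor_square assms(1-3) _ tensor_square_span _ assms(5)])
    (use assms(4) sq_tensor_closed in auto)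

end

text \<open>
  The algebra \<open>\<bbbk> \<oplus> V \<oplus> U\<close>, graded in degrees 0, 1 and 2, in which two elements of degree one are
  multiplied by the bilinear map \<open>f\<close>.  It is associative because all products of three elements of
  positive degree vanish.  Homomorphisms into it isolate the components of degree one and two of
  the tensor algebra.
\<close>

definition truncated_algebra ::
  "('k::field, 'v, 'x) module_scheme \<Rightarrow> ('k, 'u, 'y) module_scheme \<Rightarrow> ('v \<Rightarrow> 'v \<Rightarrow> 'u)
    \<Rightarrow> ('k, 'k \<times> 'v \<times> 'u) module" where
  "truncated_algebra V U f = \<lparr>carrier = UNIV \<times> carrier V \<times> carrier U,
     monoid.mult = (\<lambda>(a, v, u) (a', v', u'). (a * a', a \<odot>\<^bsub>V\<^esub> v' \<oplus>\<^bsub>V\<^esub> a' \<odot>\<^bsub>V\<^esub> v,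
        a \<odot>\<^bsub>U\<^esub> u' \<oplus>\<^bsub>U\<^esub> (a' \<odot>\<^bsub>U\<^esub> u \<oplus>\<^bsub>U\<^esub> f v v'))),
     one = (1, \<zero>\<^bsub>V\<^esub>, \<zero>\<^bsub>U\<^esub>), ring.zero = (0, \<zero>\<^bsub>V\<^esub>, \<zero>\<^bsub>U\<^esub>),
     add = (\<lambda>(a, v, u) (a', v', u'). (a + a', v \<oplus>\<^bsub>V\<^esub> v', u \<oplus>\<^bsub>U\<^esub> u')),
     smult = (\<lambda>c (a, v, u). (c * a, c \<odot>\<^bsub>V\<^esub> v, c \<odot>\<^bsub>U\<^esub> u))\<rparr>"

lemma truncated_algebra_simps:
  "carrier (truncated_algebra V U f) = UNIV \<times> carrier V \<times> carrier U"
  "(a, v, u) \<otimes>\<^bsub>truncated_algebra V U f\<^esub> (a', v', u') = (a * a', a \<odot>\<^bsub>V\<^esub> v' \<oplus>\<^bsub>V\<^esub> a' \<odot>\<^bsub>V\<^esub> v,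
     a \<odot>\<^bsub>U\<^esub> u' \<oplus>\<^bsub>U\<^esub> (a' \<odot>\<^bsub>U\<^esub> u \<oplus>\<^bsub>U\<^esub> f v v'))"
  "\<one>\<^bsub>truncated_algebra V U f\<^esub> = (1, \<zero>\<^bsub>V\<^esub>, \<zero>\<^bsub>U\<^esub>)"
  "\<zero>\<^bsub>truncated_algebra V U f\<^esub> = (0, \<zero>\<^bsub>V\<^esub>, \<zero>\<^bsub>U\<^esub>)"
  "(a, v, u) \<oplus>\<^bsub>truncated_algebra V U f\<^esub> (a', v', u') = (a + a', v \<oplus>\<^bsub>V\<^esub> v', u \<oplus>\<^bsub>U\<^esub> u')"
  "c \<odot>\<^bsub>truncated_algebra V U f\<^esub> (a, v, u) = (c * a, c \<odot>\<^bsub>V\<^esub> v, c \<odot>\<^bsub>U\<^esub> u)"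
  by (simp_all add: truncated_algebra_def)

context
  fixes V :: "('k::field, 'v, 'x) module_scheme" and U :: "('k, 'u, 'y) module_scheme"
    and f :: "'v \<Rightarrow> 'v \<Rightarrow> 'u"
  assumes V: "vec_space V" and U: "vec_space U" and f: "bilin V V U f"
begin

lemma assoc_algebra_truncated: "assoc_algebra (truncated_algebra V U f)"
proof (rule assoc_algebraI)
  note b = bilinD[OF f]
  have z: "f \<zero>\<^bsub>V\<^esub> v = \<zero>\<^bsub>U\<^esub>" "f v \<zero>\<^bsub>V\<^esub> = \<zero>\<^bsub>U\<^esub>" if "v \<in> carrier V" for v
    using lin_zero[OF V U bilin_lin_left[OF f that]] lin_zero[OF V U bilin_lin_right[OF f that]] by auto
  note ac = vs_add_assoc[OF U] vs_add_comm[OF U] vs_add_left_comm[OF U]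
    vs_add_assoc[OF V] vs_add_comm[OF V] vs_add_left_comm[OF V]
  note d = vs_smult_add[OF U] vs_smult_add[OF V] vs_add_smult[OF U] vs_add_smult[OF V]
  note s = truncated_algebra_simps
  show "vec_space (truncated_algebra V U f)"
    by (rule vec_spaceI) (auto simp: s ac d V U vs_add_neg1 algebra_simps)
  show "\<one>\<^bsub>truncated_algebra V U f\<^esub> \<in> carrier (truncated_algebra V U f)"
    by (simp add: s V U)
  show "bilin (truncated_algebra V U f) (truncated_algebra V U f) (truncated_algebra V U f)
    (\<lambda>x y. x \<otimes>\<^bsub>truncated_algebra V U f\<^esub> y)"
    by (rule bilinI) (auto simp: s ac d V U b algebra_simps)
qed (auto simp: truncated_algebra_simps vs_add_assoc vs_add_comm vs_add_left_comm V U bilinD[OF f]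
    vs_smult_add vs_add_smult mult.assoc mult.commute
    lin_zero[OF V U bilin_lin_left[OF f]] lin_zero[OF V U bilin_lin_right[OF f]])

lemma truncation_hom:
  "\<exists>g. alg_hom (tensor_algebra V) (truncated_algebra V U f) g \<and>
    (\<forall>v\<in>carrier V. g (tensor_incl V v) = (0, v, \<zero>\<^bsub>U\<^esub>)) \<and>
    (\<forall>v\<in>carrier V. \<forall>v'\<in>carrier V. g (sq_tensor V v v') = (0, \<zero>\<^bsub>V\<^esub>, f v v'))"
proof -
  have "lin V (truncated_algebra V U f) (\<lambda>v. (0, v, \<zero>\<^bsub>U\<^esub>))"
    by (rule linI) (simp_all add: truncated_algebra_simps U)
  then obtain g where g: "alg_hom (tensor_algebra V) (truncated_algebra V U f) g"
    "\<And>v. v \<in> carrier V \<Longrightarrow> g (tensor_incl V v) = (0, v, \<zero>\<^bsub>U\<^esub>)"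
    using tensor_algebra_lift[OF V assoc_algebra_truncated] by blast
  have "g (sq_tensor V v v') = (0, \<zero>\<^bsub>V\<^esub>, f v v')" if "v \<in> carrier V" "v' \<in> carrier V" for v v'
    using that V U bilinD(1)[OF f]
    by (simp add: sq_tensor_def alg_hom_mult[OF g(1)] g(2) tensor_incl_closed truncated_algebra_simps)
  then show ?thesis
    using g by blast
qed

lemma tensor_square_lift:
  "\<exists>h\<in>lin_maps (tensor_square V) U. \<forall>v\<in>carrier V. \<forall>v'\<in>carrier V. h (sq_tensor V v v') = f v v'"
proof -
  obtain g where g: "alg_hom (tensor_algebra V) (truncated_algebra V U f) g"
    "\<And>v v'. v \<in> carrier V \<Longrightarrow> v' \<in> carrier V \<Longrightarrow> g (sq_tensor V v v') = (0, \<zero>\<^bsub>V\<^esub>, f v v')"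
    using truncation_hom by blast
  have "lin (truncated_algebra V U f) U (\<lambda>x. snd (snd x))"
    by (rule linI) (auto simp: truncated_algebra_simps)
  then have "lin (tensor_square V) U (\<lambda>x. snd (snd (g x)))"
    by (rule lin_comp[OF lin_tensor_square[OF V alg_hom_lin[OF g(1)]]])
  then have "restrict (\<lambda>x. snd (snd (g x))) (carrier (tensor_square V)) \<in> lin_maps (tensor_square V) U"
    by (rule restrict_lin_maps[OF vec_space_tensor_square[OF V]])
  then show ?thesis
    by (rule rev_bexI) (simp add: g(2) sq_tensor_closed[OF V])
qed

end

text \<open>
  For \<open>f = 0\<close> products of degree one elements vanish in the truncated algebra, so the homomorphism
  into it kills all quadratic relations and its degree one coordinate descends to the quotient.
\<close>

lemma quadratic_quotient_degree_one:
  fixes V :: "('k::field, 'v, 'x) module_scheme"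
  assumes V: "vec_space V" and R: "R \<subseteq> carrier (tensor_square V)"
  shows "\<exists>\<pi>. lin (quot_algebra (tensor_algebra V) (Idl\<^bsub>tensor_algebra V\<^esub> R)) V \<pi> \<and>
    (\<forall>v\<in>carrier V. \<pi> (Idl\<^bsub>tensor_algebra V\<^esub> R +>\<^bsub>tensor_algebra V\<^esub> tensor_incl V v) = v)"
proof -
  let ?f = "\<lambda>v v'. \<zero>\<^bsub>V\<^esub>" and ?T = "tensor_algebra V"
  have f: "bilin V V V ?f"
    by (rule bilinI) (simp_all add: V)
  note A = assoc_algebra_truncated[OF V V f] and T = assoc_algebra_tensor_algebra[OF V]
  obtain g where g: "alg_hom ?T (truncated_algebra V V ?f) g"
    "\<And>v. v \<in> carrier V \<Longrightarrow> g (tensor_incl V v) = (0, v, \<zero>\<^bsub>V\<^esub>)"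
    "\<And>v v'. v \<in> carrier V \<Longrightarrow> v' \<in> carrier V \<Longrightarrow> g (sq_tensor V v v') = (0, \<zero>\<^bsub>V\<^esub>, \<zero>\<^bsub>V\<^esub>)"
    using truncation_hom[OF V V f] by blast
  have "g x = \<zero>\<^bsub>truncated_algebra V V ?f\<^esub>" if "x \<in> carrier (tensor_square V)" for x
    by (rule tensor_square_ext[OF V alg_vec_space[OF A] lin_tensor_square[OF V alg_hom_lin[OF g(1)]]
          lin_const_zero[OF alg_vec_space[OF A]] _ that])
      (simp add: g(3) truncated_algebra_simps)
  then have 0: "g x = \<zero>\<^bsub>truncated_algebra V V ?f\<^esub>" if "x \<in> Idl\<^bsub>?T\<^esub> R" for x
    using R tensor_square_subset[OF V] by (intro alg_hom_zero_on_Idl[OF T A g(1) _ _ that]) auto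
  have I: "ideal (Idl\<^bsub>?T\<^esub> R) ?T"
    using R tensor_square_subset[OF V] by (intro Idl_ideal[OF T]) auto
  obtain h where h: "alg_hom (quot_algebra ?T (Idl\<^bsub>?T\<^esub> R)) (truncated_algebra V V ?f) h"
    "\<And>x. x \<in> carrier ?T \<Longrightarrow> h (Idl\<^bsub>?T\<^esub> R +>\<^bsub>?T\<^esub> x) = g x"
    using quot_lift_alg_hom[OF T I A g(1) 0] by blast
  have "lin (truncated_algebra V V ?f) V (\<lambda>x. fst (snd x))"
    by (rule linI) (auto simp: truncated_algebra_simps)
  then have "lin (quot_algebra ?T (Idl\<^bsub>?T\<^esub> R)) V (\<lambda>x. fst (snd (h x)))"
    by (rule lin_comp[OF alg_hom_lin[OF h(1)]])
  then show ?thesis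
    by (rule exI[where x = "\<lambda>x. fst (snd (h x))", OF conjI]) (simp add: h(2) g(2) tensor_incl_closed[OF V])
qed

section \<open>Shuffle, pairing and transpose\<close>

text \<open>
  Currying: a multilinear map in four arguments factors through two universal bilinear maps
  \<open>\<tau>\<^sub>1\<close>, \<open>\<tau>\<^sub>2\<close>, by lifting first into \<open>U\<close> and then into the space of linear maps \<open>T\<^sub>2 \<rightarrow> U\<close>.
\<close>

lemma quadrilinear_lift:
  assumes T2: "vec_space T\<^sub>2" and U: "vec_space U"
    and \<tau>1: "bilin V V' T\<^sub>1 \<tau>\<^sub>1" and \<tau>2: "bilin W W' T\<^sub>2 \<tau>\<^sub>2"
    and lift1: "\<And>g. bilin V V' (hom_space T\<^sub>2 U) g \<Longrightarrow>
      \<exists>h\<in>lin_maps T\<^sub>1 (hom_space T\<^sub>2 U). \<forall>v\<in>carrier V. \<forall>v'\<in>carrier V'. h (\<tau>\<^sub>1 v v') = g v v'"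
    and lift2: "\<And>g. bilin W W' U g \<Longrightarrow>
      \<exists>h\<in>lin_maps T\<^sub>2 U. \<forall>w\<in>carrier W. \<forall>w'\<in>carrier W'. h (\<tau>\<^sub>2 w w') = g w w'"
    and ext2: "\<And>g h. lin T\<^sub>2 U g \<Longrightarrow> lin T\<^sub>2 U h \<Longrightarrow>
      (\<And>w w'. w \<in> carrier W \<Longrightarrow> w' \<in> carrier W' \<Longrightarrow> g (\<tau>\<^sub>2 w w') = h (\<tau>\<^sub>2 w w')) \<Longrightarrow>
      (\<And>x. x \<in> carrier T\<^sub>2 \<Longrightarrow> g x = h x)"
    and f1: "\<And>w w'. w \<in> carrier W \<Longrightarrow> w' \<in> carrier W' \<Longrightarrow> bilin V V' U (\<lambda>v v'. f v v' w w')"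
    and f2: "\<And>v v'. v \<in> carrier V \<Longrightarrow> v' \<in> carrier V' \<Longrightarrow> bilin W W' U (f v v')"
    and V: "vec_space V" "vec_space V'"
  shows "\<exists>\<mu>. bilin T\<^sub>1 T\<^sub>2 U \<mu> \<and> (\<forall>v\<in>carrier V. \<forall>v'\<in>carrier V'. \<forall>w\<in>carrier W. \<forall>w'\<in>carrier W'.
    \<mu> (\<tau>\<^sub>1 v v') (\<tau>\<^sub>2 w w') = f v v' w w')"
proof -
  let ?H = "hom_space T\<^sub>2 U"
  have H: "vec_space ?H"
    by (rule vec_space_hom_space[OF T2 U])
  define P where "P = (\<lambda>v v' h. h \<in> lin_maps T\<^sub>2 U \<and> (\<forall>w\<in>carrier W. \<forall>w'\<in>carrier W'. h (\<tau>\<^sub>2 w w') = f v v' w w'))"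
  define g where "g = (\<lambda>v v'. SOME h. P v v' h)"
  have "P v v' (g v v')" if "v \<in> carrier V" "v' \<in> carrier V'" for v v'
  proof -
    have "\<exists>h. P v v' h"
      using lift2[OF f2[OF that]] by (auto simp: P_def)
    then show ?thesis
      unfolding g_def by (rule someI_ex)
  qed
  then have g: "\<And>v v'. v \<in> carrier V \<Longrightarrow> v' \<in> carrier V' \<Longrightarrow> g v v' \<in> lin_maps T\<^sub>2 U"
    "\<And>v v' w w'. v \<in> carrier V \<Longrightarrow> v' \<in> carrier V' \<Longrightarrow> w \<in> carrier W \<Longrightarrow> w' \<in> carrier W' \<Longrightarrow>
      g v v' (\<tau>\<^sub>2 w w') = f v v' w w'"
    by (simp_all add: P_def)
  have eq: "g1 = g2" if "g1 \<in> carrier ?H" "g2 \<in> carrier ?H"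
    "\<And>w w'. w \<in> carrier W \<Longrightarrow> w' \<in> carrier W' \<Longrightarrow> g1 (\<tau>\<^sub>2 w w') = g2 (\<tau>\<^sub>2 w w')" for g1 g2
  proof (rule lin_maps_eqI)
    show g: "g1 \<in> lin_maps T\<^sub>2 U" "g2 \<in> lin_maps T\<^sub>2 U"
      using that(1,2) by (simp_all only: hom_space_simps)
    show "g1 x = g2 x" if "x \<in> carrier T\<^sub>2" for x
      by (rule ext2[OF lin_maps_lin[OF g(1)] lin_maps_lin[OF g(2)] _ that]) (rule \<open>\<And>w w'. w \<in> carrier W \<Longrightarrow> w' \<in> carrier W' \<Longrightarrow> g1 (\<tau>\<^sub>2 w w') = g2 (\<tau>\<^sub>2 w w')\<close>)
  qed
  have gH: "g v v' \<in> carrier ?H" if "v \<in> carrier V" "v' \<in> carrier V'" for v v'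
    using g(1)[OF that] by (simp add: hom_space_simps)
  have sumH: "(g1 \<oplus>\<^bsub>?H\<^esub> g2) (\<tau>\<^sub>2 w w') = g1 (\<tau>\<^sub>2 w w') \<oplus>\<^bsub>U\<^esub> g2 (\<tau>\<^sub>2 w w')"
    and smH: "(c \<odot>\<^bsub>?H\<^esub> g1) (\<tau>\<^sub>2 w w') = c \<odot>\<^bsub>U\<^esub> g1 (\<tau>\<^sub>2 w w')"
    if "w \<in> carrier W" "w' \<in> carrier W'" for g1 g2 c w w'
    using bilinD(1)[OF \<tau>2 that] by (simp_all add: hom_space_simps)
  have "bilin V V' ?H g"
  proof (rule bilinI)
    fix v w assume v: "v \<in> carrier V" "w \<in> carrier V'"
    show "g v w \<in> carrier ?H"
      by (rule gH[OF v])
    show "g (v \<oplus>\<^bsub>V\<^esub> v') w = g v w \<oplus>\<^bsub>?H\<^esub> g v' w" if "v' \<in> carrier V" for v'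
      using v that V H by (intro eq) (simp_all add: gH sumH g(2) bilinD(2)[OF f1])
    show "g (c \<odot>\<^bsub>V\<^esub> v) w = c \<odot>\<^bsub>?H\<^esub> g v w" for c
      using v V H by (intro eq) (simp_all add: gH smH g(2) bilinD(3)[OF f1])
    show "g v (w \<oplus>\<^bsub>V'\<^esub> w') = g v w \<oplus>\<^bsub>?H\<^esub> g v w'" if "w' \<in> carrier V'" for w'
      using v that V H by (intro eq) (simp_all add: gH sumH g(2) bilinD(4)[OF f1])
    show "g v (c \<odot>\<^bsub>V'\<^esub> w) = c \<odot>\<^bsub>?H\<^esub> g v w" for c
      using v V H by (intro eq) (simp_all add: gH smH g(2) bilinD(5)[OF f1])
  qed
  then obtain h where h: "h \<in> lin_maps T\<^sub>1 ?H" "\<And>v v'. v \<in> carrier V \<Longrightarrow> v' \<in> carrier V' \<Longrightarrow> h (\<tau>\<^sub>1 v v') = g v v'"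
    using lift1 by blast
  have "bilin T\<^sub>1 T\<^sub>2 U h"
    unfolding bilin_def
  proof (intro conjI ballI)
    show "lin T\<^sub>2 U (h t)" if "t \<in> carrier T\<^sub>1" for t
      using lin_closed[OF lin_maps_lin[OF h(1)] that] by (simp add: hom_space_simps lin_maps_lin)
    show "lin T\<^sub>1 U (\<lambda>t. h t s)" if "s \<in> carrier T\<^sub>2" for s
      by (rule lin_comp[OF lin_maps_lin[OF h(1)] lin_eval[OF that]])
  qed
  then show ?thesis
    using h(2) g(2) by (intro exI[of _ h]) simp
qed

lemma tensor_squares_lift:
  assumes V: "vec_space V" and W: "vec_space W" and U: "vec_space U"
    and f1: "\<And>w w'. w \<in> carrier W \<Longrightarrow> w' \<in> carrier W \<Longrightarrow> bilin V V U (\<lambda>v v'. f v v' w w')"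
    and f2: "\<And>v v'. v \<in> carrier V \<Longrightarrow> v' \<in> carrier V \<Longrightarrow> bilin W W U (f v v')"
  shows "\<exists>\<mu>. bilin (tensor_square V) (tensor_square W) U \<mu> \<and>
    (\<forall>v\<in>carrier V. \<forall>v'\<in>carrier V. \<forall>w\<in>carrier W. \<forall>w'\<in>carrier W.
      \<mu> (sq_tensor V v v') (sq_tensor W w w') = f v v' w w')"
proof (rule quadrilinear_lift[OF vec_space_tensor_square[OF W] U sq_tensor_bilin[OF V] sq_tensor_bilin[OF W]
      _ _ _ f1 f2 V V])
  let ?H = "hom_space (tensor_square W) U"
  show "\<exists>h\<in>lin_maps (tensor_square V) ?H. \<forall>v\<in>carrier V. \<forall>v'\<in>carrier V. h (sq_tensor V v v') = g v v'"
    if "bilin V V ?H g" for g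
    by (rule tensor_square_lift[OF V vec_space_hom_space[OF vec_space_tensor_square[OF W] U] that])
  show "\<exists>h\<in>lin_maps (tensor_square W) U. \<forall>w\<in>carrier W. \<forall>w'\<in>carrier W. h (sq_tensor W w w') = g w w'"
    if "bilin W W U g" for g
    by (rule tensor_square_lift[OF W U that])
qed (rule tensor_square_ext[OF W U])

lemma tensors_lift:
  assumes V: "vec_space V" and W: "vec_space W" and V': "vec_space V'" and W': "vec_space W'" and U: "vec_space U"
    and f1: "\<And>w w'. w \<in> carrier W \<Longrightarrow> w' \<in> carrier W' \<Longrightarrow> bilin V V' U (\<lambda>v v'. f v v' w w')"
    and f2: "\<And>v v'. v \<in> carrier V \<Longrightarrow> v' \<in> carrier V' \<Longrightarrow> bilin W W' U (f v v')"
  shows "\<exists>\<mu>. bilin (tensor V V') (tensor W W') U \<mu> \<and>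
    (\<forall>v\<in>carrier V. \<forall>v'\<in>carrier V'. \<forall>w\<in>carrier W. \<forall>w'\<in>carrier W'.
      \<mu> (pure_tensor V V' v v') (pure_tensor W W' w w') = f v v' w w')"
proof (rule quadrilinear_lift[OF vec_space_tensor[OF W W'] U pure_tensor_bilin[OF V V'] pure_tensor_bilin[OF W W']
      _ _ _ f1 f2 V V'])
  let ?H = "hom_space (tensor W W') U"
  show "\<exists>h\<in>lin_maps (tensor V V') ?H. \<forall>v\<in>carrier V. \<forall>v'\<in>carrier V'. h (pure_tensor V V' v v') = g v v'"
    if "bilin V V' ?H g" for g
    by (rule tensor_lift[OF V V' vec_space_hom_space[OF vec_space_tensor[OF W W'] U] that])
  show "\<exists>h\<in>lin_maps (tensor W W') U. \<forall>w\<in>carrier W. \<forall>w'\<in>carrier W'. h (pure_tensor W W' w w') = g w w'"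
    if "bilin W W' U g" for g
    by (rule tensor_lift[OF W W' U that])
qed (rule tensor_ext[OF W W' U])

context
  fixes V :: "('k::field, 'v) module" and W :: "('k, 'w) module"
  assumes V: "vec_space V" and W: "vec_space W"
begin

private abbreviation (input) "V2 \<equiv> tensor_square V"

private abbreviation (input) "W2 \<equiv> tensor_square W"

private abbreviation (input) "P2 \<equiv> tensor_square (tensor V W)"

lemma tensor_square_tensor_ext:
  assumes U: "vec_space U" and f: "lin P2 U f" and g: "lin P2 U g"
    and eq: "\<And>v w v' w'. v \<in> carrier V \<Longrightarrow> w \<in> carrier W \<Longrightarrow> v' \<in> carrier V \<Longrightarrow> w' \<in> carrier W \<Longrightarrow>
      f (sq_tensor (tensor V W) (pure_tensor V W v w) (pure_tensor V W v' w'))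
      = g (sq_tensor (tensor V W) (pure_tensor V W v w) (pure_tensor V W v' w'))"
    and x: "x \<in> carrier P2"
  shows "f x = g x"
proof (rule tensor_square_ext[OF vec_space_tensor[OF V W] U f g _ x])
  note T = vec_space_tensor[OF V W]
  fix x y assume "x \<in> carrier (tensor V W)" "y \<in> carrier (tensor V W)"
  then show "f (sq_tensor (tensor V W) x y) = g (sq_tensor (tensor V W) x y)"
    by (rule bilin_ext[OF T T U
          bilin_comp[OF sq_tensor_bilin[OF T] lin_ident lin_ident f]
          bilin_comp[OF sq_tensor_bilin[OF T] lin_ident lin_ident g]
          pure_tensors_subset[OF V W] tensor_span[OF V W] pure_tensors_subset[OF V W] tensor_span[OF V W], rotated])
      (use eq in blast)
qed

lemma tensor_tensor_square_ext:
  assumes U: "vec_space U" and f: "lin (tensor V2 W2) U f" and g: "lin (tensor V2 W2) U g"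
    and eq: "\<And>v w v' w'. v \<in> carrier V \<Longrightarrow> w \<in> carrier W \<Longrightarrow> v' \<in> carrier V \<Longrightarrow> w' \<in> carrier W \<Longrightarrow>
      f (pure_tensor V2 W2 (sq_tensor V v v') (sq_tensor W w w'))
      = g (pure_tensor V2 W2 (sq_tensor V v v') (sq_tensor W w w'))"
    and x: "x \<in> carrier (tensor V2 W2)"
  shows "f x = g x"
proof (rule tensor_ext[OF vec_space_tensor_square[OF V] vec_space_tensor_square[OF W] U f g _ x])
  note TV = vec_space_tensor_square[OF V] and TW = vec_space_tensor_square[OF W]
  have S: "{sq_tensor V v v' |v v'. v \<in> carrier V \<and> v' \<in> carrier V} \<subseteq> carrier V2"
    "{sq_tensor W v v' |v v'. v \<in> carrier W \<and> v' \<in> carrier W} \<subseteq> carrier W2"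
    using sq_tensor_closed[OF V] sq_tensor_closed[OF W] by auto
  fix x y assume "x \<in> carrier V2" "y \<in> carrier W2"
  then show "f (pure_tensor V2 W2 x y) = g (pure_tensor V2 W2 x y)"
    by (rule bilin_ext[OF TV TW U
          bilin_comp[OF pure_tensor_bilin[OF TV TW] lin_ident lin_ident f]
          bilin_comp[OF pure_tensor_bilin[OF TV TW] lin_ident lin_ident g]
          S(1) tensor_square_span[OF V] S(2) tensor_square_span[OF W], rotated])
      (use eq in blast)
qed

lemma shuffle_map_spec:
  shows shuffle_map_lin_maps: "shuffle_map V W \<in> lin_maps P2 (tensor V2 W2)"
    and shuffle_map_pure: "\<And>v w v' w'. v \<in> carrier V \<Longrightarrow> w \<in> carrier W \<Longrightarrow> v' \<in> carrier V \<Longrightarrow> w' \<in> carrier W \<Longrightarrow>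
      shuffle_map V W (sq_tensor (tensor V W) (pure_tensor V W v w) (pure_tensor V W v' w'))
      = pure_tensor V2 W2 (sq_tensor V v v') (sq_tensor W w w')"
proof -
  let ?P = "\<lambda>h. h \<in> lin_maps P2 (tensor V2 W2) \<and>
     (\<forall>v\<in>carrier V. \<forall>w\<in>carrier W. \<forall>v'\<in>carrier V. \<forall>w'\<in>carrier W.
        h (sq_tensor (tensor V W) (pure_tensor V W v w) (pure_tensor V W v' w')) =
        pure_tensor V2 W2 (sq_tensor V v v') (sq_tensor W w w'))"
  note T = vec_space_tensor[OF V W] and TV = vec_space_tensor_square[OF V] and TW = vec_space_tensor_square[OF W]
  note TT = vec_space_tensor[OF TV TW] and pb = pure_tensor_bilin[OF TV TW]
  obtain \<mu> where \<mu>: "bilin (tensor V W) (tensor V W) (tensor V2 W2) \<mu>"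
    "\<forall>v\<in>carrier V. \<forall>w\<in>carrier W. \<forall>v'\<in>carrier V. \<forall>w'\<in>carrier W.
      \<mu> (pure_tensor V W v w) (pure_tensor V W v' w') = pure_tensor V2 W2 (sq_tensor V v v') (sq_tensor W w w')"
    using tensors_lift[where f = "\<lambda>v w v' w'. pure_tensor V2 W2 (sq_tensor V v v') (sq_tensor W w w')",
        OF V V W W TT
        bilin_comp[OF pb bilin_lin_left[OF sq_tensor_bilin[OF V]] bilin_lin_left[OF sq_tensor_bilin[OF W]] lin_ident]
        bilin_comp[OF pb bilin_lin_right[OF sq_tensor_bilin[OF V]] bilin_lin_right[OF sq_tensor_bilin[OF W]] lin_ident]]
    by blast
  obtain h where h0: "h \<in> lin_maps P2 (tensor V2 W2)"
    "\<forall>x\<in>carrier (tensor V W). \<forall>y\<in>carrier (tensor V W). h (sq_tensor (tensor V W) x y) = \<mu> x y"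
    using tensor_square_lift[OF T TT \<mu>(1)] by blast
  have h: "?P h"
    using h0 \<mu>(2) pure_tensor_closed[OF V W] by simp
  have "?P (shuffle_map V W)"
    unfolding shuffle_map_def
  proof (rule theI[where P = ?P, OF h])
    fix h' assume h': "?P h'"
    show "h' = h"
    proof (rule lin_maps_eqI)
      show "h' x = h x" if "x \<in> carrier P2" for x
        by (rule tensor_square_tensor_ext[OF TT _ _ _ that]) (use h h' in \<open>auto simp: lin_maps_lin\<close>)
    qed (use h h' in auto)
  qed
  then show "shuffle_map V W \<in> lin_maps P2 (tensor V2 W2)"
    "\<And>v w v' w'. v \<in> carrier V \<Longrightarrow> w \<in> carrier W \<Longrightarrow> v' \<in> carrier V \<Longrightarrow> w' \<in> carrier W \<Longrightarrow>
      shuffle_map V W (sq_tensor (tensor V W) (pure_tensor V W v w) (pure_tensor V W v' w'))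
      = pure_tensor V2 W2 (sq_tensor V v v') (sq_tensor W w w')"
    by auto
qed

text \<open>
  The inverse of the shuffle, from the universal properties of the tensor product and of the two
  tensor squares.  It makes the inverse in the definition of \<open>R \<boxtimes> S\<close> meaningful.
\<close>

lemma unshuffle_exists:
  "\<exists>u. lin (tensor V2 W2) P2 u \<and>
    (\<forall>v\<in>carrier V. \<forall>v'\<in>carrier V. \<forall>w\<in>carrier W. \<forall>w'\<in>carrier W.
      u (pure_tensor V2 W2 (sq_tensor V v v') (sq_tensor W w w'))
      = sq_tensor (tensor V W) (pure_tensor V W v w) (pure_tensor V W v' w'))"
proof -
  note T = vec_space_tensor[OF V W] and TV = vec_space_tensor_square[OF V] and TW = vec_space_tensor_square[OF W]
  note TT = vec_space_tensor_square[OF T] and sb = sq_tensor_bilin[OF T] and pb = pure_tensor_bilin[OF V W]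
  obtain \<mu> where \<mu>: "bilin V2 W2 P2 \<mu>"
    "\<forall>v\<in>carrier V. \<forall>v'\<in>carrier V. \<forall>w\<in>carrier W. \<forall>w'\<in>carrier W. \<mu> (sq_tensor V v v') (sq_tensor W w w')
      = sq_tensor (tensor V W) (pure_tensor V W v w) (pure_tensor V W v' w')"
    using tensor_squares_lift[where f = "\<lambda>v v' w w'. sq_tensor (tensor V W) (pure_tensor V W v w) (pure_tensor V W v' w')",
        OF V W TT
        bilin_comp[OF sb bilin_lin_left[OF pb] bilin_lin_left[OF pb] lin_ident]
        bilin_comp[OF sb bilin_lin_right[OF pb] bilin_lin_right[OF pb] lin_ident]]
    by blast
  obtain u where u: "u \<in> lin_maps (tensor V2 W2) P2"
    "\<forall>x\<in>carrier V2. \<forall>y\<in>carrier W2. u (pure_tensor V2 W2 x y) = \<mu> x y"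
    using tensor_lift[OF TV TW TT \<mu>(1)] by blast
  have "lin (tensor V2 W2) P2 u"
    using u(1) by (rule lin_maps_lin)
  then show ?thesis
    using u(2) \<mu>(2) sq_tensor_closed[OF V] sq_tensor_closed[OF W] by (intro exI[of _ u]) simp
qed

lemma shuffle_map_bij: "bij_betw (shuffle_map V W) (carrier P2) (carrier (tensor V2 W2))"
proof -
  obtain u where u: "lin (tensor V2 W2) P2 u"
    "\<And>v v' w w'. v \<in> carrier V \<Longrightarrow> v' \<in> carrier V \<Longrightarrow> w \<in> carrier W \<Longrightarrow> w' \<in> carrier W \<Longrightarrow>
      u (pure_tensor V2 W2 (sq_tensor V v v') (sq_tensor W w w'))
      = sq_tensor (tensor V W) (pure_tensor V W v w) (pure_tensor V W v' w')"
    using unshuffle_exists by blast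
  note sh = lin_maps_lin[OF shuffle_map_lin_maps]
  have 1: "u (shuffle_map V W x) = x" if "x \<in> carrier P2" for x
    by (rule tensor_square_tensor_ext[OF vec_space_tensor_square[OF vec_space_tensor[OF V W]]
          lin_comp[OF sh u(1)] lin_ident _ that])
      (simp add: shuffle_map_pure u(2))
  have 2: "shuffle_map V W (u x) = x" if "x \<in> carrier (tensor V2 W2)" for x
    by (rule tensor_tensor_square_ext[OF vec_space_tensor[OF vec_space_tensor_square[OF V] vec_space_tensor_square[OF W]]
          lin_comp[OF u(1) sh] lin_ident _ that])
      (simp add: shuffle_map_pure u(2))
  show ?thesis
    by (rule bij_betwI[where g = u]) (use 1 2 linD(1)[OF sh] linD(1)[OF u(1)] in auto)
qed

text \<open>
  Describes \<open>R \<boxtimes> S\<close> without mentioning the shuffle and its inverse: \<open>u(x, y)\<close> is \<open>x \<otimes> y\<close> with its four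
  factors shuffled back, and \<open>R\<close> and \<open>S\<close> act on its two arguments like a derivation.
\<close>

lemma EQA_prod_spec:
  assumes R: "R \<in> lin_maps V2 V2" and S: "S \<in> lin_maps W2 W2"
  shows "\<exists>Q u. EQA_prod (V, R) (W, S) = (tensor V W, Q) \<and> Q \<in> lin_maps P2 P2 \<and> bilin V2 W2 P2 u \<and>
    (\<forall>v\<in>carrier V. \<forall>v'\<in>carrier V. \<forall>w\<in>carrier W. \<forall>w'\<in>carrier W.
      u (sq_tensor V v v') (sq_tensor W w w')
      = sq_tensor (tensor V W) (pure_tensor V W v w) (pure_tensor V W v' w')) \<and>
    (\<forall>x\<in>carrier V2. \<forall>y\<in>carrier W2. Q (u x y) = u (R x) y \<oplus>\<^bsub>P2\<^esub> u x (S y))"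
proof -
  note T = vec_space_tensor[OF V W] and TV = vec_space_tensor_square[OF V] and TW = vec_space_tensor_square[OF W]
  note TP = vec_space_tensor_square[OF T] and TT = vec_space_tensor[OF TV TW]
  let ?sh = "shuffle_map V W"
  note sh = lin_maps_lin[OF shuffle_map_lin_maps]
  define i where "i = the_inv_into (carrier P2) ?sh"
  have inj: "inj_on ?sh (carrier P2)" and im: "?sh ` carrier P2 = carrier (tensor V2 W2)"
    using shuffle_map_bij by (auto simp: bij_betw_def)
  have i: "lin (tensor V2 W2) P2 i"
    unfolding i_def by (rule lin_the_inv_into[OF TP TT sh shuffle_map_bij])
  have ish: "i (?sh x) = x" if "x \<in> carrier P2" for x
    unfolding i_def by (rule the_inv_into_f_f[OF inj that])
  have shi: "?sh (i x) = x" if "x \<in> carrier (tensor V2 W2)" for x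
    unfolding i_def using that im by (intro f_the_inv_into_f[OF inj]) simp
  define mR where "mR = tensor_map V2 W2 V2 W2 R (id_map W2)"
  define mS where "mS = tensor_map V2 W2 V2 W2 (id_map V2) S"
  note Rl = lin_maps_lin[OF R] and Sl = lin_maps_lin[OF S]
  note iV = lin_maps_lin[OF id_map_lin_maps[OF TV]] and iW = lin_maps_lin[OF id_map_lin_maps[OF TW]]
  have mR: "lin (tensor V2 W2) (tensor V2 W2) mR"
    unfolding mR_def by (rule lin_maps_lin[OF tensor_map_lin_maps[OF TV TW TV TW Rl iW]])
  have mS: "lin (tensor V2 W2) (tensor V2 W2) mS"
    unfolding mS_def by (rule lin_maps_lin[OF tensor_map_lin_maps[OF TV TW TV TW iV Sl]])
  define Q where "Q = (\<lambda>x\<in>carrier P2. i (mR (?sh x) \<oplus>\<^bsub>tensor V2 W2\<^esub> mS (?sh x)))"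
  define u where "u = (\<lambda>x y. i (pure_tensor V2 W2 x y))"
  have "Q \<in> lin_maps P2 P2"
    unfolding Q_def
    by (intro restrict_lin_maps[OF TP] lin_comp[OF _ i] lin_sum[OF TT] lin_comp[OF sh mR] lin_comp[OF sh mS])
  moreover have ub: "bilin V2 W2 P2 u"
    unfolding u_def by (rule bilin_comp[OF pure_tensor_bilin[OF TV TW] lin_ident lin_ident i])
  moreover have "u (sq_tensor V v v') (sq_tensor W w w')
      = sq_tensor (tensor V W) (pure_tensor V W v w) (pure_tensor V W v' w')"
    if "v \<in> carrier V" "v' \<in> carrier V" "w \<in> carrier W" "w' \<in> carrier W" for v v' w w'
    using that ish[OF sq_tensor_closed[OF T], of "pure_tensor V W v w" "pure_tensor V W v' w'"]
    by (simp add: u_def shuffle_map_pure pure_tensor_closed[OF V W])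
  moreover have "Q (u x y) = u (R x) y \<oplus>\<^bsub>P2\<^esub> u x (S y)" if x: "x \<in> carrier V2" and y: "y \<in> carrier W2" for x y
  proof -
    have p: "pure_tensor V2 W2 x y \<in> carrier (tensor V2 W2)"
      by (rule pure_tensor_closed[OF TV TW x y])
    have "Q (u x y) = i (mR (pure_tensor V2 W2 x y) \<oplus>\<^bsub>tensor V2 W2\<^esub> mS (pure_tensor V2 W2 x y))"
      using bilinD(1)[OF ub x y] by (simp add: Q_def) (simp add: u_def shi[OF p])
    also have "\<dots> = i (mR (pure_tensor V2 W2 x y)) \<oplus>\<^bsub>P2\<^esub> i (mS (pure_tensor V2 W2 x y))"
      by (rule lin_add[OF i lin_closed[OF mR p] lin_closed[OF mS p]])
    also have "mR (pure_tensor V2 W2 x y) = pure_tensor V2 W2 (R x) y"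
      using tensor_map_pure[OF TV TW TV TW Rl iW x y] y by (simp add: mR_def id_map_def)
    also have "mS (pure_tensor V2 W2 x y) = pure_tensor V2 W2 x (S y)"
      using tensor_map_pure[OF TV TW TV TW iV Sl x y] x by (simp add: mS_def id_map_def)
    finally show ?thesis
      by (simp add: u_def)
  qed
  moreover have "EQA_prod (V, R) (W, S) = (tensor V W, Q)"
    by (simp add: EQA_prod_def Let_def Q_def mR_def mS_def i_def)
  ultimately show ?thesis
    by blast
qed

end

context
  fixes W :: "('k::field, 'w) module"
  assumes W: "vec_space W"
begin

private abbreviation (input) "D \<equiv> dual_space W"

private abbreviation (input) "D2 \<equiv> tensor_square (dual_space W)"

private abbreviation (input) "Wsq \<equiv> tensor_square W"

text \<open>
  Existence of the pairing is the universal property for four arguments; uniqueness holds because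
  the elements \<open>f \<otimes> f'\<close> and \<open>w \<otimes> w'\<close> span the two tensor squares.
\<close>

lemma sq_pairing_spec:
  shows sq_pairing_bilin: "bilin D2 Wsq base_field (sq_pairing W)"
    and sq_pairing_sq: "\<And>f f' w w'. f \<in> carrier D \<Longrightarrow> f' \<in> carrier D \<Longrightarrow> w \<in> carrier W \<Longrightarrow> w' \<in> carrier W \<Longrightarrow>
      sq_pairing W (sq_tensor D f f') (sq_tensor W w w') = f w * f' w'"
proof -
  let ?P = "\<lambda>\<beta>. \<beta> \<in> lin_maps D2 (dual_space Wsq) \<and>
     (\<forall>f\<in>carrier D. \<forall>f'\<in>carrier D. \<forall>w\<in>carrier W. \<forall>w'\<in>carrier W.
        \<beta> (sq_tensor D f f') (sq_tensor W w w') = f w * f' w')"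
  note VD = vec_space_dual_space[OF W]
  note V2 = vec_space_tensor_square[OF VD] and VW2 = vec_space_tensor_square[OF W]
  have 1: "bilin D D base_field (\<lambda>f f'. f w * f' w')" if "w \<in> carrier W" "w' \<in> carrier W" for w w'
    by (rule bilinI) (use that in \<open>simp_all add: algebra_simps\<close>)
  have 2: "bilin W W base_field (\<lambda>w w'. f w * f' w')" if "f \<in> carrier D" "f' \<in> carrier D" for f f'
    by (rule bilinI)
      (use linD[OF dual_space_lin[OF that(1)]] linD[OF dual_space_lin[OF that(2)]] in \<open>simp_all add: algebra_simps\<close>)
  obtain \<mu> where \<mu>: "bilin D2 Wsq base_field \<mu>"
    "\<forall>f\<in>carrier D. \<forall>f'\<in>carrier D. \<forall>w\<in>carrier W. \<forall>w'\<in>carrier W. \<mu> (sq_tensor D f f') (sq_tensor W w w') = f w * f' w'"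
    using tensor_squares_lift[where f = "\<lambda>f f' w w'. f w * f' w'", OF VD W vec_space_base_field 1 2] by blast
  define \<beta> where "\<beta> = (\<lambda>x\<in>carrier D2. \<lambda>y\<in>carrier Wsq. \<mu> x y)"
  have \<beta>: "?P \<beta>"
    using bilin_hom_space[OF V2 VW2 \<mu>(1)] \<mu>(2) sq_tensor_closed[OF VD] sq_tensor_closed[OF W]
    by (simp add: \<beta>_def dual_space_eq_hom_space)
  have bil: "bilin D2 Wsq base_field \<beta>'" if "?P \<beta>'" for \<beta>'
    using that by (intro hom_space_bilin lin_maps_lin) (simp add: dual_space_eq_hom_space)
  have "?P (sq_pairing W)"
    unfolding sq_pairing_def
  proof (rule theI[where P = ?P, OF \<beta>])
    fix \<beta>' assume \<beta>': "?P \<beta>'"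
    have S: "{sq_tensor D f f' |f f'. f \<in> carrier D \<and> f' \<in> carrier D} \<subseteq> carrier D2"
      "{sq_tensor W v v' |v v'. v \<in> carrier W \<and> v' \<in> carrier W} \<subseteq> carrier Wsq"
      using sq_tensor_closed[OF VD] sq_tensor_closed[OF W] by auto
    have eq: "\<beta>' x y = \<beta> x y" if "x \<in> carrier D2" "y \<in> carrier Wsq" for x y
      by (rule bilin_ext[OF V2 VW2 vec_space_base_field bil[OF \<beta>'] bil[OF \<beta>]
            S(1) tensor_square_span[OF VD] S(2) tensor_square_span[OF W] _ that])
        (use \<beta> \<beta>' in auto)
    show "\<beta>' = \<beta>"
    proof (rule lin_maps_eqI)
      show l: "\<beta>' \<in> lin_maps D2 (dual_space Wsq)" "\<beta> \<in> lin_maps D2 (dual_space Wsq)"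
        using \<beta> \<beta>' by auto
      show "\<beta>' x = \<beta> x" if x: "x \<in> carrier D2" for x
        using lin_closed[OF lin_maps_lin[OF l(1)] x] lin_closed[OF lin_maps_lin[OF l(2)] x] eq[OF x]
        by (intro lin_maps_eqI[of "\<beta>' x" Wsq base_field "\<beta> x"]) (simp_all only: carrier_dual_space)
    qed
  qed
  then show "bilin D2 Wsq base_field (sq_pairing W)"
    "\<And>f f' w w'. f \<in> carrier D \<Longrightarrow> f' \<in> carrier D \<Longrightarrow> w \<in> carrier W \<Longrightarrow> w' \<in> carrier W \<Longrightarrow>
      sq_pairing W (sq_tensor D f f') (sq_tensor W w w') = f w * f' w'"
    using bil by auto
qed

end

text \<open>Dual bases of \<open>W\<close> and its dual space induce dual bases of their tensor squares.\<close>

definition sq_basis ::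
  "('k::field, 'v, 'x) module_scheme \<Rightarrow> (nat \<Rightarrow> 'v) \<Rightarrow> nat \<times> nat \<Rightarrow> ('v list \<Rightarrow>\<^sub>0 'k) set" where
  "sq_basis V b = (\<lambda>(i, j). sq_tensor V (b i) (b j))"

lemma dual_bases_dual_span:
  assumes V: "vec_space V" and db: "dual_bases V n b d"
  shows "lin_span (dual_space V) (d ` {..<n}) = carrier (dual_space V)"
proof -
  note D = dual_basesD[OF db] and VD = vec_space_dual_space[OF V]
  have sub: "d ` {..<n} \<subseteq> carrier (dual_space V)"
    using D by auto
  note N = lin_span_subspace[OF VD sub]
  have "f \<in> lin_span (dual_space V) (d ` {..<n})" if f: "f \<in> carrier (dual_space V)" for f
  proof -
    have "finsum (dual_space V) (\<lambda>j. f (b j) \<odot>\<^bsub>dual_space V\<^esub> d j) {..<n} \<in> lin_span (dual_space V) (d ` {..<n})"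
      using lin_span_superset[of "d ` {..<n}" "dual_space V"]
      by (intro lin_span_finsum[OF VD N] lin_subspace_smult[OF VD N]) auto
    then show ?thesis
      using dual_bases_dual_expansion[OF V db f] by simp
  qed
  then show ?thesis
    using lin_subspace_subset[OF VD N] by auto
qed

lemma sq_basis_span:
  assumes V: "vec_space V" and b: "b ` {..<n} \<subseteq> carrier V" "lin_span V (b ` {..<n}) = carrier V"
  shows "lin_span (tensor_square V) (sq_basis V b ` ({..<n} \<times> {..<n})) = carrier (tensor_square V)"
proof -
  have "{sq_tensor V v w | v w. v \<in> b ` {..<n} \<and> w \<in> b ` {..<n}} = sq_basis V b ` ({..<n} \<times> {..<n})"
    by (auto simp: sq_basis_def image_iff)
  then show ?thesis
    using bilin_span[OF V V vec_space_tensor_square[OF V] sq_tensor_bilin[OF V] b b tensor_square_span[OF V]]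
    by simp
qed

context
  fixes W :: "('k::field, 'w) module" and n :: nat and b :: "nat \<Rightarrow> 'w" and d :: "nat \<Rightarrow> 'w \<Rightarrow> 'k"
  assumes W: "vec_space W" and db: "dual_bases W n b d"
begin

private abbreviation (input) "DD \<equiv> dual_space W"

private abbreviation (input) "DD2 \<equiv> tensor_square (dual_space W)"

private abbreviation (input) "WW2 \<equiv> tensor_square W"

private abbreviation (input) "I \<equiv> {..<n} \<times> {..<n}"

lemma sq_basis_closed:
  "p \<in> I \<Longrightarrow> sq_basis W b p \<in> carrier WW2"
  "p \<in> I \<Longrightarrow> sq_basis DD d p \<in> carrier DD2"
  using dual_basesD[OF db] by (auto simp: sq_basis_def sq_tensor_closed[OF W] sq_tensor_closed[OF vec_space_dual_space[OF W]])

lemma sq_pairing_basis: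
  assumes "p \<in> I" "q \<in> I"
  shows "sq_pairing W (sq_basis DD d p) (sq_basis W b q) = (if p = q then 1 else 0)"
  using assms dual_basesD[OF db] by (auto simp: sq_basis_def sq_pairing_sq[OF W] split: if_splits)

lemma sq_basis_expansion:
  assumes "y \<in> carrier WW2"
  shows "y = finsum WW2 (\<lambda>p. sq_pairing W (sq_basis DD d p) y \<odot>\<^bsub>WW2\<^esub> sq_basis W b p) I"
proof (rule coordinate_expansion[OF vec_space_tensor_square[OF W] _ _ _ _ _ assms])
  show "lin_span WW2 (sq_basis W b ` I) = carrier WW2"
    using dual_basesD[OF db] by (intro sq_basis_span[OF W]) auto
qed (simp_all only: sq_basis_closed bilin_lin_right[OF sq_pairing_bilin[OF W]] sq_pairing_basis
      finite_cartesian_product finite_lessThan)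

lemma sq_basis_dual_expansion:
  assumes "x \<in> carrier DD2"
  shows "x = finsum DD2 (\<lambda>p. sq_pairing W x (sq_basis W b p) \<odot>\<^bsub>DD2\<^esub> sq_basis DD d p) I"
proof (rule coordinate_expansion[OF vec_space_tensor_square[OF vec_space_dual_space[OF W]] _ _ _ _ _ assms])
  show "lin_span DD2 (sq_basis DD d ` I) = carrier DD2"
    using dual_basesD[OF db] dual_bases_dual_span[OF W db]
    by (intro sq_basis_span[OF vec_space_dual_space[OF W]]) auto
  show "sq_pairing W (sq_basis DD d j) (sq_basis W b i) = (if i = j then 1 else 0)"
    if "i \<in> I" "j \<in> I" for i j
    using sq_pairing_basis[OF that(2,1)] by (simp only: eq_commute)
qed (simp_all only: sq_basis_closed bilin_lin_left[OF sq_pairing_bilin[OF W]]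
      finite_cartesian_product finite_lessThan)

text \<open>
  In coordinates the transpose of \<open>S\<close> must be \<open>x \<mapsto> \<Sum>\<^sub>p \<langle>x, S B\<^sub>p\<rangle> D\<^sub>p\<close>.  It is unique because an element of
  the tensor square of the dual is determined by its pairings with the \<open>B\<^sub>p\<close>.
\<close>

lemma sq_transpose_spec:
  assumes S: "S \<in> lin_maps WW2 WW2"
  shows sq_transpose_lin_maps: "sq_transpose W S \<in> lin_maps DD2 DD2"
    and sq_transpose_pairing: "\<And>x y. x \<in> carrier DD2 \<Longrightarrow> y \<in> carrier WW2 \<Longrightarrow>
      sq_pairing W (sq_transpose W S x) y = sq_pairing W x (S y)"
proof -
  let ?P = "\<lambda>T. T \<in> lin_maps DD2 DD2 \<and>
     (\<forall>x\<in>carrier DD2. \<forall>y\<in>carrier WW2. sq_pairing W (T x) y = sq_pairing W x (S y))"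
  note VD = vec_space_dual_space[OF W]
  note V2 = vec_space_tensor_square[OF VD] and VW2 = vec_space_tensor_square[OF W]
  note pb = sq_pairing_bilin[OF W] and Sl = lin_maps_lin[OF S]
  let ?f = "\<lambda>x. finsum DD2 (\<lambda>p. sq_pairing W x (S (sq_basis W b p)) \<odot>\<^bsub>DD2\<^esub> sq_basis DD d p) I"
  have cl: "S (sq_basis W b p) \<in> carrier WW2" if "p \<in> I" for p
    by (rule lin_closed[OF Sl sq_basis_closed(1)[OF that]])
  have fl: "lin DD2 DD2 ?f"
  proof (rule lin_finsum_fun[OF V2 V2])
    show "lin DD2 DD2 (\<lambda>x. sq_pairing W x (S (sq_basis W b p)) \<odot>\<^bsub>DD2\<^esub> sq_basis DD d p)" if "p \<in> I" for p
      by (rule lin_scale_fun[OF V2 bilin_lin_left[OF pb cl[OF that]] sq_basis_closed(2)[OF that]])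
  qed simp
  have fp: "sq_pairing W (?f x) y = sq_pairing W x (S y)" if x: "x \<in> carrier DD2" and y: "y \<in> carrier WW2" for x y
  proof (rule lin_ext[OF VW2 vec_space_base_field bilin_lin_right[OF pb lin_closed[OF fl x]]
        lin_comp[OF Sl bilin_lin_right[OF pb x]], where S = "sq_basis W b ` I"])
    show "sq_basis W b ` I \<subseteq> carrier WW2"
      using sq_basis_closed(1) by auto
    show "lin_span WW2 (sq_basis W b ` I) = carrier WW2"
      using dual_basesD[OF db] by (intro sq_basis_span[OF W]) auto
    show "y \<in> carrier WW2"
      by (rule y)
    fix z assume "z \<in> sq_basis W b ` I"
    then obtain q where q: "q \<in> I" "z = sq_basis W b q"
      by auto
    note bq = sq_basis_closed(1)[OF q(1)]
    let ?c = "\<lambda>p. sq_pairing W x (S (sq_basis W b p))"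
    have "sq_pairing W (?f x) z
      = finsum base_field (\<lambda>p. sq_pairing W (?c p \<odot>\<^bsub>DD2\<^esub> sq_basis DD d p) (sq_basis W b q)) I"
      unfolding q(2)
      by (rule lin_finsum[OF V2 vec_space_base_field bilin_lin_left[OF pb bq]])
        (simp_all only: finite_cartesian_product finite_lessThan vs_smult_closed[OF V2] sq_basis_closed(2))
    also have "\<dots> = finsum base_field (\<lambda>p. ?c p * (if p = q then 1 else 0)) I"
      using bilinD(3)[OF pb _ bq] sq_basis_closed(2) sq_pairing_basis[OF _ q(1)]
      by (intro vs_finsum_cong[OF vec_space_base_field]) auto
    also have "\<dots> = ?c q * (if q = q then 1 else 0)"
      using q(1) by (intro vs_finsum_single[OF vec_space_base_field]) auto
    finally show "sq_pairing W (?f x) z = sq_pairing W x (S z)"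
      by (simp add: q(2))
  qed
  define T where "T = restrict ?f (carrier DD2)"
  have "T \<in> lin_maps DD2 DD2"
    unfolding T_def by (rule restrict_lin_maps[OF V2 fl])
  moreover have "T x = ?f x" if "x \<in> carrier DD2" for x
    using that by (simp add: T_def)
  ultimately have T: "?P T"
    using fp by simp
  have "?P (sq_transpose W S)"
    unfolding sq_transpose_def
  proof (rule theI[where P = ?P, OF T])
    fix T' assume T': "?P T'"
    show "T' = T"
    proof (rule lin_maps_eqI)
      show l: "T' \<in> lin_maps DD2 DD2" "T \<in> lin_maps DD2 DD2"
        using T T' by auto
      fix x assume x: "x \<in> carrier DD2"
      note c = lin_closed[OF lin_maps_lin[OF l(1)] x] lin_closed[OF lin_maps_lin[OF l(2)] x]
      have eq: "sq_pairing W (T' x) (sq_basis W b p) = sq_pairing W (T x) (sq_basis W b p)" if "p \<in> I" for p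
        using T T' x sq_basis_closed(1)[OF that] by simp
      have "T' x = finsum DD2 (\<lambda>p. sq_pairing W (T' x) (sq_basis W b p) \<odot>\<^bsub>DD2\<^esub> sq_basis DD d p) I"
        by (rule sq_basis_dual_expansion[OF c(1)])
      also have "\<dots> = finsum DD2 (\<lambda>p. sq_pairing W (T x) (sq_basis W b p) \<odot>\<^bsub>DD2\<^esub> sq_basis DD d p) I"
        by (rule vs_finsum_cong[OF V2 refl]) (simp_all only: eq vs_smult_closed[OF V2] sq_basis_closed(2))
      also have "\<dots> = T x"
        by (rule sq_basis_dual_expansion[OF c(2), symmetric])
      finally show "T' x = T x" .
    qed
  qed
  then show "sq_transpose W S \<in> lin_maps DD2 DD2"
    "\<And>x y. x \<in> carrier DD2 \<Longrightarrow> y \<in> carrier WW2 \<Longrightarrow>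
      sq_pairing W (sq_transpose W S x) y = sq_pairing W x (S y)"
    by auto
qed

lemma sq_transpose_basis:
  assumes S: "S \<in> lin_maps WW2 WW2" and p: "p \<in> I"
  shows "sq_transpose W S (sq_basis DD d p)
    = finsum DD2 (\<lambda>q. sq_pairing W (sq_basis DD d p) (S (sq_basis W b q)) \<odot>\<^bsub>DD2\<^esub> sq_basis DD d q) I"
proof -
  note V2 = vec_space_tensor_square[OF vec_space_dual_space[OF W]]
  note x = sq_basis_closed(2)[OF p]
  note c = lin_closed[OF lin_maps_lin[OF sq_transpose_lin_maps[OF S]] x]
  have "sq_transpose W S (sq_basis DD d p)
    = finsum DD2 (\<lambda>q. sq_pairing W (sq_transpose W S (sq_basis DD d p)) (sq_basis W b q) \<odot>\<^bsub>DD2\<^esub> sq_basis DD d q) I"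
    by (rule sq_basis_dual_expansion[OF c])
  also have "\<dots> = finsum DD2 (\<lambda>q. sq_pairing W (sq_basis DD d p) (S (sq_basis W b q)) \<odot>\<^bsub>DD2\<^esub> sq_basis DD d q) I"
    by (rule vs_finsum_cong[OF V2 refl])
      (simp_all only: sq_transpose_pairing[OF S x] vs_smult_closed[OF V2] sq_basis_closed)
  finally show ?thesis .
qed

end

text \<open>
  The product formula for the operator of the dual space, which is minus the transpose.  The vanishing
  of \<open>u(x, R y) - u(S\<^sup>* x, y)\<close> is what allows the coaction to trade \<open>R\<close> for \<open>S\<^sup>*\<close>.
\<close>

lemma EQA_coHom_spec:
  assumes \<WW>: "EQA_object (W, S)" and \<VV>: "EQA_object (V, R)"
  shows "\<exists>Q u. EQA_coHom (W, S) (V, R) = (tensor (dual_space W) V, Q) \<and>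
    Q \<in> lin_maps (tensor_square (tensor (dual_space W) V)) (tensor_square (tensor (dual_space W) V)) \<and>
    bilin (tensor_square (dual_space W)) (tensor_square V) (tensor_square (tensor (dual_space W) V)) u \<and>
    (\<forall>f\<in>carrier (dual_space W). \<forall>f'\<in>carrier (dual_space W). \<forall>v\<in>carrier V. \<forall>v'\<in>carrier V.
      u (sq_tensor (dual_space W) f f') (sq_tensor V v v')
      = sq_tensor (tensor (dual_space W) V) (pure_tensor (dual_space W) V f v) (pure_tensor (dual_space W) V f' v')) \<and>
    (\<forall>x\<in>carrier (tensor_square (dual_space W)). \<forall>y\<in>carrier (tensor_square V).
      Q (u x y) = (- 1) \<odot>\<^bsub>tensor_square (tensor (dual_space W) V)\<^esub> u (sq_transpose W S x) y
        \<oplus>\<^bsub>tensor_square (tensor (dual_space W) V)\<^esub> u x (R y))"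
proof -
  let ?D = "dual_space W" and ?D2 = "tensor_square (dual_space W)" and ?P2 = "tensor_square (tensor (dual_space W) V)"
  have W: "vec_space W" "fin_dim W" "S \<in> lin_maps (tensor_square W) (tensor_square W)"
    and V: "vec_space V" "R \<in> lin_maps (tensor_square V) (tensor_square V)"
    using \<WW> \<VV> by (simp_all add: EQA_object_def)
  note VD = vec_space_dual_space[OF W(1)]
  note V2 = vec_space_tensor_square[OF VD]
  obtain n b d where db: "dual_bases W n b d"
    using dual_bases_exist[OF W(1,2)] by blast
  note St = sq_transpose_lin_maps[OF W(1) db W(3)]
  let ?R' = "\<lambda>x\<in>carrier ?D2. \<ominus>\<^bsub>?D2\<^esub> sq_transpose W S x"
  have eq: "\<ominus>\<^bsub>?D2\<^esub> sq_transpose W S x = (- 1) \<odot>\<^bsub>?D2\<^esub> sq_transpose W S x" if "x \<in> carrier ?D2" for x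
    by (rule vs_neg[OF V2 lin_closed[OF lin_maps_lin[OF St] that]])
  have "lin ?D2 ?D2 (\<lambda>x. \<ominus>\<^bsub>?D2\<^esub> sq_transpose W S x)"
    by (rule lin_cong_imp[OF lin_scale[OF V2 lin_maps_lin[OF St], of "- 1"] V2 eq])
  then have R': "?R' \<in> lin_maps ?D2 ?D2"
    by (rule restrict_lin_maps[OF V2])
  obtain Q u where Q: "EQA_prod (?D, ?R') (V, R) = (tensor ?D V, Q)" "Q \<in> lin_maps ?P2 ?P2"
    and u: "bilin ?D2 (tensor_square V) ?P2 u"
    and usq: "\<forall>f\<in>carrier ?D. \<forall>f'\<in>carrier ?D. \<forall>v\<in>carrier V. \<forall>v'\<in>carrier V.
      u (sq_tensor ?D f f') (sq_tensor V v v')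
      = sq_tensor (tensor ?D V) (pure_tensor ?D V f v) (pure_tensor ?D V f' v')"
    and Qu: "\<forall>x\<in>carrier ?D2. \<forall>y\<in>carrier (tensor_square V). Q (u x y) = u (?R' x) y \<oplus>\<^bsub>?P2\<^esub> u x (R y)"
    using EQA_prod_spec[OF VD V(1) R' V(2)] by blast
  have "Q (u x y) = (- 1) \<odot>\<^bsub>?P2\<^esub> u (sq_transpose W S x) y \<oplus>\<^bsub>?P2\<^esub> u x (R y)"
    if x: "x \<in> carrier ?D2" and y: "y \<in> carrier (tensor_square V)" for x y
    using Qu x y eq[OF x] bilinD(3)[OF u lin_closed[OF lin_maps_lin[OF St] x] y, of "- 1"] by simp
  moreover have "EQA_coHom (W, S) (V, R) = (tensor ?D V, Q)"
    using Q(1) by (simp add: EQA_coHom_def EQA_dual_def)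
  ultimately show ?thesis
    using Q(2) u usq by blast
qed

section \<open>Quadratic algebras\<close>

lemma quadratic_algebraD:
  assumes "quadratic_algebra A"
  shows "assoc_algebra A" "gens A \<subseteq> carrier A"
  using assms lin_subspace_subset[OF alg_vec_space, of A] by (auto simp: quadratic_algebra_def)

lemma gen_space_simps:
  "carrier (gen_space A) = gens A" "x \<oplus>\<^bsub>gen_space A\<^esub> y = x \<oplus>\<^bsub>A\<^esub> y" "c \<odot>\<^bsub>gen_space A\<^esub> x = c \<odot>\<^bsub>A\<^esub> x"
  by (simp_all add: gen_space_def)

subsection \<open>Presentations\<close>

text \<open>
  Being quadratic may be checked on a surjection from the tensor algebra of an abstract finite
  dimensional space that is injective on generators: the isomorphism of this space with the space of
  generators extends to the tensor algebras and carries the quadratic relations along.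
\<close>

lemma quadratic_algebra_presented:
  fixes Y :: "('k::field, 'a) qalg" and V :: "('k, 'v, 'x) module_scheme"
  assumes Y: "assoc_algebra Y" and V: "vec_space V" "fin_dim V"
    and p: "alg_hom (tensor_algebra V) Y p" and surj: "p ` carrier (tensor_algebra V) = carrier Y"
    and gens: "gens Y = (\<lambda>v. p (tensor_incl V v)) ` carrier V"
    and inj: "inj_on (\<lambda>v. p (tensor_incl V v)) (carrier V)"
    and R: "lin_subspace (tensor_square V) R"
    and ker: "\<And>x. x \<in> carrier (tensor_algebra V) \<Longrightarrow> p x = \<zero>\<^bsub>Y\<^esub> \<longleftrightarrow> x \<in> Idl\<^bsub>tensor_algebra V\<^esub> R"
  shows "quadratic_algebra Y"
proof -
  let ?\<psi> = "\<lambda>v. p (tensor_incl V v)"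
  note VY = alg_vec_space[OF Y]
  have \<psi>: "lin V Y ?\<psi>"
    by (rule lin_comp[OF lin_tensor_incl[OF V(1)] alg_hom_lin[OF p]])
  have gs: "lin_subspace Y (gens Y)"
    unfolding gens by (rule lin_subspace_image[OF V(1) VY \<psi> lin_subspace_carrier[OF V(1)]])
  have G_simps: "carrier (gen_space Y) = gens Y" "\<And>x y. x \<oplus>\<^bsub>gen_space Y\<^esub> y = x \<oplus>\<^bsub>Y\<^esub> y"
    "\<And>c x. c \<odot>\<^bsub>gen_space Y\<^esub> x = c \<odot>\<^bsub>Y\<^esub> x"
    by (simp_all add: gen_space_def)
  define G where "G = gen_space Y"
  have G: "vec_space G"
    unfolding G_def gen_space_def by (rule vec_space_subspace[OF VY gs])
  have \<psi>G: "lin V G ?\<psi>"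
    using \<psi> unfolding lin_def G_def G_simps by (simp add: gens)
  have bij: "bij_betw ?\<psi> (carrier V) (carrier G)"
    using inj by (simp add: bij_betw_def G_def G_simps gens)
  define \<chi> where "\<chi> = the_inv_into (carrier V) ?\<psi>"
  have \<chi>: "lin G V \<chi>"
    unfolding \<chi>_def by (rule lin_the_inv_into[OF V(1) G \<psi>G bij])
  have \<chi>\<psi>: "\<chi> (?\<psi> v) = v" if "v \<in> carrier V" for v
    unfolding \<chi>_def by (rule the_inv_into_f_f[OF inj that])
  have \<psi>\<chi>: "?\<psi> (\<chi> a) = a" if "a \<in> carrier G" for a
    unfolding \<chi>_def using that by (intro f_the_inv_into_f[OF inj]) (simp add: G_def G_simps gens)
  note TV = assoc_algebra_tensor_algebra[OF V(1)] and TG = assoc_algebra_tensor_algebra[OF G]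
  let ?TV = "tensor_algebra V" and ?TG = "tensor_algebra G"
  obtain F where F: "alg_hom ?TV ?TG F" "\<And>v. v \<in> carrier V \<Longrightarrow> F (tensor_incl V v) = tensor_incl G (?\<psi> v)"
    using tensor_algebra_lift[OF V(1) TG lin_comp[OF \<psi>G lin_tensor_incl[OF G]]] by blast
  obtain K where K: "alg_hom ?TG ?TV K" "\<And>a. a \<in> carrier G \<Longrightarrow> K (tensor_incl G a) = tensor_incl V (\<chi> a)"
    using tensor_algebra_lift[OF G TV lin_comp[OF \<chi> lin_tensor_incl[OF V(1)]]] by blast
  have ident: "alg_hom A A (\<lambda>x. x)" for A :: "('k, 'c, 'z) module_scheme"
    by (simp add: alg_hom_def lin_ident)
  have KF: "K (F x) = x" if "x \<in> carrier ?TV" for x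
    by (rule tensor_algebra_ext[OF V(1) alg_hom_comp[OF F(1) K(1)] ident _ that])
      (simp add: F(2) K(2) lin_closed[OF \<psi>G] \<chi>\<psi>)
  have FK: "F (K x) = x" if "x \<in> carrier ?TG" for x
    by (rule tensor_algebra_ext[OF G alg_hom_comp[OF K(1) F(1)] ident _ that])
      (simp add: F(2) K(2) lin_closed[OF \<chi>] \<psi>\<chi>)
  have Rsub: "R \<subseteq> carrier (tensor_square V)" "R \<subseteq> carrier ?TV"
    using lin_subspace_subset[OF vec_space_tensor_square[OF V(1)] R] tensor_square_subset[OF V(1)] by auto
  have Fsq: "F x \<in> carrier (tensor_square G)" if "x \<in> carrier (tensor_square V)" for x
  proof -
    have "lin_subspace ?TV {x \<in> carrier ?TV. F x \<in> carrier (tensor_square G)}"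
      by (rule lin_subspace_vimage[OF alg_vec_space[OF TV] alg_vec_space[OF TG] alg_hom_lin[OF F(1)]
            tensor_square_subspace[OF G]])
    moreover have "{sq_tensor V v v' | v v'. v \<in> carrier V \<and> v' \<in> carrier V}
      \<subseteq> {x \<in> carrier ?TV. F x \<in> carrier (tensor_square G)}"
    proof clarify
      fix v v' assume v: "v \<in> carrier V" "v' \<in> carrier V"
      have "F (sq_tensor V v v') = sq_tensor G (?\<psi> v) (?\<psi> v')"
        using v by (simp add: sq_tensor_def alg_hom_mult[OF F(1)] tensor_incl_closed[OF V(1)] F(2))
      then show "sq_tensor V v v' \<in> carrier ?TV \<and> F (sq_tensor V v v') \<in> carrier (tensor_square G)"
        using v bilinD(1)[OF sq_tensor_bilin_algebra[OF V(1)] v]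
        by (simp add: sq_tensor_closed[OF G] lin_closed[OF \<psi>G])
    qed
    ultimately have "lin_span ?TV {sq_tensor V v v' | v v'. v \<in> carrier V \<and> v' \<in> carrier V}
      \<subseteq> {x \<in> carrier ?TV. F x \<in> carrier (tensor_square G)}"
      by (rule lin_span_least)
    then show ?thesis
      using that by (auto simp: tensor_square_def)
  qed
  have "lin (tensor_square V) (tensor_square G) F"
    using lin_tensor_square[OF V(1) alg_hom_lin[OF F(1)]] Fsq unfolding lin_def by (simp add: tensor_square_simps[OF G])
  then have FR: "lin_subspace (tensor_square G) (F ` R)"
    by (rule lin_subspace_image[OF vec_space_tensor_square[OF V(1)] vec_space_tensor_square[OF G] _ R])
  have FRsub: "F ` R \<subseteq> carrier ?TG"
    using Rsub alg_hom_closed[OF F(1)] by auto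
  define \<pi> where "\<pi> = restrict (\<lambda>x. p (K x)) (carrier ?TG)"
  have pK: "alg_hom ?TG Y (\<lambda>x. p (K x))"
    by (rule alg_hom_comp[OF K(1) p])
  have \<pi>: "alg_hom ?TG Y \<pi>"
    unfolding \<pi>_def by (simp add: TG pK)
  have "a_kernel ?TG Y \<pi> = {x \<in> carrier ?TG. p (K x) = \<zero>\<^bsub>Y\<^esub>}"
    by (auto simp: a_kernel_def' \<pi>_def)
  also have "\<dots> = Idl\<^bsub>?TG\<^esub> (F ` R)"
  proof
    have "ideal {x \<in> carrier ?TV. F x \<in> Idl\<^bsub>?TG\<^esub> (F ` R)} ?TV"
      by (rule alg_hom_preimage_ideal[OF TV TG F(1) Idl_ideal[OF TG FRsub]])
    then have "Idl\<^bsub>?TV\<^esub> R \<subseteq> {x \<in> carrier ?TV. F x \<in> Idl\<^bsub>?TG\<^esub> (F ` R)}"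
      using Rsub Idl_superset[OF TG, of "F ` R"] by (intro Idl_least[OF TV]) auto
    then show "{x \<in> carrier ?TG. p (K x) = \<zero>\<^bsub>Y\<^esub>} \<subseteq> Idl\<^bsub>?TG\<^esub> (F ` R)"
      using ker alg_hom_closed[OF K(1)] FK by fastforce
    have 0: "p r = \<zero>\<^bsub>Y\<^esub>" if "r \<in> R" for r
      using ker that Rsub Idl_superset[OF TV, of R] by auto
    show "Idl\<^bsub>?TG\<^esub> (F ` R) \<subseteq> {x \<in> carrier ?TG. p (K x) = \<zero>\<^bsub>Y\<^esub>}"
      using 0 KF Rsub FRsub by (intro Idl_least[OF TG] alg_hom_kernel_ideal[OF TG Y pK]) auto
  qed
  finally have ker\<pi>: "a_kernel ?TG Y \<pi> = Idl\<^bsub>?TG\<^esub> (F ` R)" .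
  have \<pi>incl: "\<pi> (tensor_incl G a) = a" if "a \<in> gens Y" for a
  proof -
    have a: "a \<in> carrier G"
      using that by (simp add: G_def G_simps)
    then show ?thesis
      using tensor_incl_closed[OF G a] by (simp add: \<pi>_def K(2) \<psi>\<chi>)
  qed
  have fd: "fin_dim G"
  proof -
    obtain B where B: "finite B" "B \<subseteq> carrier V" "lin_span V B = carrier V"
      using V(2) by (auto simp: fin_dim_def)
    have "carrier G = ?\<psi> ` lin_span V B"
      using B(3) by (simp add: G_def G_simps gens)
    then have "lin_span G (?\<psi> ` B) = carrier G"
      using lin_span_image[OF V(1) G \<psi>G B(2)] by simp
    moreover have "finite (?\<psi> ` B)" "?\<psi> ` B \<subseteq> carrier G"
      using B lin_closed[OF \<psi>G] by auto
    ultimately show ?thesis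
      unfolding fin_dim_def by blast
  qed
  have gensY: "gens Y \<subseteq> carrier Y"
    by (rule lin_subspace_subset[OF VY gs])
  have "subalgebra_gen Y (gens Y) = carrier Y"
  proof
    show "subalgebra_gen Y (gens Y) \<subseteq> carrier Y"
      by (rule lin_subspace_subset[OF VY subalgebra_gen_subalgebra(1)[OF Y gensY]])
    show "carrier Y \<subseteq> subalgebra_gen Y (gens Y)"
      unfolding surj[symmetric]
      using tensor_algebra_generated[OF V(1) Y p _ gensY] gens by blast
  qed
  moreover have "\<exists>\<pi>\<in>ring_hom ?TG Y \<inter> lin_maps ?TG Y. (\<forall>a\<in>gens Y. \<pi> (tensor_incl G a) = a) \<and>
    (\<exists>R. lin_subspace (tensor_square G) R \<and> a_kernel ?TG Y \<pi> = Idl\<^bsub>?TG\<^esub> R)"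
  proof (rule bexI[of _ \<pi>])
    show "\<pi> \<in> ring_hom ?TG Y \<inter> lin_maps ?TG Y"
      using \<pi> ring_hom_lin_maps_iff[of \<pi> ?TG Y] by (simp add: \<pi>_def)
  qed (use FR ker\<pi> \<pi>incl in blast)
  ultimately show ?thesis
    unfolding quadratic_algebra_def G_def[symmetric] using Y gs fd by blast
qed

subsection \<open>The functor \<open>U\<close>\<close>

definition U_proj ::
  "('k::field, 'v) module \<Rightarrow> (('v list \<Rightarrow>\<^sub>0 'k) set \<Rightarrow> ('v list \<Rightarrow>\<^sub>0 'k) set)
    \<Rightarrow> ('v list \<Rightarrow>\<^sub>0 'k) set \<Rightarrow> ('v list \<Rightarrow>\<^sub>0 'k) set set" where
  "U_proj V R x = Idl\<^bsub>tensor_algebra V\<^esub> (R ` carrier (tensor_square V)) +>\<^bsub>tensor_algebra V\<^esub> x"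

context
  fixes V :: "('k::field, 'v) module" and R
  assumes V: "vec_space V" and R: "R \<in> lin_maps (tensor_square V) (tensor_square V)"
begin

private abbreviation (input) "T \<equiv> tensor_algebra V"

private abbreviation (input) "RI \<equiv> Idl\<^bsub>tensor_algebra V\<^esub> (R ` carrier (tensor_square V))"

private abbreviation (input) "A \<equiv> U_obj (V, R)"

lemma U_image_subspace: "lin_subspace (tensor_square V) (R ` carrier (tensor_square V))"
  by (rule lin_subspace_image[OF _ _ lin_maps_lin[OF R] lin_subspace_carrier])
    (simp_all add: vec_space_tensor_square[OF V])

lemma U_image_subset: "R ` carrier (tensor_square V) \<subseteq> carrier (tensor_square V)"
  by (rule lin_subspace_subset[OF vec_space_tensor_square[OF V] U_image_subspace])

lemma U_ideal: "ideal RI T"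
  using U_image_subset tensor_square_subset[OF V] by (intro Idl_ideal[OF assoc_algebra_tensor_algebra[OF V]]) auto

lemma U_obj_simps:
  "carrier A = carrier (quot_algebra T RI)" "monoid.mult A = monoid.mult (quot_algebra T RI)"
  "one A = one (quot_algebra T RI)" "ring.zero A = ring.zero (quot_algebra T RI)"
  "add A = add (quot_algebra T RI)" "smult A = smult (quot_algebra T RI)"
  "gens A = (\<lambda>v. U_proj V R (tensor_incl V v)) ` carrier V"
  by (auto simp: U_obj_def Let_def U_proj_def)

lemma U_carrier: "carrier A = U_proj V R ` carrier T"
  unfolding U_obj_simps U_proj_def
  by (rule quot_carrier[OF vec_space_tensor_algebra[OF V] ideal_subspace[OF assoc_algebra_tensor_algebra[OF V] U_ideal]])

lemma alg_hom_U_proj: "alg_hom T A (U_proj V R)"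
  using alg_hom_quot_proj[OF assoc_algebra_tensor_algebra[OF V] U_ideal]
  by (simp add: alg_hom_def lin_def U_obj_simps U_proj_def)

lemma assoc_algebra_U: "assoc_algebra A"
  using assoc_algebra_quot[OF assoc_algebra_tensor_algebra[OF V] U_ideal]
  by (rule assoc_algebra_image[where f = "\<lambda>x. x"]) (simp_all add: U_obj_simps)

lemma U_proj_eq_zero_iff: "x \<in> carrier T \<Longrightarrow> U_proj V R x = \<zero>\<^bsub>A\<^esub> \<longleftrightarrow> x \<in> RI"
  unfolding U_obj_simps U_proj_def
  by (rule quot_proj_eq_zero_iff[OF vec_space_tensor_algebra[OF V] ideal_subspace[OF assoc_algebra_tensor_algebra[OF V] U_ideal]])

lemma U_proj_rel: "y \<in> carrier (tensor_square V) \<Longrightarrow> U_proj V R (R y) = \<zero>\<^bsub>A\<^esub>"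
  using Idl_superset[OF assoc_algebra_tensor_algebra[OF V], of "R ` carrier (tensor_square V)"]
    U_image_subset tensor_square_subset[OF V] by (subst U_proj_eq_zero_iff) auto

lemma U_lift:
  assumes B: "assoc_algebra B" and f: "alg_hom T B f"
    and rel: "\<And>y. y \<in> carrier (tensor_square V) \<Longrightarrow> f (R y) = \<zero>\<^bsub>B\<^esub>"
  shows "\<exists>g\<in>extensional (carrier A). alg_hom A B g \<and> (\<forall>x\<in>carrier T. g (U_proj V R x) = f x)"
proof -
  have "f x = \<zero>\<^bsub>B\<^esub>" if "x \<in> RI" for x
    using rel U_image_subset tensor_square_subset[OF V]
    by (intro alg_hom_zero_on_Idl[OF assoc_algebra_tensor_algebra[OF V] B f _ _ that]) auto
  from quot_lift_alg_hom[OF assoc_algebra_tensor_algebra[OF V] U_ideal B f this]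
  show ?thesis
    by (simp add: alg_hom_def lin_def U_obj_simps U_proj_def)
qed

lemma U_degree_one:
  "\<exists>\<pi>. lin A V \<pi> \<and> (\<forall>v\<in>carrier V. \<pi> (U_proj V R (tensor_incl V v)) = v)"
  using quadratic_quotient_degree_one[OF V U_image_subset]
  by (simp add: lin_def U_obj_simps U_proj_def)

lemma U_proj_incl_inj: "inj_on (\<lambda>v. U_proj V R (tensor_incl V v)) (carrier V)"
  using U_degree_one by (auto intro: inj_on_inverseI)

end

lemma U_gen_space:
  fixes W :: "('k::field, 'w) module"
  assumes W: "vec_space W" and S: "S \<in> lin_maps (tensor_square W) (tensor_square W)"
  shows vec_space_U_gen_space: "vec_space (gen_space (U_obj (W, S)))"
    and lin_U_gen_space: "lin W (gen_space (U_obj (W, S))) (\<lambda>w. U_proj W S (tensor_incl W w))"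
    and U_gens_subset: "gens (U_obj (W, S)) \<subseteq> carrier (U_obj (W, S))"
proof -
  let ?B = "U_obj (W, S)"
  note VB = alg_vec_space[OF assoc_algebra_U[OF W S]]
  have l: "lin W ?B (\<lambda>w. U_proj W S (tensor_incl W w))"
    by (rule lin_comp[OF lin_tensor_incl[OF W] alg_hom_lin[OF alg_hom_U_proj[OF W S]]])
  have s: "lin_subspace ?B (gens ?B)"
    unfolding U_obj_simps(7)[OF W S] by (rule lin_subspace_image[OF W VB l lin_subspace_carrier[OF W]])
  show "vec_space (gen_space ?B)"
    unfolding gen_space_def by (rule vec_space_subspace[OF VB s])
  show "lin W (gen_space ?B) (\<lambda>w. U_proj W S (tensor_incl W w))"
    using l by (simp add: lin_def gen_space_simps U_obj_simps(7)[OF W S])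
  show "gens ?B \<subseteq> carrier ?B"
    by (rule lin_subspace_subset[OF VB s])
qed

text \<open>
  Serves both for \<open>U(M, Q)\<close> itself and for its copy inside \<open>nat \<Rightarrow> 'k\<close>.
\<close>

lemma quadratic_algebra_U_image:
  fixes M :: "('k::field, 'm) module" and Y :: "('k, 'y) qalg"
  assumes M: "vec_space M" "fin_dim M" and Q: "Q \<in> lin_maps (tensor_square M) (tensor_square M)"
    and Y: "assoc_algebra Y" and f: "alg_hom (U_obj (M, Q)) Y f" and bij: "bij_betw f (carrier (U_obj (M, Q))) (carrier Y)"
    and gens: "gens Y = f ` gens (U_obj (M, Q))"
  shows "quadratic_algebra Y"
proof -
  note E = assoc_algebra_U[OF M(1) Q] and iE = alg_hom_U_proj[OF M(1) Q]
  have inj: "inj_on f (carrier (U_obj (M, Q)))"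
    using bij by (simp add: bij_betw_def)
  have f0: "f \<zero>\<^bsub>U_obj (M, Q)\<^esub> = \<zero>\<^bsub>Y\<^esub>"
    by (rule lin_zero[OF alg_vec_space[OF E] alg_vec_space[OF Y] alg_hom_lin[OF f]])
  show ?thesis
  proof (rule quadratic_algebra_presented[OF Y M alg_hom_comp[OF iE f]])
    show "(\<lambda>x. f (U_proj M Q x)) ` carrier (tensor_algebra M) = carrier Y"
      using bij U_carrier[OF M(1) Q] by (simp add: bij_betw_def image_image)
    show "gens Y = (\<lambda>v. f (U_proj M Q (tensor_incl M v))) ` carrier M"
      by (simp add: gens U_obj_simps(7)[OF M(1) Q] image_image)
    have "inj_on (f \<circ> (\<lambda>v. U_proj M Q (tensor_incl M v))) (carrier M)"
    proof (rule comp_inj_on[OF U_proj_incl_inj[OF M(1) Q]])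
      show "inj_on f ((\<lambda>v. U_proj M Q (tensor_incl M v)) ` carrier M)"
        using inj_on_subset[OF inj U_gens_subset[OF M(1) Q]] by (simp add: U_obj_simps(7)[OF M(1) Q])
    qed
    then show "inj_on (\<lambda>v. f (U_proj M Q (tensor_incl M v))) (carrier M)"
      by (simp add: comp_def)
    show "lin_subspace (tensor_square M) (Q ` carrier (tensor_square M))"
      by (rule U_image_subspace[OF M(1) Q])
    fix x assume x: "x \<in> carrier (tensor_algebra M)"
    have "f (U_proj M Q x) = \<zero>\<^bsub>Y\<^esub> \<longleftrightarrow> f (U_proj M Q x) = f \<zero>\<^bsub>U_obj (M, Q)\<^esub>"
      by (simp add: f0)
    also have "\<dots> \<longleftrightarrow> U_proj M Q x = \<zero>\<^bsub>U_obj (M, Q)\<^esub>"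
      by (rule inj_on_eq_iff[OF inj alg_hom_closed[OF iE x] vs_zero_closed[OF alg_vec_space[OF E]]])
    also have "\<dots> \<longleftrightarrow> x \<in> Idl\<^bsub>tensor_algebra M\<^esub> (Q ` carrier (tensor_square M))"
      by (rule U_proj_eq_zero_iff[OF M(1) Q x])
    finally show "f (U_proj M Q x) = \<zero>\<^bsub>Y\<^esub> \<longleftrightarrow> x \<in> Idl\<^bsub>tensor_algebra M\<^esub> (Q ` carrier (tensor_square M))" .
  qed
qed

subsection \<open>Isomorphic copies\<close>

definition transport :: "('a \<Rightarrow> 'b) \<Rightarrow> ('k::field, 'a) qalg \<Rightarrow> ('k, 'b) qalg" where
  "transport J A = (let K = the_inv_into (carrier A) J in
     \<lparr>carrier = J ` carrier A, monoid.mult = (\<lambda>x y. J (K x \<otimes>\<^bsub>A\<^esub> K y)), one = J \<one>\<^bsub>A\<^esub>,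
      ring.zero = J \<zero>\<^bsub>A\<^esub>, add = (\<lambda>x y. J (K x \<oplus>\<^bsub>A\<^esub> K y)), smult = (\<lambda>c x. J (c \<odot>\<^bsub>A\<^esub> K x)),
      gens = J ` gens A\<rparr>)"

context
  fixes A :: "('k::field, 'a) qalg" and J :: "'a \<Rightarrow> 'b"
  assumes A: "assoc_algebra A" and J: "inj_on J (carrier A)"
begin

lemma transport_simps:
  "carrier (transport J A) = J ` carrier A" "\<one>\<^bsub>transport J A\<^esub> = J \<one>\<^bsub>A\<^esub>" "\<zero>\<^bsub>transport J A\<^esub> = J \<zero>\<^bsub>A\<^esub>"
  "gens (transport J A) = J ` gens A"
  "x \<in> carrier A \<Longrightarrow> y \<in> carrier A \<Longrightarrow> J x \<otimes>\<^bsub>transport J A\<^esub> J y = J (x \<otimes>\<^bsub>A\<^esub> y)"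
  "x \<in> carrier A \<Longrightarrow> y \<in> carrier A \<Longrightarrow> J x \<oplus>\<^bsub>transport J A\<^esub> J y = J (x \<oplus>\<^bsub>A\<^esub> y)"
  "x \<in> carrier A \<Longrightarrow> c \<odot>\<^bsub>transport J A\<^esub> J x = J (c \<odot>\<^bsub>A\<^esub> x)"
  by (simp_all add: transport_def Let_def the_inv_into_f_f[OF J])

lemma assoc_algebra_transport: "assoc_algebra (transport J A)"
  by (rule assoc_algebra_image[OF A, where f = J]) (simp_all add: transport_simps)

lemma alg_hom_transport: "alg_hom A (transport J A) J"
  by (simp add: alg_hom_def lin_def transport_simps)

lemma alg_hom_transport_inv: "alg_hom (transport J A) A (the_inv_into (carrier A) J)"
  using A by (auto simp: alg_hom_def lin_def transport_simps the_inv_into_f_f[OF J]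
      bilinD(1)[OF alg_mult_bilin[OF A]])

end

text \<open>
  The words in a finite spanning set of \<open>V\<close> form a countable set that is closed under multiplication,
  so its span is a subalgebra; it contains \<open>V\<close> and hence is everything.
\<close>

lemma tensor_algebra_countable_span:
  assumes V: "vec_space V" and fd: "fin_dim V"
  shows "\<exists>e :: nat \<Rightarrow> _. range e \<subseteq> carrier (tensor_algebra V) \<and>
    lin_span (tensor_algebra V) (range e) = carrier (tensor_algebra V)"
proof -
  let ?T = "tensor_algebra V"
  note T = assoc_algebra_tensor_algebra[OF V]
  note VT = alg_vec_space[OF T] and mb = alg_mult_bilin[OF T]
  obtain B where B: "finite B" "B \<subseteq> carrier V" "lin_span V B = carrier V"
    using fd by (auto simp: fin_dim_def)
  let ?w = "\<lambda>w. foldr (\<lambda>v b. tensor_incl V v \<otimes>\<^bsub>?T\<^esub> b) w \<one>\<^bsub>?T\<^esub>"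
  define C where "C = ?w ` lists B"
  have cl: "?w x \<in> carrier ?T" if "x \<in> lists B" for x
    using that by (induction x) (use B T tensor_incl_closed[OF V] in auto)
  have C: "C \<subseteq> carrier ?T"
    using cl by (auto simp: C_def)
  have ap: "?w x \<otimes>\<^bsub>?T\<^esub> ?w y = ?w (x @ y)" if x: "x \<in> lists B" and y: "y \<in> lists B" for x y
    using x
  proof (induction x)
    case Nil
    then show ?case
      using T cl[OF y] by simp
  next
    case (Cons v x)
    then have "tensor_incl V v \<in> carrier ?T"
      using B tensor_incl_closed[OF V] by auto
    then show ?case
      using Cons T cl[OF y] cl[of x] by (simp add: alg_mult_assoc[OF T] del: foldr_append)
  qed
  have CC: "x \<otimes>\<^bsub>?T\<^esub> y \<in> C" if "x \<in> C" "y \<in> C" for x y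
  proof -
    obtain a b where ab: "a \<in> lists B" "b \<in> lists B" "x = ?w a" "y = ?w b"
      using \<open>x \<in> C\<close> \<open>y \<in> C\<close> unfolding C_def by blast
    then have "x \<otimes>\<^bsub>?T\<^esub> y = ?w (a @ b)" "a @ b \<in> lists B"
      using ap by auto
    then show ?thesis
      unfolding C_def by blast
  qed
  note N = lin_span_subspace[OF VT C]
  note N' = lin_subspaceD[OF VT N] and sup = lin_span_superset[of C ?T]
  have 1: "x \<otimes>\<^bsub>?T\<^esub> y \<in> lin_span ?T C" if x: "x \<in> C" and y: "y \<in> lin_span ?T C" for x y
  proof -
    have "x \<in> carrier ?T"
      using x C by auto
    then have "lin_subspace ?T {y \<in> carrier ?T. x \<otimes>\<^bsub>?T\<^esub> y \<in> lin_span ?T C}"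
      by (intro lin_subspace_vimage[OF VT VT bilin_lin_right[OF mb] N])
    moreover have "C \<subseteq> {y \<in> carrier ?T. x \<otimes>\<^bsub>?T\<^esub> y \<in> lin_span ?T C}"
      using x CC C sup by auto
    ultimately show ?thesis
      using lin_span_least y by blast
  qed
  have 2: "x \<otimes>\<^bsub>?T\<^esub> y \<in> lin_span ?T C" if x: "x \<in> lin_span ?T C" and y: "y \<in> lin_span ?T C" for x y
  proof -
    have "y \<in> carrier ?T"
      using y N' by auto
    then have "lin_subspace ?T {x \<in> carrier ?T. x \<otimes>\<^bsub>?T\<^esub> y \<in> lin_span ?T C}"
      by (intro lin_subspace_vimage[OF VT VT bilin_lin_left[OF mb] N])
    moreover have "C \<subseteq> {x \<in> carrier ?T. x \<otimes>\<^bsub>?T\<^esub> y \<in> lin_span ?T C}"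
      using y 1 C by auto
    ultimately show ?thesis
      using lin_span_least x by blast
  qed
  have "?w [] \<in> C"
    unfolding C_def by blast
  then have one: "\<one>\<^bsub>?T\<^esub> \<in> C"
    by simp
  have incl: "tensor_incl V v \<in> lin_span ?T C" if v: "v \<in> carrier V" for v
  proof -
    have "lin_subspace V {v \<in> carrier V. tensor_incl V v \<in> lin_span ?T C}"
      by (rule lin_subspace_vimage[OF V VT lin_tensor_incl[OF V] N])
    moreover have "B \<subseteq> {v \<in> carrier V. tensor_incl V v \<in> lin_span ?T C}"
    proof
      fix v assume v: "v \<in> B"
      then have vV: "v \<in> carrier V"
        using B by auto
      have "?w [v] \<in> C"
        unfolding C_def by (rule imageI) (simp add: v)
      then have "tensor_incl V v \<in> C"
        using T tensor_incl_closed[OF V vV] by simp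
      then show "v \<in> {v \<in> carrier V. tensor_incl V v \<in> lin_span ?T C}"
        using vV sup by auto
    qed
    ultimately have "lin_span V B \<subseteq> {v \<in> carrier V. tensor_incl V v \<in> lin_span ?T C}"
      by (rule lin_span_least)
    then show ?thesis
      using v B by auto
  qed
  have "x \<in> lin_span ?T C" if "x \<in> carrier ?T" for x
    by (rule tensor_algebra_induct[OF V that]) (use one sup incl N' 2 in auto)
  then have span: "lin_span ?T C = carrier ?T"
    using N' by auto
  have "countable C"
    unfolding C_def using B by (intro countable_image countable_lists countable_finite)
  then have "range (from_nat_into C) = C"
    using one by (intro range_from_nat_into) auto
  then show ?thesis
    using C span by metis
qed

text \<open>
  A chosen expression of each element in terms of a spanning sequence determines the element, so
  these finitely supported coefficient sequences form a copy of the carrier inside \<open>nat \<Rightarrow> 'k\<close>.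
\<close>

lemma countable_span_injection:
  fixes E :: "('k::field, 'a, 'x) module_scheme" and e :: "nat \<Rightarrow> 'a"
  assumes E: "vec_space E" and e: "range e \<subseteq> carrier E" "lin_span E (range e) = carrier E"
  shows "\<exists>J :: 'a \<Rightarrow> nat \<Rightarrow> 'k. inj_on J (carrier E)"
proof -
  let ?G = "\<lparr>carrier = UNIV, monoid.mult = \<lambda>x y. x, one = 0\<rparr> :: nat monoid"
  let ?F = "monoid_algebra ?G :: ('k, nat \<Rightarrow>\<^sub>0 'k) module"
  have eE: "e i \<in> carrier E" for i
    using e by auto
  have l: "lin ?F E (free_lift E e)"
    by (rule lin_free_lift[OF E]) (rule eE)
  have "range e \<subseteq> free_lift E e ` carrier ?F"
  proof
    fix x assume "x \<in> range e"
    then obtain i where "x = e i"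
      by auto
    then have "x = free_lift E e (Poly_Mapping.single i 1)"
      using E eE by (simp add: free_lift_single)
    then show "x \<in> free_lift E e ` carrier ?F"
      by auto
  qed
  then have "carrier E \<subseteq> free_lift E e ` carrier ?F"
    using lin_span_least[OF lin_subspace_image[OF vec_space_monoid_algebra E l
          lin_subspace_carrier[OF vec_space_monoid_algebra]]] e(2) by metis
  then have ex: "\<exists>q. x = free_lift E e q" if "x \<in> carrier E" for x
    using that by blast
  define c where "c x = (SOME q. x = free_lift E e q)" for x
  have c: "x = free_lift E e (c x)" if "x \<in> carrier E" for x
    unfolding c_def using someI_ex[OF ex[OF that]] .
  have "inj_on (\<lambda>x. Poly_Mapping.lookup (c x)) (carrier E)"
  proof (rule inj_onI)
    fix x y assume "x \<in> carrier E" "y \<in> carrier E" "Poly_Mapping.lookup (c x) = Poly_Mapping.lookup (c y)"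
    then show "x = y"
      using c[of x] c[of y] by (simp add: Poly_Mapping.lookup_inject)
  qed
  then show ?thesis
    by blast
qed

section \<open>The coaction\<close>

definition QA_prod_gens ::
  "('k::field, 'a) qalg \<Rightarrow> ('k, 'b) qalg \<Rightarrow> ('a \<times> 'b \<Rightarrow>\<^sub>0 'k) set set" where
  "QA_prod_gens A B = lin_span (tensor A B) {pure_tensor A B a b | a b. a \<in> gens A \<and> b \<in> gens B}"

lemma QA_prod_simps:
  "carrier (QA_prod A B) = subalgebra_gen (tensor A B) (QA_prod_gens A B)"
  "monoid.mult (QA_prod A B) = monoid.mult (tensor A B)" "one (QA_prod A B) = one (tensor A B)"
  "ring.zero (QA_prod A B) = ring.zero (tensor A B)" "add (QA_prod A B) = add (tensor A B)"
  "smult (QA_prod A B) = smult (tensor A B)" "gens (QA_prod A B) = QA_prod_gens A B"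
  by (simp_all add: QA_prod_def Let_def QA_prod_gens_def)

context
  fixes A :: "('k::field, 'a) qalg" and B :: "('k, 'b) qalg"
  assumes A: "assoc_algebra A" and B: "assoc_algebra B" and gA: "gens A \<subseteq> carrier A" and gB: "gens B \<subseteq> carrier B"
begin

lemma QA_prod_gens_subspace: "lin_subspace (tensor A B) (QA_prod_gens A B)"
  unfolding QA_prod_gens_def using gA gB pure_tensor_closed[OF alg_vec_space[OF A] alg_vec_space[OF B]]
  by (intro lin_span_subspace vec_space_tensor alg_vec_space A B) blast

lemma QA_prod_gens_subset: "QA_prod_gens A B \<subseteq> carrier (tensor A B)"
  by (rule lin_subspace_subset[OF vec_space_tensor[OF alg_vec_space[OF A] alg_vec_space[OF B]] QA_prod_gens_subspace])

lemma QA_prod_subspace: "lin_subspace (tensor A B) (carrier (QA_prod A B))"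
  unfolding QA_prod_simps by (rule subalgebra_gen_subalgebra(1)[OF assoc_algebra_tensor[OF A B] QA_prod_gens_subset])

lemma QA_prod_subset: "carrier (QA_prod A B) \<subseteq> carrier (tensor A B)"
  by (rule lin_subspace_subset[OF vec_space_tensor[OF alg_vec_space[OF A] alg_vec_space[OF B]] QA_prod_subspace])

lemma vec_space_QA_prod: "vec_space (QA_prod A B)"
  using vec_space_subspace[OF vec_space_tensor[OF alg_vec_space[OF A] alg_vec_space[OF B]] QA_prod_subspace]
  by (rule vec_space_image[where f = "\<lambda>x. x"]) (simp_all add: QA_prod_simps)

lemma pure_tensor_QA_prod:
  assumes "a \<in> gens A" "b \<in> gens B"
  shows "pure_tensor A B a b \<in> QA_prod_gens A B" "pure_tensor A B a b \<in> carrier (QA_prod A B)"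
proof -
  show 1: "pure_tensor A B a b \<in> QA_prod_gens A B"
    unfolding QA_prod_gens_def
    using assms lin_span_superset[of "{pure_tensor A B a b | a b. a \<in> gens A \<and> b \<in> gens B}" "tensor A B"] by blast
  show "pure_tensor A B a b \<in> carrier (QA_prod A B)"
    unfolding QA_prod_simps by (rule subsetD[OF subalgebra_gen_superset 1])
qed

lemma finsum_QA_prod:
  assumes "finite I" "\<And>i. i \<in> I \<Longrightarrow> f i \<in> carrier (QA_prod A B)"
  shows "finsum (QA_prod A B) f I = finsum (tensor A B) f I"
  using assms QA_prod_subset
  by (intro finsum_same[OF vec_space_tensor[OF alg_vec_space[OF A] alg_vec_space[OF B]] vec_space_QA_prod])
    (auto simp: QA_prod_simps)

end

text \<open>
  The coaction \<open>v \<mapsto> \<Sum>\<^sub>j (d\<^sub>j \<otimes> v) \<otimes> b\<^sub>j\<close>.  Write \<open>\<mu>(x, t)\<close> for the image in \<open>Y\<close> of \<open>x \<otimes> t\<close>, unshuffled.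
  In degree two the coaction sends \<open>t\<close> to \<open>\<Sum>\<^sub>q \<mu>(D\<^sub>q, t) \<otimes> B\<^sub>q\<close> for the dual bases \<open>B\<close>, \<open>D\<close> of the tensor
  squares.  Since \<open>\<mu>(x, R t) = \<mu>(S\<^sup>* x, t)\<close>, the sum for \<open>R t\<close> equals \<open>\<Sum>\<^sub>q \<mu>(D\<^sub>q, t) \<otimes> S B\<^sub>q\<close>, which
  vanishes as \<open>S B\<^sub>q = 0\<close> in \<open>U(W, S)\<close>.
\<close>

lemma coaction_exists:
  fixes W :: "('k::field, 'w) module" and V :: "('k, 'v) module" and Y :: "('k, 'y) qalg"
  assumes \<WW>: "EQA_object (W, S)" and \<VV>: "EQA_object (V, R)" and db: "dual_bases W n b d"
    and Y: "assoc_algebra Y" and p: "alg_hom (tensor_algebra (tensor (dual_space W) V)) Y p"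
    and gensY: "gens Y = (\<lambda>z. p (tensor_incl (tensor (dual_space W) V) z)) ` carrier (tensor (dual_space W) V)"
    and rel: "\<And>z. z \<in> carrier (tensor_square (tensor (dual_space W) V)) \<Longrightarrow>
      p (snd (EQA_coHom (W, S) (V, R)) z) = \<zero>\<^bsub>Y\<^esub>"
  shows "\<exists>\<phi>\<in>QA_hom (U_obj (V, R)) (QA_prod Y (U_obj (W, S))). \<forall>v\<in>carrier V.
    \<phi> (U_proj V R (tensor_incl V v)) = finsum (tensor Y (U_obj (W, S)))
      (\<lambda>j. pure_tensor Y (U_obj (W, S))
        (p (tensor_incl (tensor (dual_space W) V) (pure_tensor (dual_space W) V (d j) v)))
        (U_proj W S (tensor_incl W (b j)))) {..<n}"
proof -
  let ?D = "dual_space W" and ?D2 = "tensor_square (dual_space W)" and ?W2 = "tensor_square W"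
  let ?V2 = "tensor_square V" and ?M = "tensor (dual_space W) V" and ?P2 = "tensor_square (tensor (dual_space W) V)"
  let ?B = "U_obj (W, S)" and ?A = "U_obj (V, R)" and ?I = "{..<n} \<times> {..<n}"
  let ?BB = "sq_basis W b" and ?DD = "sq_basis (dual_space W) d"
  define Z where "Z = tensor Y (U_obj (W, S))"
  have W: "vec_space W" and S: "S \<in> lin_maps ?W2 ?W2" and V: "vec_space V" and R: "R \<in> lin_maps ?V2 ?V2"
    using \<WW> \<VV> by (simp_all add: EQA_object_def)
  note D = vec_space_dual_space[OF W]
  note M = vec_space_tensor[OF D V]
  note V2 = vec_space_tensor_square[OF V] and W2 = vec_space_tensor_square[OF W]
    and D2 = vec_space_tensor_square[OF D] and P2 = vec_space_tensor_square[OF M]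
  note B = assoc_algebra_U[OF W S] and A = assoc_algebra_U[OF V R]
  note VY = alg_vec_space[OF Y] and VB = alg_vec_space[OF B]
  have Z: "assoc_algebra Z"
    unfolding Z_def by (rule assoc_algebra_tensor[OF Y B])
  note VZ = alg_vec_space[OF Z] and mZ = alg_mult_bilin[OF Z]
  have pt: "bilin Y ?B Z (pure_tensor Y ?B)"
    unfolding Z_def by (rule pure_tensor_bilin[OF VY VB])
  note dbD = dual_basesD[OF db] and bc = sq_basis_closed[OF W db]
  note iW = alg_hom_U_proj[OF W S]
  note TW = assoc_algebra_tensor_algebra[OF W] and TV = assoc_algebra_tensor_algebra[OF V]
  obtain Q u where Qu: "EQA_coHom (W, S) (V, R) = (?M, Q)" and u: "bilin ?D2 ?V2 ?P2 u"
    and usq: "\<And>f f' v v'. f \<in> carrier ?D \<Longrightarrow> f' \<in> carrier ?D \<Longrightarrow> v \<in> carrier V \<Longrightarrow> v' \<in> carrier V \<Longrightarrow>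
      u (sq_tensor ?D f f') (sq_tensor V v v') = sq_tensor ?M (pure_tensor ?D V f v) (pure_tensor ?D V f' v')"
    and Q: "\<And>x t. x \<in> carrier ?D2 \<Longrightarrow> t \<in> carrier ?V2 \<Longrightarrow>
      Q (u x t) = (- 1) \<odot>\<^bsub>?P2\<^esub> u (sq_transpose W S x) t \<oplus>\<^bsub>?P2\<^esub> u x (R t)"
    using EQA_coHom_spec[OF \<WW> \<VV>] by blast

  define \<psi> where "\<psi> = (\<lambda>f v. p (tensor_incl ?M (pure_tensor ?D V f v)))"
  have \<psi>: "bilin ?D V Y \<psi>"
    unfolding \<psi>_def
    by (rule bilin_comp[OF pure_tensor_bilin[OF D V] lin_ident lin_ident
          lin_comp[OF lin_tensor_incl[OF M] alg_hom_lin[OF p]]])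
  define \<beta> where "\<beta> = (\<lambda>w. U_proj W S (tensor_incl W w))"
  have \<beta>: "lin W ?B \<beta>"
    unfolding \<beta>_def by (rule lin_comp[OF lin_tensor_incl[OF W] alg_hom_lin[OF iW]])
  define c where "c = (\<lambda>v. finsum Z (\<lambda>j. pure_tensor Y ?B (\<psi> (d j) v) (\<beta> (b j))) {..<n})"
  have summand: "lin V Z (\<lambda>v. pure_tensor Y ?B (\<psi> (d j) v) (\<beta> (b j)))" if "j < n" for j
    by (rule lin_comp[OF bilin_lin_right[OF \<psi> dbD(2)[OF that]] bilin_lin_left[OF pt lin_closed[OF \<beta> dbD(1)[OF that]]]])
  have c: "lin V Z c"
    unfolding c_def by (rule lin_finsum_fun[OF V VZ]) (simp_all add: summand)
  obtain \<Phi> where \<Phi>: "alg_hom (tensor_algebra V) Z \<Phi>" "\<And>v. v \<in> carrier V \<Longrightarrow> \<Phi> (tensor_incl V v) = c v"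
    using tensor_algebra_lift[OF V Z c] by blast

  define \<mu> where "\<mu> = (\<lambda>x t. p (u x t))"
  have p2: "lin ?P2 Y p"
    by (rule lin_tensor_square[OF M alg_hom_lin[OF p]])
  have \<mu>: "bilin ?D2 ?V2 Y \<mu>"
    unfolding \<mu>_def by (rule bilin_comp[OF u lin_ident lin_ident p2])
  have \<mu>sq: "\<mu> (sq_tensor ?D f f') (sq_tensor V v v') = \<psi> f v \<otimes>\<^bsub>Y\<^esub> \<psi> f' v'"
    if "f \<in> carrier ?D" "f' \<in> carrier ?D" "v \<in> carrier V" "v' \<in> carrier V" for f f' v v'
    using that unfolding \<mu>_def \<psi>_def usq[OF that]
    by (simp add: sq_tensor_def alg_hom_mult[OF p] tensor_incl_closed[OF M] pure_tensor_closed[OF D V])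
  have iW2: "lin ?W2 ?B (U_proj W S)"
    by (rule lin_tensor_square[OF W alg_hom_lin[OF iW]])
  \<comment> \<open>The expected degree two part of the coaction.\<close>
  define g where "g = (\<lambda>t. finsum Z (\<lambda>q. pure_tensor Y ?B (\<mu> (?DD q) t) (U_proj W S (?BB q))) ?I)"
  have g: "lin ?V2 Z g"
    unfolding g_def
  proof (rule lin_finsum_fun[OF V2 VZ])
    show "lin ?V2 Z (\<lambda>t. pure_tensor Y ?B (\<mu> (?DD q) t) (U_proj W S (?BB q)))" if "q \<in> ?I" for q
      by (rule lin_comp[OF bilin_lin_right[OF \<mu> bc(2)[OF that]] bilin_lin_left[OF pt lin_closed[OF iW2 bc(1)[OF that]]]])
  qed simp
  have \<Phi>2: "\<Phi> t = g t" if t: "t \<in> carrier ?V2" for t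
  proof (rule tensor_square_ext[OF V VZ lin_tensor_square[OF V alg_hom_lin[OF \<Phi>(1)]] g _ t])
    fix v v' assume v: "v \<in> carrier V" "v' \<in> carrier V"
    let ?h = "\<lambda>v j. pure_tensor Y ?B (\<psi> (d j) v) (\<beta> (b j))"
    have hc: "?h v j \<in> carrier Z" "?h v' j \<in> carrier Z" if "j < n" for j
      using lin_closed[OF summand[OF that] v(1)] lin_closed[OF summand[OF that] v(2)] by auto
    note cc = lin_closed[OF c v(1)] lin_closed[OF c v(2)]
    have mult: "?h v j \<otimes>\<^bsub>Z\<^esub> ?h v' k = pure_tensor Y ?B (\<mu> (?DD (j, k)) (sq_tensor V v v')) (U_proj W S (?BB (j, k)))"
      if jk: "j < n" "k < n" for j k
    proof -
      have "?h v j \<otimes>\<^bsub>Z\<^esub> ?h v' k = pure_tensor Y ?B (\<psi> (d j) v \<otimes>\<^bsub>Y\<^esub> \<psi> (d k) v') (\<beta> (b j) \<otimes>\<^bsub>?B\<^esub> \<beta> (b k))"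
        unfolding Z_def using jk v bilinD(1)[OF \<psi>] lin_closed[OF \<beta>] dbD(1,2)
        by (intro pure_tensor_mult[OF Y B]) auto
      also have "\<psi> (d j) v \<otimes>\<^bsub>Y\<^esub> \<psi> (d k) v' = \<mu> (?DD (j, k)) (sq_tensor V v v')"
        using \<mu>sq[OF dbD(2)[OF jk(1)] dbD(2)[OF jk(2)] v] by (simp add: sq_basis_def)
      also have "\<beta> (b j) \<otimes>\<^bsub>?B\<^esub> \<beta> (b k) = U_proj W S (?BB (j, k))"
        using alg_hom_mult[OF iW tensor_incl_closed[OF W dbD(1)[OF jk(1)]] tensor_incl_closed[OF W dbD(1)[OF jk(2)]]]
        by (simp add: sq_basis_def sq_tensor_def \<beta>_def)
      finally show ?thesis .
    qed
    have "\<Phi> (sq_tensor V v v') = c v \<otimes>\<^bsub>Z\<^esub> c v'"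
      using v by (simp add: sq_tensor_def alg_hom_mult[OF \<Phi>(1)] tensor_incl_closed[OF V] \<Phi>(2))
    also have "\<dots> = finsum Z (\<lambda>j. ?h v j \<otimes>\<^bsub>Z\<^esub> c v') {..<n}"
      unfolding c_def using hc cc
      by (intro lin_finsum[OF VZ VZ bilin_lin_left[OF mZ]]) (auto simp: c_def)
    also have "\<dots> = finsum Z (\<lambda>j. finsum Z (\<lambda>k. ?h v j \<otimes>\<^bsub>Z\<^esub> ?h v' k) {..<n}) {..<n}"
    proof (rule vs_finsum_cong[OF VZ refl])
      fix j assume j: "j \<in> {..<n}"
      show "?h v j \<otimes>\<^bsub>Z\<^esub> c v' = finsum Z (\<lambda>k. ?h v j \<otimes>\<^bsub>Z\<^esub> ?h v' k) {..<n}"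
        unfolding c_def using hc j by (intro lin_finsum[OF VZ VZ bilin_lin_right[OF mZ]]) auto
      show "finsum Z (\<lambda>k. ?h v j \<otimes>\<^bsub>Z\<^esub> ?h v' k) {..<n} \<in> carrier Z"
        using hc j by (intro vs_finsum_closed[OF VZ] bilinD(1)[OF mZ]) auto
    qed
    also have "\<dots> = finsum Z (\<lambda>(j, k). ?h v j \<otimes>\<^bsub>Z\<^esub> ?h v' k) ?I"
      using hc by (intro vs_finsum_Times[OF VZ] bilinD(1)[OF mZ]) auto
    also have "\<dots> = g (sq_tensor V v v')"
      unfolding g_def
    proof (rule vs_finsum_cong[OF VZ refl])
      fix q assume q: "q \<in> ?I"
      show "(case q of (j, k) \<Rightarrow> ?h v j \<otimes>\<^bsub>Z\<^esub> ?h v' k)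
        = pure_tensor Y ?B (\<mu> (?DD q) (sq_tensor V v v')) (U_proj W S (?BB q))"
        using q mult by auto
      show "pure_tensor Y ?B (\<mu> (?DD q) (sq_tensor V v v')) (U_proj W S (?BB q)) \<in> carrier Z"
        by (intro bilinD(1)[OF pt] bilinD(1)[OF \<mu>] bc(2)[OF q] sq_tensor_closed[OF V] v lin_closed[OF iW2] bc(1)[OF q])
    qed
    finally show "\<Phi> (sq_tensor V v v') = g (sq_tensor V v v')" .
  qed

  note St = lin_maps_lin[OF sq_transpose_lin_maps[OF W db S]]
  \<comment> \<open>The image of \<open>x \<otimes> t\<close> under the coHom operator is zero in \<open>Y\<close>.\<close>
  have \<mu>R: "\<mu> x (R t) = \<mu> (sq_transpose W S x) t" if x: "x \<in> carrier ?D2" and t: "t \<in> carrier ?V2" for x t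
  proof -
    note Rt = lin_closed[OF lin_maps_lin[OF R] t] and Sx = lin_closed[OF St x]
    have "\<zero>\<^bsub>Y\<^esub> = p (Q (u x t))"
      using rel[OF bilinD(1)[OF u x t]] by (simp add: Qu)
    also have "\<dots> = (- 1) \<odot>\<^bsub>Y\<^esub> \<mu> (sq_transpose W S x) t \<oplus>\<^bsub>Y\<^esub> \<mu> x (R t)"
      using P2 bilinD(1)[OF u Sx t] bilinD(1)[OF u x Rt]
      by (simp add: Q[OF x t] \<mu>_def lin_add[OF p2] lin_smult[OF p2])
    also have "\<dots> = \<mu> x (R t) \<oplus>\<^bsub>Y\<^esub> (- 1) \<odot>\<^bsub>Y\<^esub> \<mu> (sq_transpose W S x) t"
      using VY bilinD(1)[OF \<mu> Sx t] bilinD(1)[OF \<mu> x Rt] by (intro vs_add_comm) auto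
    finally show ?thesis
      using vs_minus_eq_zero_iff[OF VY bilinD(1)[OF \<mu> x Rt] bilinD(1)[OF \<mu> Sx t]] by simp
  qed
  have \<Phi>R: "\<Phi> (R t) = \<zero>\<^bsub>Z\<^esub>" if t: "t \<in> carrier ?V2" for t
  proof -
    let ?c = "\<lambda>q r. sq_pairing W (?DD q) (S (?BB r))"
    let ?\<mu> = "\<lambda>r. \<mu> (?DD r) t" and ?\<beta> = "\<lambda>q. U_proj W S (?BB q)"
    have \<mu>c: "?\<mu> r \<in> carrier Y" if "r \<in> ?I" for r
      by (rule bilinD(1)[OF \<mu> bc(2)[OF that] t])
    have \<beta>c: "?\<beta> q \<in> carrier ?B" if "q \<in> ?I" for q
      by (rule lin_closed[OF iW2 bc(1)[OF that]])
    have tc: "pure_tensor Y ?B (?\<mu> r) (?c q r \<odot>\<^bsub>?B\<^esub> ?\<beta> q) \<in> carrier Z" if "q \<in> ?I" "r \<in> ?I" for q r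
      by (rule bilinD(1)[OF pt \<mu>c[OF that(2)] vs_smult_closed[OF VB \<beta>c[OF that(1)]]])
    have fI: "finite ?I"
      by simp
    have "\<Phi> (R t) = g (R t)"
      by (rule \<Phi>2[OF lin_closed[OF lin_maps_lin[OF R] t]])
    also have "\<dots> = finsum Z (\<lambda>q. finsum Z (\<lambda>r. pure_tensor Y ?B (?\<mu> r) (?c q r \<odot>\<^bsub>?B\<^esub> ?\<beta> q)) ?I) ?I"
      unfolding g_def
    proof (rule vs_finsum_cong[OF VZ refl])
      fix q assume q: "q \<in> ?I"
      have "\<mu> (?DD q) (R t) = \<mu> (sq_transpose W S (?DD q)) t"
        by (rule \<mu>R[OF bc(2)[OF q] t])
      also have "\<dots> = \<mu> (finsum ?D2 (\<lambda>r. ?c q r \<odot>\<^bsub>?D2\<^esub> ?DD r) ?I) t"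
        by (simp only: sq_transpose_basis[OF W db S q])
      also have "\<dots> = finsum Y (\<lambda>r. \<mu> (?c q r \<odot>\<^bsub>?D2\<^esub> ?DD r) t) ?I"
        by (rule lin_finsum[OF D2 VY bilin_lin_left[OF \<mu> t] fI]) (rule vs_smult_closed[OF D2 bc(2)])
      finally have 1: "\<mu> (?DD q) (R t) = finsum Y (\<lambda>r. \<mu> (?c q r \<odot>\<^bsub>?D2\<^esub> ?DD r) t) ?I" .
      have "pure_tensor Y ?B (\<mu> (?DD q) (R t)) (?\<beta> q)
        = finsum Z (\<lambda>r. pure_tensor Y ?B (\<mu> (?c q r \<odot>\<^bsub>?D2\<^esub> ?DD r) t) (?\<beta> q)) ?I"
        unfolding 1
        by (rule lin_finsum[OF VY VZ bilin_lin_left[OF pt \<beta>c[OF q]] fI])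
          (rule bilinD(1)[OF \<mu> vs_smult_closed[OF D2 bc(2)] t])
      also have "\<dots> = finsum Z (\<lambda>r. pure_tensor Y ?B (?\<mu> r) (?c q r \<odot>\<^bsub>?B\<^esub> ?\<beta> q)) ?I"
      proof (rule vs_finsum_cong[OF VZ refl])
        fix r assume r: "r \<in> ?I"
        show "pure_tensor Y ?B (\<mu> (?c q r \<odot>\<^bsub>?D2\<^esub> ?DD r) t) (?\<beta> q) = pure_tensor Y ?B (?\<mu> r) (?c q r \<odot>\<^bsub>?B\<^esub> ?\<beta> q)"
          by (simp only: bilinD(3)[OF \<mu> bc(2)[OF r] t] bilinD(3)[OF pt \<mu>c[OF r] \<beta>c[OF q]]
              bilinD(5)[OF pt \<mu>c[OF r] \<beta>c[OF q]])
      qed (rule tc[OF q])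
      finally show "pure_tensor Y ?B (\<mu> (?DD q) (R t)) (?\<beta> q)
        = finsum Z (\<lambda>r. pure_tensor Y ?B (?\<mu> r) (?c q r \<odot>\<^bsub>?B\<^esub> ?\<beta> q)) ?I" .
      show "finsum Z (\<lambda>r. pure_tensor Y ?B (?\<mu> r) (?c q r \<odot>\<^bsub>?B\<^esub> ?\<beta> q)) ?I \<in> carrier Z"
        by (rule vs_finsum_closed[OF VZ tc[OF q]])
    qed
    \<comment> \<open>The inner sums are now \<open>\<mu>(D\<^sub>r, t) \<otimes> S B\<^sub>r\<close>.\<close>
    also have "\<dots> = finsum Z (\<lambda>r. finsum Z (\<lambda>q. pure_tensor Y ?B (?\<mu> r) (?c q r \<odot>\<^bsub>?B\<^esub> ?\<beta> q)) ?I) ?I"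
      by (rule vs_finsum_swap[OF VZ fI fI tc])
    also have "\<dots> = \<zero>\<^bsub>Z\<^esub>"
    proof (rule vs_finsum_zero[OF VZ])
      fix r assume r: "r \<in> ?I"
      note SB = lin_closed[OF lin_maps_lin[OF S] bc(1)[OF r]]
      have "\<zero>\<^bsub>?B\<^esub> = U_proj W S (S (?BB r))"
        by (rule U_proj_rel[OF W S bc(1)[OF r], symmetric])
      also have "\<dots> = U_proj W S (finsum ?W2 (\<lambda>q. ?c q r \<odot>\<^bsub>?W2\<^esub> ?BB q) ?I)"
        by (rule arg_cong[OF sq_basis_expansion[OF W db SB]])
      also have "\<dots> = finsum ?B (\<lambda>q. U_proj W S (?c q r \<odot>\<^bsub>?W2\<^esub> ?BB q)) ?I"
        by (rule lin_finsum[OF W2 VB iW2 fI]) (rule vs_smult_closed[OF W2 bc(1)])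
      also have "\<dots> = finsum ?B (\<lambda>q. ?c q r \<odot>\<^bsub>?B\<^esub> ?\<beta> q) ?I"
        by (rule vs_finsum_cong[OF VB refl]) (simp_all only: lin_smult[OF iW2 bc(1)] vs_smult_closed[OF VB \<beta>c])
      finally have 0: "finsum ?B (\<lambda>q. ?c q r \<odot>\<^bsub>?B\<^esub> ?\<beta> q) ?I = \<zero>\<^bsub>?B\<^esub>" ..
      have "finsum Z (\<lambda>q. pure_tensor Y ?B (?\<mu> r) (?c q r \<odot>\<^bsub>?B\<^esub> ?\<beta> q)) ?I
        = pure_tensor Y ?B (?\<mu> r) (finsum ?B (\<lambda>q. ?c q r \<odot>\<^bsub>?B\<^esub> ?\<beta> q) ?I)"
        by (rule lin_finsum[OF VB VZ bilin_lin_right[OF pt \<mu>c[OF r]] fI, symmetric]) (rule vs_smult_closed[OF VB \<beta>c])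
      also have "\<dots> = \<zero>\<^bsub>Z\<^esub>"
        unfolding 0 by (rule lin_zero[OF VB VZ bilin_lin_right[OF pt \<mu>c[OF r]]])
      finally show "finsum Z (\<lambda>q. pure_tensor Y ?B (?\<mu> r) (?c q r \<odot>\<^bsub>?B\<^esub> ?\<beta> q)) ?I = \<zero>\<^bsub>Z\<^esub>" .
    qed
    finally show ?thesis .
  qed

  obtain \<phi> where \<phi>: "\<phi> \<in> extensional (carrier ?A)" "alg_hom ?A Z \<phi>"
    "\<And>x. x \<in> carrier (tensor_algebra V) \<Longrightarrow> \<phi> (U_proj V R x) = \<Phi> x"
    using U_lift[OF V R Z \<Phi>(1) \<Phi>R] by blast
  have gB: "gens ?B = \<beta> ` carrier W"
    by (simp add: U_obj_simps[OF W S] \<beta>_def)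
  have gYc: "gens Y \<subseteq> carrier Y" and gBc: "gens ?B \<subseteq> carrier ?B"
    using lin_closed[OF \<beta>] lin_closed[OF lin_comp[OF lin_tensor_incl[OF M] alg_hom_lin[OF p]]]
    by (auto simp: gB gensY)
  have cG: "c v \<in> QA_prod_gens Y ?B" if v: "v \<in> carrier V" for v
    unfolding c_def Z_def
  proof (rule lin_span_finsum[OF vec_space_tensor[OF VY VB] QA_prod_gens_subspace[OF Y B gYc gBc]])
    fix j assume "j \<in> {..<n}"
    then have j: "j < n"
      by simp
    have "\<psi> (d j) v \<in> gens Y"
      unfolding gensY \<psi>_def using pure_tensor_closed[OF D V dbD(2)[OF j] v] by blast
    moreover have "\<beta> (b j) \<in> gens ?B"
      using dbD(1)[OF j] by (simp add: gB)
    ultimately show "pure_tensor Y ?B (\<psi> (d j) v) (\<beta> (b j)) \<in> QA_prod_gens Y ?B"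
      by (rule pure_tensor_QA_prod(1)[OF Y B gYc gBc])
  qed simp
  have \<phi>c: "\<phi> a \<in> carrier (QA_prod Y ?B)" if a: "a \<in> carrier ?A" for a
  proof -
    obtain x where x: "x \<in> carrier (tensor_algebra V)" "a = U_proj V R x"
      using a unfolding U_carrier[OF V R] by auto
    have "\<Phi> x \<in> subalgebra_gen Z (QA_prod_gens Y ?B)"
      using cG QA_prod_gens_subset[OF Y B gYc gBc]
      by (intro tensor_algebra_generated[OF V Z \<Phi>(1) _ _ x(1)]) (simp_all add: \<Phi>(2) Z_def)
    then show ?thesis
      using x \<phi>(3) by (simp add: QA_prod_simps Z_def)
  qed
  have val: "\<phi> (U_proj V R (tensor_incl V v)) = c v" if "v \<in> carrier V" for v
    using that by (simp add: \<phi>(3) tensor_incl_closed[OF V] \<Phi>(2))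
  have "alg_hom ?A (QA_prod Y ?B) \<phi>"
    using \<phi>(2) \<phi>c by (simp add: alg_hom_def lin_def QA_prod_simps Z_def)
  moreover have "\<phi> ` gens ?A \<subseteq> gens (QA_prod Y ?B)"
    using val cG by (auto simp: U_obj_simps[OF V R] QA_prod_simps)
  ultimately have "\<phi> \<in> QA_hom ?A (QA_prod Y ?B)"
    using \<phi>(1) by (simp add: QA_hom_iff)
  then show ?thesis
    using val unfolding c_def Z_def \<psi>_def \<beta>_def by blast
qed

section \<open>The epimorphism\<close>

lemma dual_bases_U:
  fixes W :: "('k::field, 'w) module"
  assumes W: "vec_space W" and S: "S \<in> lin_maps (tensor_square W) (tensor_square W)" and db: "dual_bases W n b d"
    and \<pi>: "lin (U_obj (W, S)) W \<pi>" "\<And>w. w \<in> carrier W \<Longrightarrow> \<pi> (U_proj W S (tensor_incl W w)) = w"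
  shows "dual_bases (gen_space (U_obj (W, S))) n (\<lambda>j. U_proj W S (tensor_incl W (b j)))
    (\<lambda>j. \<lambda>x\<in>gens (U_obj (W, S)). d j (\<pi> x))"
proof -
  let ?B = "U_obj (W, S)" and ?G = "gen_space (U_obj (W, S))"
  let ?\<psi> = "\<lambda>w. U_proj W S (tensor_incl W w)"
  note D = dual_basesD[OF db] and VG = vec_space_U_gen_space[OF W S] and \<psi> = lin_U_gen_space[OF W S]
  have gB: "gens ?B = ?\<psi> ` carrier W"
    by (rule U_obj_simps(7)[OF W S])
  have bW: "b ` {..<n} \<subseteq> carrier W"
    using D by auto
  have "lin_span ?G (?\<psi> ` b ` {..<n}) = ?\<psi> ` lin_span W (b ` {..<n})"
    by (rule lin_span_image[OF W VG \<psi> bW, symmetric])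
  then have span: "lin_span ?G ((\<lambda>j. ?\<psi> (b j)) ` {..<n}) = carrier ?G"
    by (simp add: D(5) gen_space_simps gB image_image)
  have lp: "lin ?G W \<pi>"
    using \<pi>(1) U_gens_subset[OF W S] by (simp add: lin_def gen_space_simps subset_iff)
  have "restrict (\<lambda>x. d j (\<pi> x)) (carrier ?G) \<in> carrier (dual_space ?G)" if "j < n" for j
    unfolding carrier_dual_space by (rule restrict_lin_maps[OF VG lin_comp[OF lp D(3)[OF that]]])
  then show ?thesis
    unfolding dual_bases_def
    using span D(1,4) \<pi>(2) lin_closed[OF \<psi>] by (auto simp: gen_space_simps gB)
qed

text \<open>
  The functional \<open>d\<^sub>j\<close>, extended by the projection onto degree one and applied to the second tensor
  factor, extracts \<open>d\<^sub>j \<otimes> v\<close> from \<open>\<phi>(v) = \<Sum>\<^sub>j (d\<^sub>j \<otimes> v) \<otimes> b\<^sub>j\<close>.  As \<open>\<phi>\<close> factors through \<open>\<alpha>\<close>, these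
  generators lie in the image of \<open>\<alpha>\<close>.
\<close>

lemma coHom_arrow_surjective:
  fixes W :: "('k::field, 'w) module" and V :: "('k, 'v) module" and Y :: "('k, 'y) qalg"
    and H :: "('k, 'h) qalg"
  assumes \<WW>: "EQA_object (W, S)" and \<VV>: "EQA_object (V, R)" and db: "dual_bases W n b d"
    and Y: "assoc_algebra Y" and p: "alg_hom (tensor_algebra (tensor (dual_space W) V)) Y p"
    and surj: "p ` carrier (tensor_algebra (tensor (dual_space W) V)) = carrier Y"
    and coHom: "QA_coHom (U_obj (W, S)) (U_obj (V, R)) H \<iota> \<delta>"
    and \<phi>: "\<And>v. v \<in> carrier V \<Longrightarrow> \<phi> (U_proj V R (tensor_incl V v)) = finsum (tensor Y (U_obj (W, S)))
      (\<lambda>j. pure_tensor Y (U_obj (W, S))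
        (p (tensor_incl (tensor (dual_space W) V) (pure_tensor (dual_space W) V (d j) v)))
        (U_proj W S (tensor_incl W (b j)))) {..<n}"
    and \<alpha>: "\<alpha> \<in> QA_hom H Y"
    and factor: "\<phi> = compose (carrier (U_obj (V, R)))
      (QA_prod_map H (U_obj (W, S)) Y (U_obj (W, S)) \<alpha> (id_map (U_obj (W, S)))) \<delta>"
  shows "\<alpha> ` carrier H = carrier Y"
proof -
  let ?D = "dual_space W" and ?M = "tensor (dual_space W) V"
  let ?B = "U_obj (W, S)" and ?A = "U_obj (V, R)"
  let ?B1 = "dual_space (gen_space (U_obj (W, S)))" and ?A1 = "gen_space (U_obj (V, R))"
  have W: "vec_space W" and S: "S \<in> lin_maps (tensor_square W) (tensor_square W)"
    and V: "vec_space V" and R: "R \<in> lin_maps (tensor_square V) (tensor_square V)"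
    using \<WW> \<VV> by (simp_all add: EQA_object_def)
  note D = vec_space_dual_space[OF W] and dbD = dual_basesD[OF db]
  note M = vec_space_tensor[OF D V]
  note B = assoc_algebra_U[OF W S] and A = assoc_algebra_U[OF V R]
  have H: "assoc_algebra H" "gens H \<subseteq> carrier H"
    using coHom quadratic_algebraD[of H] by (auto simp: QA_coHom_def)
  note VY = alg_vec_space[OF Y] and VB = alg_vec_space[OF B] and VH = alg_vec_space[OF H(1)]
  note VZ = vec_space_tensor[OF VY VB] and VHB = vec_space_tensor[OF VH VB]
  have \<iota>: "lin (tensor ?B1 ?A1) (gen_space H) \<iota>" and \<delta>: "\<delta> \<in> QA_hom ?A (QA_prod H ?B)"
    and \<delta>val: "\<And>n b d a. dual_bases (gen_space ?B) n b d \<Longrightarrow> a \<in> gens ?A \<Longrightarrow>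
      \<delta> a = finsum (QA_prod H ?B) (\<lambda>j. pure_tensor H ?B (\<iota> (pure_tensor ?B1 ?A1 (d j) a)) (b j)) {..<n}"
    using coHom by (auto simp: QA_coHom_def Let_def lin_maps_lin)
  have \<alpha>h: "alg_hom H Y \<alpha>"
    using \<alpha> by (simp add: QA_hom_iff)
  note \<alpha>l = alg_hom_lin[OF \<alpha>h] and idl = lin_maps_lin[OF id_map_lin_maps[OF VB]]
  obtain \<pi> where \<pi>: "lin ?B W \<pi>" "\<And>w. w \<in> carrier W \<Longrightarrow> \<pi> (U_proj W S (tensor_incl W w)) = w"
    using U_degree_one[OF W S] by blast
  define b' where "b' = (\<lambda>j. U_proj W S (tensor_incl W (b j)))"
  define d' where "d' = (\<lambda>j. \<lambda>x\<in>gens ?B. d j (\<pi> x))"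
  have db': "dual_bases (gen_space ?B) n b' d'"
    unfolding b'_def d'_def by (rule dual_bases_U[OF W S db \<pi>])
  note dbD' = dual_basesD[OF db']
  have b'g: "b' j \<in> gens ?B" if "j < n" for j
    using dbD'(1)[OF that] by (simp add: gen_space_simps)
  then have b'c: "b' j \<in> carrier ?B" if "j < n" for j
    using that U_gens_subset[OF W S] by blast
  let ?y = "\<lambda>j v. p (tensor_incl ?M (pure_tensor ?D V (d j) v))"
  have yc: "?y j v \<in> carrier Y" if "j < n" "v \<in> carrier V" for j v
    by (rule alg_hom_closed[OF p tensor_incl_closed[OF M pure_tensor_closed[OF D V dbD(2)[OF that(1)] that(2)]]])

  have hit: "?y i v \<in> \<alpha> ` carrier H" if i: "i < n" and v: "v \<in> carrier V" for i v
  proof -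
    let ?a = "U_proj V R (tensor_incl V v)"
    have a: "?a \<in> gens ?A" "?a \<in> carrier ?A"
      using v U_gens_subset[OF V R] by (auto simp: U_obj_simps(7)[OF V R])
    define h where "h = (\<lambda>j. \<iota> (pure_tensor ?B1 ?A1 (d' j) ?a))"
    have hg: "h j \<in> gens H" if "j < n" for j
      using lin_closed[OF \<iota> pure_tensor_closed[OF vec_space_dual_space[OF vec_space_U_gen_space[OF W S]]
            vec_space_U_gen_space[OF V R] dbD'(2)[OF that]]] a
      by (simp add: h_def gen_space_simps)
    then have hc: "h j \<in> carrier H" if "j < n" for j
      using that H by blast
    note tm = tensor_map_lin_maps[OF VH VB VY VB \<alpha>l idl]
    have \<delta>c: "\<delta> ?a \<in> carrier (QA_prod H ?B)"
      using \<delta> a by (auto simp: QA_hom_iff alg_hom_closed)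
    have "\<delta> ?a = finsum (QA_prod H ?B) (\<lambda>j. pure_tensor H ?B (h j) (b' j)) {..<n}"
      unfolding h_def by (rule \<delta>val[OF db' a(1)])
    also have "\<dots> = finsum (tensor H ?B) (\<lambda>j. pure_tensor H ?B (h j) (b' j)) {..<n}"
      by (rule finsum_QA_prod[OF H(1) B H(2) U_gens_subset[OF W S]])
        (simp_all add: pure_tensor_QA_prod(2)[OF H(1) B H(2) U_gens_subset[OF W S]] hg b'g)
    finally have \<delta>a: "\<delta> ?a = finsum (tensor H ?B) (\<lambda>j. pure_tensor H ?B (h j) (b' j)) {..<n}" .
    have "\<phi> ?a = tensor_map H ?B Y ?B \<alpha> (id_map ?B) (\<delta> ?a)"
      using a \<delta>c by (simp add: factor compose_def QA_prod_map_def)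
    also have "\<dots> = finsum (tensor Y ?B) (\<lambda>j. tensor_map H ?B Y ?B \<alpha> (id_map ?B) (pure_tensor H ?B (h j) (b' j))) {..<n}"
      unfolding \<delta>a by (rule lin_finsum[OF VHB VZ lin_maps_lin[OF tm]])
        (simp_all add: pure_tensor_closed[OF VH VB] hc b'c)
    also have "\<dots> = finsum (tensor Y ?B) (\<lambda>j. pure_tensor Y ?B (\<alpha> (h j)) (b' j)) {..<n}"
    proof (rule vs_finsum_cong[OF VZ refl])
      fix j assume "j \<in> {..<n}"
      then have j: "j < n"
        by simp
      show "tensor_map H ?B Y ?B \<alpha> (id_map ?B) (pure_tensor H ?B (h j) (b' j)) = pure_tensor Y ?B (\<alpha> (h j)) (b' j)"
        using tensor_map_pure[OF VH VB VY VB \<alpha>l idl hc[OF j] b'c[OF j]] b'c[OF j] by (simp add: id_map_def)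
      show "pure_tensor Y ?B (\<alpha> (h j)) (b' j) \<in> carrier (tensor Y ?B)"
        by (rule pure_tensor_closed[OF VY VB lin_closed[OF \<alpha>l hc[OF j]] b'c[OF j]])
    qed
    finally have eq: "finsum (tensor Y ?B) (\<lambda>j. pure_tensor Y ?B (?y j v) (b' j)) {..<n}
      = finsum (tensor Y ?B) (\<lambda>j. pure_tensor Y ?B (\<alpha> (h j)) (b' j)) {..<n}"
      using \<phi>[OF v] by (simp add: b'_def)
    note di = lin_comp[OF \<pi>(1) dbD(3)[OF i]]
    have "bilin Y ?B Y (\<lambda>y x. d i (\<pi> x) \<odot>\<^bsub>Y\<^esub> y)"
      unfolding bilin_def using lin_scale_fun[OF VY di] lin_scale[OF VY lin_ident] by blast
    then obtain \<chi> where \<chi>: "\<chi> \<in> lin_maps (tensor Y ?B) Y"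
      "\<And>y x. y \<in> carrier Y \<Longrightarrow> x \<in> carrier ?B \<Longrightarrow> \<chi> (pure_tensor Y ?B y x) = d i (\<pi> x) \<odot>\<^bsub>Y\<^esub> y"
      using tensor_lift[OF VY VB VY] by blast
    \<comment> \<open>\<open>\<chi>\<close> evaluates the second factor by \<open>d\<^sub>i\<close> and so picks out the \<open>i\<close>-th summand.\<close>
    have \<chi>sum: "\<chi> (finsum (tensor Y ?B) (\<lambda>j. pure_tensor Y ?B (y j) (b' j)) {..<n}) = y i"
      if y: "\<And>j. j < n \<Longrightarrow> y j \<in> carrier Y" for y
    proof -
      have \<pi>b: "d i (\<pi> (b' j)) = (if i = j then 1 else 0)" if "j < n" for j
        using \<pi>(2)[OF dbD(1)[OF that]] dbD(4)[OF i that] by (simp add: b'_def)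
      have "\<chi> (finsum (tensor Y ?B) (\<lambda>j. pure_tensor Y ?B (y j) (b' j)) {..<n})
        = finsum Y (\<lambda>j. \<chi> (pure_tensor Y ?B (y j) (b' j))) {..<n}"
        by (rule lin_finsum[OF VZ VY lin_maps_lin[OF \<chi>(1)]]) (simp_all add: pure_tensor_closed[OF VY VB] y b'c)
      also have "\<dots> = \<chi> (pure_tensor Y ?B (y i) (b' i))"
        using i VY by (intro vs_finsum_single[OF VY]) (simp_all add: \<chi>(2) y b'c \<pi>b)
      also have "\<dots> = y i"
        using i VY by (simp add: \<chi>(2) y b'c \<pi>b)
      finally show ?thesis .
    qed
    have "?y i v = \<alpha> (h i)"
      using arg_cong[OF eq, of \<chi>] \<chi>sum[of "\<lambda>j. ?y j v"] \<chi>sum[of "\<lambda>j. \<alpha> (h j)"] yc v lin_closed[OF \<alpha>l hc] by simp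
    then show ?thesis
      using hc[OF i] by blast
  qed

  let ?N = "\<alpha> ` carrier H"
  have N: "lin_subspace Y ?N"
    by (rule lin_subspace_image[OF VH VY \<alpha>l lin_subspace_carrier[OF VH]])
  have sN: "subring ?N Y"
  proof (rule subring_of_subspace[OF Y N])
    show "\<one>\<^bsub>Y\<^esub> \<in> ?N"
      unfolding alg_hom_one[OF \<alpha>h, symmetric] by (rule imageI[OF alg_one_closed[OF H(1)]])
    show "x \<otimes>\<^bsub>Y\<^esub> y \<in> ?N" if xy: "x \<in> ?N" "y \<in> ?N" for x y
    proof -
      obtain a c where "a \<in> carrier H" "c \<in> carrier H" "x = \<alpha> a" "y = \<alpha> c"
        using xy by blast
      then show ?thesis
        by (intro image_eqI[of _ \<alpha> "a \<otimes>\<^bsub>H\<^esub> c"]) (simp_all add: alg_hom_mult[OF \<alpha>h] H(1))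
    qed
  qed
  have T: "d ` {..<n} \<subseteq> carrier ?D"
    using dbD(2) by auto
  have span: "lin_span ?M {pure_tensor ?D V f v | f v. f \<in> d ` {..<n} \<and> v \<in> carrier V} = carrier ?M"
    by (rule bilin_span[OF D V M pure_tensor_bilin[OF D V] T dual_bases_dual_span[OF W db]
          order_refl lin_span_carrier[OF V] tensor_span[OF D V]])
  have lp: "lin ?M Y (\<lambda>z. p (tensor_incl ?M z))"
    by (rule lin_comp[OF lin_tensor_incl[OF M] alg_hom_lin[OF p]])
  have "{pure_tensor ?D V f v | f v. f \<in> d ` {..<n} \<and> v \<in> carrier V} \<subseteq> {z \<in> carrier ?M. p (tensor_incl ?M z) \<in> ?N}"
    using hit dbD(2) pure_tensor_closed[OF D V] by auto
  from lin_span_least[OF lin_subspace_vimage[OF M VY lp N] this]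
  have "carrier ?M \<subseteq> {z \<in> carrier ?M. p (tensor_incl ?M z) \<in> ?N}"
    unfolding span .
  then have incl: "p (tensor_incl ?M z) \<in> ?N" if "z \<in> carrier ?M" for z
    using subsetD[OF _ that] by blast
  have "p x \<in> subalgebra_gen Y ?N" if "x \<in> carrier (tensor_algebra ?M)" for x
    by (rule tensor_algebra_generated[OF M Y p incl lin_subspace_subset[OF VY N] that])
  then have "carrier Y \<subseteq> subalgebra_gen Y ?N"
    unfolding surj[symmetric] by (rule image_subsetI)
  also have "\<dots> \<subseteq> ?N"
    by (rule subalgebra_gen_least[OF sN N order_refl])
  finally show ?thesis
    using lin_subspace_subset[OF VY N] by (intro equalityI)
qed

theorem mainTheorem7:
  fixes \<WW> :: "('k::real_normed_field, 'w) equipped"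
    and \<VV> :: "('k, 'v) equipped"
    and H :: "('k, 'h) qalg"
  assumes "EQA_object \<WW>" and "EQA_object \<VV>"
    and "QA_coHom (U_obj \<WW>) (U_obj \<VV>) H \<iota> \<delta>"
  shows "(\<exists>f. QA_epi H (U_obj (EQA_coHom \<WW> \<VV>)) f) \<and>
         quantum_subspace (U_obj (EQA_coHom \<WW> \<VV>)) H"
proof -
  obtain W S where W_eq: "\<WW> = (W, S)"
    by (cases \<WW>)
  obtain V R where V_eq: "\<VV> = (V, R)"
    by (cases \<VV>)
  note \<WW> = assms(1)[unfolded W_eq] and \<VV> = assms(2)[unfolded V_eq]
  note coHom = assms(3)[unfolded W_eq V_eq]
  let ?M = "tensor (dual_space W) V"
  have W: "vec_space W" "fin_dim W" and V: "vec_space V" "fin_dim V"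
    using \<WW> \<VV> by (simp_all add: EQA_object_def)
  obtain n b d where db: "dual_bases W n b d"
    using dual_bases_exist[OF W] by blast
  note D = vec_space_dual_space[OF W(1)]
  have fD: "fin_dim (dual_space W)"
    using dual_basesD(2)[OF db] dual_bases_dual_span[OF W(1) db]
    unfolding fin_dim_def by (intro exI[of _ "d ` {..<n}"]) auto
  note M = vec_space_tensor[OF D V(1)] and fM = fin_dim_tensor[OF D fD V]
  obtain Q where coH: "EQA_coHom (W, S) (V, R) = (?M, Q)"
    and Q: "Q \<in> lin_maps (tensor_square ?M) (tensor_square ?M)"
    using EQA_coHom_spec[OF \<WW> \<VV>] by blast
  define E where "E = U_obj (?M, Q)"
  have E: "assoc_algebra E" and iE: "alg_hom (tensor_algebra ?M) E (U_proj ?M Q)"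
    and Ec: "carrier E = U_proj ?M Q ` carrier (tensor_algebra ?M)"
    unfolding E_def by (rule assoc_algebra_U[OF M Q] alg_hom_U_proj[OF M Q] U_carrier[OF M Q])+
  note VE = alg_vec_space[OF E] and VT = vec_space_tensor_algebra[OF M]
  have gE: "gens E \<subseteq> carrier E"
    unfolding E_def by (rule U_gens_subset[OF M Q])
  have qE: "quadratic_algebra E"
    using quadratic_algebra_U_image[OF M fM Q E, of "\<lambda>x. x"]
    by (simp add: E_def[symmetric] alg_hom_def lin_ident bij_betw_def)

  \<comment> \<open>A copy of \<open>E\<close> that may serve as a test object of the universal property.\<close>
  obtain e :: "nat \<Rightarrow> _" where e: "range e \<subseteq> carrier (tensor_algebra ?M)"
    "lin_span (tensor_algebra ?M) (range e) = carrier (tensor_algebra ?M)"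
    using tensor_algebra_countable_span[OF M fM] by blast
  have eE: "range (\<lambda>i. U_proj ?M Q (e i)) = U_proj ?M Q ` range e"
    by auto
  have "range (\<lambda>i. U_proj ?M Q (e i)) \<subseteq> carrier E"
    unfolding eE Ec using e(1) by (rule image_mono)
  moreover have "lin_span E (range (\<lambda>i. U_proj ?M Q (e i))) = carrier E"
    unfolding eE Ec lin_span_image[OF VT VE alg_hom_lin[OF iE] e(1), symmetric] e(2) by (rule refl)
  ultimately obtain J :: "_ \<Rightarrow> nat \<Rightarrow> 'k" where J: "inj_on J (carrier E)"
    using countable_span_injection[OF VE] by blast
  define X where "X = transport J E"
  define K where "K = the_inv_into (carrier E) J"
  have X: "assoc_algebra X" and Jh: "alg_hom E X J" and Kh: "alg_hom X E K"
    unfolding X_def K_def by (rule assoc_algebra_transport[OF E J] alg_hom_transport[OF E J] alg_hom_transport_inv[OF E J])+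
  have Xc: "carrier X = J ` carrier E" and Xg: "gens X = J ` gens E"
    by (simp_all add: X_def transport_simps[OF E J])
  have KJ: "K (J x) = x" if "x \<in> carrier E" for x
    unfolding K_def by (rule the_inv_into_f_f[OF J that])
  have qX: "quadratic_algebra X"
    using quadratic_algebra_U_image[OF M fM Q X, of J] Jh J
    by (simp add: E_def[symmetric] bij_betw_def Xc Xg)

  define p where "p = (\<lambda>x. J (U_proj ?M Q x))"
  have p: "alg_hom (tensor_algebra ?M) X p"
    unfolding p_def by (rule alg_hom_comp[OF iE Jh])
  have psurj: "p ` carrier (tensor_algebra ?M) = carrier X"
    by (simp add: p_def Xc Ec image_image)
  have gensX: "gens X = (\<lambda>z. p (tensor_incl ?M z)) ` carrier ?M"
    by (simp add: p_def Xg E_def U_obj_simps(7)[OF M Q] image_image)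
  have rel: "p (snd (EQA_coHom (W, S) (V, R)) z) = \<zero>\<^bsub>X\<^esub>" if "z \<in> carrier (tensor_square ?M)" for z
    using U_proj_rel[OF M Q that] lin_zero[OF VE alg_vec_space[OF X] alg_hom_lin[OF Jh]]
    by (simp add: coH p_def E_def)
  obtain \<phi> where \<phi>: "\<phi> \<in> QA_hom (U_obj (V, R)) (QA_prod X (U_obj (W, S)))"
    and \<phi>val: "\<And>v. v \<in> carrier V \<Longrightarrow> \<phi> (U_proj V R (tensor_incl V v)) = finsum (tensor X (U_obj (W, S)))
      (\<lambda>j. pure_tensor X (U_obj (W, S)) (p (tensor_incl ?M (pure_tensor (dual_space W) V (d j) v)))
        (U_proj W S (tensor_incl W (b j)))) {..<n}"
    using coaction_exists[OF \<WW> \<VV> db X p gensX rel] by blast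
  obtain \<alpha> where \<alpha>: "\<alpha> \<in> QA_hom H X" and factor: "\<phi> = compose (carrier (U_obj (V, R)))
      (QA_prod_map H (U_obj (W, S)) X (U_obj (W, S)) \<alpha> (id_map (U_obj (W, S)))) \<delta>"
    using coHom qX \<phi> unfolding QA_coHom_def by blast
  have \<alpha>surj: "\<alpha> ` carrier H = carrier X"
    by (rule coHom_arrow_surjective[OF \<WW> \<VV> db X p psurj coHom \<phi>val \<alpha> factor])

  have qH: "quadratic_algebra H"
    using coHom by (simp add: QA_coHom_def)
  note H = quadratic_algebraD[OF qH]
  have \<alpha>h: "alg_hom H X \<alpha>" "\<alpha> ` gens H \<subseteq> gens X"
    using \<alpha> by (simp_all add: QA_hom_iff)
  define f where "f = restrict (\<lambda>x. K (\<alpha> x)) (carrier H)"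
  have fh: "alg_hom H E f"
    unfolding f_def by (simp add: H alg_hom_comp[OF \<alpha>h(1) Kh])
  have "f ` gens H \<subseteq> gens E"
  proof
    fix y assume "y \<in> f ` gens H"
    then obtain x where x: "x \<in> gens H" "y = K (\<alpha> x)"
      using H(2) by (auto simp: f_def)
    then obtain g where "g \<in> gens E" "\<alpha> x = J g"
      using \<alpha>h(2) Xg by auto
    then show "y \<in> gens E"
      using x gE KJ by auto
  qed
  then have "f \<in> QA_hom H E"
    using fh by (simp add: QA_hom_iff f_def)
  moreover have "f ` carrier H = K ` \<alpha> ` carrier H"
    by (auto simp: f_def)
  then have "f ` carrier H = carrier E"
    unfolding \<alpha>surj Xc using KJ by (simp add: image_image)
  ultimately have "QA_epi H E f"
    using qH qE by (simp add: QA_epi_def)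
  then show ?thesis
    unfolding quantum_subspace_def W_eq V_eq coH E_def by blast
qed

end
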